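(* Let $(M,g,H)$ be a compact oriented four-dimensional Einstein manifold with skew torsion. Then, if $\omega=*H$, the torsion-free connection $D$ such that $Dg=\omega\otimes g$ is an Einstein-Weyl connection. Conversely, given a compact oriented four-dimensional Einstein-Weyl manifold $(M,[g],D)$, each metric $g$ in the conformal class, with associated one-form $\omega$ (determined by $Dg=\omega\otimes g$), defines with $H=-*\omega$ (where $*$ is the Hodge star of $g$) an Einstein manifold with skew torsion $(M,g,H)$.
   Context: Given a Riemannian manifold $(M,g)$ with Levi-Civita connection $\nabla^g$ and a three-form $H$, the metric connection with skew torsion $H$ is the connection $\nabla$ on $TM$ defined by $g(\nabla_X Y,Z)=g(\nabla^g_XY,Z)+\frac12 H(X,Y,Z)$. Its Ricci tensor is $\mathrm{Ric}^\nabla(X,Y)=\sum_i g\big((\nabla_{e_i}\nabla_X-\nabla_X\nabla_{e_i}-\nabla_{[e_i,X]})Y,e_i\big)$ for a local orthonormal frame $\{e_i\}$ (in general not symmetric), and $Z^\nabla$ denotes the trace-free part of the symmetrization of $\mathrm{Ric}^\nabla$. $*$ is the Hodge star of $g$ and the orientation; in dimension four $*H$ is a one-form, $*dH$ is a function, and $\nabla\!*\!H$ is the 2-tensor $(X,Y)\mapsto (\nabla_X( *H))(Y)$. $S$ denotes symmetrization: $S(T)(X,Y)=\frac12(T(X,Y)+T(Y,X))$. An oriented Riemannian four-manifold with three-form $(M,g,H)$ is an Einstein manifold with skew torsion if $Z^\nabla+S(\nabla\!*\!H)+\frac{*dH}{4}g=0$. Let $[g]$ be a conformal class of metrics on $M$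 ($\tilde g\simeq g$ if $\tilde g=e^fg$ with $f$ a smooth real function). A Weyl connection is a torsion-free affine connection $D$ such that for any representative $g$ there is a one-form $\omega$ with $Dg=\omega\otimes g$. A Weyl manifold is a manifold with a conformal structure and a compatible Weyl connection $D$. It is Einstein-Weyl (and $D$ is called an Einstein-Weyl connection) if the trace-free symmetric part of the Ricci tensor of $D$ vanishes. *)

theory Defs
  imports "HOL-Analysis.Analysis" "HOL-Library.Function_Algebras"
begin

text \<open>
  The libraries contain no smooth manifolds, so the required differential geometry is built here,
  in dimension four, on the model space \<^typ>\<open>real^4\<close>. A manifold is a topological type \<open>'m\<close> together
  with a smooth oriented atlas \<open>A\<close>. All tensorial objects act on sections over open
  sets (\<open>\<dots>_on U\<close>); sections are total functions whose values outside \<open>U\<close> are irrelevant.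
\<close>

instantiation "fun" :: (type, real_vector) real_vector
begin

definition scaleR_fun :: "real \<Rightarrow> ('a \<Rightarrow> 'b) \<Rightarrow> 'a \<Rightarrow> 'b"
  where "scaleR_fun a f = (\<lambda>x. a *\<^sub>R f x)"

instance
  by standard (simp_all add: scaleR_fun_def fun_eq_iff scaleR_right_distrib scaleR_left_distrib)

end


section \<open>Smooth maps and oriented manifolds\<close>

primrec Ck_on :: "nat \<Rightarrow> 'a::real_normed_vector set \<Rightarrow> ('a \<Rightarrow> 'b::real_normed_vector) \<Rightarrow> bool" where
  "Ck_on 0 S f \<longleftrightarrow> continuous_on S f"
| "Ck_on (Suc k) S f \<longleftrightarrow>
     (\<forall>x\<in>S. f differentiable (at x)) \<and> (\<forall>v. Ck_on k S (\<lambda>x. frechet_derivative f (at x) v))"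

text \<open>Used for open \<open>S\<close> in a finite-dimensional space only.\<close>

definition smooth_on :: "'a::real_normed_vector set \<Rightarrow> ('a \<Rightarrow> 'b::real_normed_vector) \<Rightarrow> bool"
  where "smooth_on S f \<longleftrightarrow> (\<forall>k. Ck_on k S f)"

text \<open>A chart is a pair of its domain and its coordinate map.\<close>

type_synonym 'm chart = "'m set \<times> ('m \<Rightarrow> real^4)"
type_synonym 'm atlas = "'m chart set"

abbreviation dom :: "'m chart \<Rightarrow> 'm set" where "dom c \<equiv> fst c"
abbreviation coords :: "'m chart \<Rightarrow> 'm \<Rightarrow> real^4" where "coords c \<equiv> snd c"

definition param :: "'m chart \<Rightarrow> real^4 \<Rightarrow> 'm"
  where "param c = inv_into (dom c) (coords c)"

definition is_chart :: "('m::topological_space) chart \<Rightarrow> bool"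
  where "is_chart c \<longleftrightarrow> open (dom c) \<and> open (coords c ` dom c) \<and>
           homeomorphism (dom c) (coords c ` dom c) (coords c) (param c)"

definition transition :: "'m chart \<Rightarrow> 'm chart \<Rightarrow> real^4 \<Rightarrow> real^4"
  where "transition c c' = coords c' \<circ> param c"

definition smooth_atlas :: "('m::topological_space) atlas \<Rightarrow> bool"
  where "smooth_atlas A \<longleftrightarrow>
     (\<forall>c\<in>A. is_chart c) \<and> (\<Union>c\<in>A. dom c) = UNIV \<and>
     (\<forall>c\<in>A. \<forall>c'\<in>A. smooth_on (coords c ` (dom c \<inter> dom c')) (transition c c'))"

definition oriented_atlas :: "('m::topological_space) atlas \<Rightarrow> bool"
  where "oriented_atlas A \<longleftrightarrow> smooth_atlas A \<and>
     (\<forall>c\<in>A. \<forall>c'\<in>A. \<forall>p\<in>dom c \<inter> dom c'.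
        det (matrix (frechet_derivative (transition c c') (at (coords c p)))) > 0)"


section \<open>Tangent vectors and vector fields\<close>

text \<open>
  A tangent vector at \<open>p\<close> is a family of component vectors, one for each chart of the atlas around \<open>p\<close>,
  transforming by the Jacobians of the transition maps. On all other arguments it is set to \<open>0\<close>,
  so that \<open>tangent A p\<close> is a four-dimensional subspace of the function space \<open>'m tvec\<close>.
\<close>

type_synonym 'm tvec = "'m chart \<Rightarrow> real^4"
type_synonym 'm field = "'m \<Rightarrow> 'm tvec"
type_synonym 'm metric = "'m \<Rightarrow> 'm tvec \<Rightarrow> 'm tvec \<Rightarrow> real"
type_synonym 'm form1 = "'m \<Rightarrow> 'm tvec \<Rightarrow> real"
type_synonym 'm form3 = "'m \<Rightarrow> 'm tvec \<Rightarrow> 'm tvec \<Rightarrow> 'm tvec \<Rightarrow> real"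
type_synonym 'm connection = "'m field \<Rightarrow> 'm field \<Rightarrow> 'm field"

text \<open>2-tensors are only ever evaluated on (local) vector fields.\<close>

type_synonym 'm tensor2 = "'m field \<Rightarrow> 'm field \<Rightarrow> 'm \<Rightarrow> real"

context
  fixes A :: "('m::topological_space) atlas"
begin

definition tangent :: "'m \<Rightarrow> 'm tvec set"
  where "tangent p = {v.
     (\<forall>c\<in>A. \<forall>c'\<in>A. p \<in> dom c \<longrightarrow> p \<in> dom c' \<longrightarrow>
        v c' = frechet_derivative (transition c c') (at (coords c p)) (v c)) \<and>
     (\<forall>c. \<not> (c \<in> A \<and> p \<in> dom c) \<longrightarrow> v c = 0)}"

definition smooth_fun_on :: "'m set \<Rightarrow> ('m \<Rightarrow> real) \<Rightarrow> bool"
  where "smooth_fun_on U f \<longleftrightarrow> (\<forall>c\<in>A. smooth_on (coords c ` (U \<inter> dom c)) (f \<circ> param c))"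

definition smooth_field_on :: "'m set \<Rightarrow> 'm field \<Rightarrow> bool"
  where "smooth_field_on U X \<longleftrightarrow> (\<forall>p\<in>U. X p \<in> tangent p) \<and>
     (\<forall>c\<in>A. smooth_on (coords c ` (U \<inter> dom c)) (\<lambda>x. X (param c x) c))"

definition smooth_field_near :: "'m \<Rightarrow> 'm field \<Rightarrow> bool"
  where "smooth_field_near p X \<longleftrightarrow> (\<exists>U. open U \<and> p \<in> U \<and> smooth_field_on U X)"

definition chart_at :: "'m \<Rightarrow> 'm chart"
  where "chart_at p = (SOME c. c \<in> A \<and> p \<in> dom c)"

text \<open>The directional derivative \<open>X f\<close>; it does not depend on the chart used.\<close>

definition deriv_along :: "'m field \<Rightarrow> ('m \<Rightarrow> real) \<Rightarrow> 'm \<Rightarrow> real"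
  where "deriv_along X f p = (let c = chart_at p in
     frechet_derivative (f \<circ> param c) (at (coords c p)) (X p c))"

definition lie_bracket :: "'m field \<Rightarrow> 'm field \<Rightarrow> 'm field"
  where "lie_bracket X Y p c =
     (if c \<in> A \<and> p \<in> dom c
      then frechet_derivative (\<lambda>x. Y (param c x) c) (at (coords c p)) (X p c)
         - frechet_derivative (\<lambda>x. X (param c x) c) (at (coords c p)) (Y p c)
      else 0)"

text \<open>The coordinate field \<open>\<partial>\<^sub>i\<close> of the chart \<open>c\<close>, a section over \<open>dom c\<close>.\<close>

definition coord_field :: "'m chart \<Rightarrow> 4 \<Rightarrow> 'm field"
  where "coord_field c i p c' =
     (if c' \<in> A \<and> p \<in> dom c'
      then frechet_derivative (transition c c') (at (coords c p)) (axis i 1) else 0)"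


section \<open>Metrics, forms, frames and the Hodge star\<close>

definition riemannian_metric :: "'m metric \<Rightarrow> bool"
  where "riemannian_metric g \<longleftrightarrow>
     (\<forall>p. \<forall>u\<in>tangent p. \<forall>v\<in>tangent p.
        g p u v = g p v u \<and>
        (\<forall>w\<in>tangent p. g p (u + w) v = g p u v + g p w v) \<and>
        (\<forall>a. g p (a *\<^sub>R u) v = a * g p u v) \<and>
        (u \<noteq> 0 \<longrightarrow> g p u u > 0)) \<and>
     (\<forall>U X Y. open U \<longrightarrow> smooth_field_on U X \<longrightarrow> smooth_field_on U Y \<longrightarrow>
        smooth_fun_on U (\<lambda>p. g p (X p) (Y p)))"

definition one_form :: "'m form1 \<Rightarrow> bool"
  where "one_form \<omega> \<longleftrightarrow>
     (\<forall>p. \<forall>u\<in>tangent p. (\<forall>v\<in>tangent p. \<omega> p (u + v) = \<omega> p u + \<omega> p v) \<and>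
        (\<forall>a. \<omega> p (a *\<^sub>R u) = a * \<omega> p u)) \<and>
     (\<forall>U X. open U \<longrightarrow> smooth_field_on U X \<longrightarrow> smooth_fun_on U (\<lambda>p. \<omega> p (X p)))"

definition three_form :: "'m form3 \<Rightarrow> bool"
  where "three_form H \<longleftrightarrow>
     (\<forall>p. \<forall>u\<in>tangent p. \<forall>v\<in>tangent p. \<forall>w\<in>tangent p.
        (\<forall>u'\<in>tangent p. H p (u + u') v w = H p u v w + H p u' v w) \<and>
        (\<forall>a. H p (a *\<^sub>R u) v w = a * H p u v w) \<and>
        H p v u w = - H p u v w \<and> H p u w v = - H p u v w) \<and>
     (\<forall>U X Y Z. open U \<longrightarrow> smooth_field_on U X \<longrightarrow> smooth_field_on U Y \<longrightarrow> smooth_field_on U Z \<longrightarrow>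
        smooth_fun_on U (\<lambda>p. H p (X p) (Y p) (Z p)))"

text \<open>
  \<open>E\<close> is a smooth, positively oriented, orthonormal frame on some neighbourhood of \<open>p\<close>.
  The constructions below that use a chosen frame are independent of the choice.
\<close>

definition oriented_frame_near :: "'m metric \<Rightarrow> 'm \<Rightarrow> (4 \<Rightarrow> 'm field) \<Rightarrow> bool"
  where "oriented_frame_near g p E \<longleftrightarrow> (\<exists>U. open U \<and> p \<in> U \<and>
     (\<forall>i. smooth_field_on U (E i)) \<and>
     (\<forall>q\<in>U. \<forall>i j. g q (E i q) (E j q) = (if i = j then 1 else 0)) \<and>
     (\<forall>q\<in>U. \<forall>c\<in>A. q \<in> dom c \<longrightarrow> det (\<chi> i. E i q c) > 0))"

definition frame :: "'m metric \<Rightarrow> 'm \<Rightarrow> 4 \<Rightarrow> 'm field"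
  where "frame g p = (SOME E. oriented_frame_near g p E)"

definition vol :: "'m metric \<Rightarrow> 'm \<Rightarrow> (4 \<Rightarrow> 'm tvec) \<Rightarrow> real"
  where "vol g p v = det (\<chi> i j. g p (frame g p i p) (v j))"

definition tuple4 :: "'a \<Rightarrow> 'a \<Rightarrow> 'a \<Rightarrow> 'a \<Rightarrow> 4 \<Rightarrow> 'a"
  where "tuple4 a b c d i = (if i = 1 then a else if i = 2 then b else if i = 3 then c else d)"

text \<open>
  The Hodge star of a \<open>k\<close>-form is
  \<open>(*\<alpha>)(v\<^sub>1,\<dots>) = 1/k! \<Sum>\<alpha>(e\<^sub>i\<^sub>1,\<dots>,e\<^sub>i\<^sub>k) vol(e\<^sub>i\<^sub>1,\<dots>,e\<^sub>i\<^sub>k,v\<^sub>1,\<dots>)\<close>, i.e.\ \<open>\<alpha> \<and> *\<beta> = g(\<alpha>,\<beta>) vol\<close>.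
  On three-forms and one-forms in dimension four it satisfies \<open>** = -1\<close>.
\<close>

definition hodge1 :: "'m metric \<Rightarrow> 'm form1 \<Rightarrow> 'm form3"
  where "hodge1 g \<omega> p u v w = (let e = (\<lambda>i. frame g p i p) in
     \<Sum>i\<in>UNIV. \<omega> p (e i) * vol g p (tuple4 (e i) u v w))"

definition hodge3 :: "'m metric \<Rightarrow> 'm form3 \<Rightarrow> 'm form1"
  where "hodge3 g H p v = (let e = (\<lambda>i. frame g p i p) in
     (\<Sum>i\<in>UNIV. \<Sum>j\<in>UNIV. \<Sum>k\<in>UNIV.
        H p (e i) (e j) (e k) * vol g p (tuple4 (e i) (e j) (e k) v)) / fact 3)"

definition ext_deriv3 :: "'m form3 \<Rightarrow> 'm field \<Rightarrow> 'm field \<Rightarrow> 'm field \<Rightarrow> 'm field \<Rightarrow> 'm \<Rightarrow> real"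
  where "ext_deriv3 H W X Y Z p =
       deriv_along W (\<lambda>q. H q (X q) (Y q) (Z q)) p
     - deriv_along X (\<lambda>q. H q (W q) (Y q) (Z q)) p
     + deriv_along Y (\<lambda>q. H q (W q) (X q) (Z q)) p
     - deriv_along Z (\<lambda>q. H q (W q) (X q) (Y q)) p
     - H p (lie_bracket W X p) (Y p) (Z p)
     + H p (lie_bracket W Y p) (X p) (Z p)
     - H p (lie_bracket W Z p) (X p) (Y p)
     - H p (lie_bracket X Y p) (W p) (Z p)
     + H p (lie_bracket X Z p) (W p) (Y p)
     - H p (lie_bracket Y Z p) (W p) (X p)"

text \<open>The function \<open>*dH\<close>: a four-form evaluated on an oriented orthonormal basis.\<close>

definition hodge_ext_deriv3 :: "'m metric \<Rightarrow> 'm form3 \<Rightarrow> 'm \<Rightarrow> real"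
  where "hodge_ext_deriv3 g H p = (let E = frame g p in ext_deriv3 H (E 1) (E 2) (E 3) (E 4) p)"


section \<open>Connections\<close>

text \<open>
  Connections act on locally defined sections; hence locality is one of the conditions.
  The first condition is a convention that makes a connection uniquely determined as a function:
  the value at \<open>p\<close> is \<open>0\<close> unless both arguments are smooth vector fields near \<open>p\<close>.
\<close>

definition affine_connection :: "'m connection \<Rightarrow> bool"
  where "affine_connection D \<longleftrightarrow>
     (\<forall>X Y p. \<not> (smooth_field_near p X \<and> smooth_field_near p Y) \<longrightarrow> D X Y p = 0) \<and>
     (\<forall>U X X' Y Y'. open U \<longrightarrow> (\<forall>p\<in>U. X p = X' p \<and> Y p = Y' p) \<longrightarrow>
        (\<forall>p\<in>U. D X Y p = D X' Y' p)) \<and>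
     (\<forall>U X Y. open U \<longrightarrow> smooth_field_on U X \<longrightarrow> smooth_field_on U Y \<longrightarrow>
        smooth_field_on U (D X Y)) \<and>
     (\<forall>U X X' Y Y' f. open U \<longrightarrow> smooth_fun_on U f \<longrightarrow>
        smooth_field_on U X \<longrightarrow> smooth_field_on U X' \<longrightarrow>
        smooth_field_on U Y \<longrightarrow> smooth_field_on U Y' \<longrightarrow>
        (\<forall>p\<in>U. D (X + X') Y p = D X Y p + D X' Y p \<and>
                D (\<lambda>q. f q *\<^sub>R X q) Y p = f p *\<^sub>R D X Y p \<and>
                D X (Y + Y') p = D X Y p + D X Y' p \<and>
                D X (\<lambda>q. f q *\<^sub>R Y q) p = deriv_along X f p *\<^sub>R Y p + f p *\<^sub>R D X Y p))"

definition torsion_free :: "'m connection \<Rightarrow> bool"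
  where "torsion_free D \<longleftrightarrow> (\<forall>U X Y. open U \<longrightarrow> smooth_field_on U X \<longrightarrow> smooth_field_on U Y \<longrightarrow>
     (\<forall>p\<in>U. D X Y p - D Y X p = lie_bracket X Y p))"

definition metric_deriv :: "'m connection \<Rightarrow> 'm metric \<Rightarrow> 'm field \<Rightarrow> 'm field \<Rightarrow> 'm field \<Rightarrow> 'm \<Rightarrow> real"
  where "metric_deriv D g X Y Z p =
     deriv_along X (\<lambda>q. g q (Y q) (Z q)) p - g p (D X Y p) (Z p) - g p (Y p) (D X Z p)"

definition metric_deriv_eq :: "'m connection \<Rightarrow> 'm metric \<Rightarrow> 'm form1 \<Rightarrow> bool" \<comment> \<open>\<open>Dg = \<omega> \<otimes> g\<close>\<close>
  where "metric_deriv_eq D g \<omega> \<longleftrightarrow> (\<forall>U X Y Z. open U \<longrightarrow>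
     smooth_field_on U X \<longrightarrow> smooth_field_on U Y \<longrightarrow> smooth_field_on U Z \<longrightarrow>
     (\<forall>p\<in>U. metric_deriv D g X Y Z p = \<omega> p (X p) * g p (Y p) (Z p)))"

definition levi_civita :: "'m metric \<Rightarrow> 'm connection \<Rightarrow> bool"
  where "levi_civita g D \<longleftrightarrow> affine_connection D \<and> torsion_free D \<and> metric_deriv_eq D g (\<lambda>_ _. 0)"

definition skew_torsion_connection :: "'m metric \<Rightarrow> 'm form3 \<Rightarrow> 'm connection \<Rightarrow> bool"
  where "skew_torsion_connection g H D \<longleftrightarrow> affine_connection D \<and>
     (\<exists>Dg. levi_civita g Dg \<and> (\<forall>U X Y Z. open U \<longrightarrow>
        smooth_field_on U X \<longrightarrow> smooth_field_on U Y \<longrightarrow> smooth_field_on U Z \<longrightarrow>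
        (\<forall>p\<in>U. g p (D X Y p) (Z p) = g p (Dg X Y p) (Z p) + 1/2 * H p (X p) (Y p) (Z p))))"

definition curvature :: "'m connection \<Rightarrow> 'm field \<Rightarrow> 'm field \<Rightarrow> 'm field \<Rightarrow> 'm field"
  where "curvature D X Y Z = D X (D Y Z) - D Y (D X Z) - D (lie_bracket X Y) Z"

text \<open>The Ricci tensor with respect to a local orthonormal frame of \<open>g\<close>.\<close>

definition metric_ricci :: "'m metric \<Rightarrow> 'm connection \<Rightarrow> 'm tensor2"
  where "metric_ricci g D X Y p = (let E = frame g p in
     \<Sum>i\<in>UNIV. g p (curvature D (E i) X Y p) (E i p))"

text \<open>
  The Ricci tensor of an affine connection: the trace of the endomorphism
  \<open>V \<mapsto> R(V, X) Y\<close> of the tangent space, computed in a coordinate basis.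
\<close>

definition affine_ricci :: "'m connection \<Rightarrow> 'm tensor2"
  where "affine_ricci D X Y p = (let c = chart_at p in
     trace (\<chi> i j. curvature D (coord_field c j) X Y p c $ i))"

definition cov_deriv1 :: "'m connection \<Rightarrow> 'm form1 \<Rightarrow> 'm tensor2"
  where "cov_deriv1 D \<omega> X Y p = deriv_along X (\<lambda>q. \<omega> q (Y q)) p - \<omega> p (D X Y p)"

definition symmetrization :: "'m tensor2 \<Rightarrow> 'm tensor2"
  where "symmetrization T X Y p = 1/2 * (T X Y p + T Y X p)"

definition metric_trace :: "'m metric \<Rightarrow> 'm tensor2 \<Rightarrow> 'm \<Rightarrow> real"
  where "metric_trace g T p = (let E = frame g p in \<Sum>i\<in>UNIV. T (E i) (E i) p)"

definition trace_free_part :: "'m metric \<Rightarrow> 'm tensor2 \<Rightarrow> 'm tensor2"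
  where "trace_free_part g T X Y p = T X Y p - metric_trace g T p / 4 * g p (X p) (Y p)"


section \<open>Einstein manifolds with skew torsion and Einstein-Weyl manifolds\<close>

definition einstein_skew_torsion :: "'m metric \<Rightarrow> 'm form3 \<Rightarrow> bool"
  where "einstein_skew_torsion g H \<longleftrightarrow> riemannian_metric g \<and> three_form H \<and>
     (\<exists>D. skew_torsion_connection g H D \<and>
        (\<forall>U X Y. open U \<longrightarrow> smooth_field_on U X \<longrightarrow> smooth_field_on U Y \<longrightarrow>
           (\<forall>p\<in>U. trace_free_part g (symmetrization (metric_ricci g D)) X Y p
                 + symmetrization (cov_deriv1 D (hodge3 g H)) X Y p
                 + hodge_ext_deriv3 g H p / 4 * g p (X p) (Y p) = 0)))"

definition conformal_class :: "'m metric \<Rightarrow> 'm metric set"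
  where "conformal_class g = {g'. riemannian_metric g' \<and>
     (\<exists>f. smooth_fun_on UNIV f \<and>
        (\<forall>p. \<forall>u\<in>tangent p. \<forall>v\<in>tangent p. g' p u v = exp (f p) * g p u v))}"

definition conformal_structure :: "'m metric set \<Rightarrow> bool"
  where "conformal_structure C \<longleftrightarrow> (\<exists>g. riemannian_metric g \<and> C = conformal_class g)"

definition weyl_connection :: "'m metric set \<Rightarrow> 'm connection \<Rightarrow> bool"
  where "weyl_connection C D \<longleftrightarrow> affine_connection D \<and> torsion_free D \<and>
     (\<forall>g\<in>C. \<exists>\<omega>. one_form \<omega> \<and> metric_deriv_eq D g \<omega>)"

definition einstein_weyl :: "'m metric set \<Rightarrow> 'm connection \<Rightarrow> bool"
  where "einstein_weyl C D \<longleftrightarrow> conformal_structure C \<and> weyl_connection C D \<and>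
     (\<forall>g\<in>C. \<forall>U X Y. open U \<longrightarrow> smooth_field_on U X \<longrightarrow> smooth_field_on U Y \<longrightarrow>
        (\<forall>p\<in>U. trace_free_part g (symmetrization (affine_ricci D)) X Y p = 0))"

end

end

theory Submission
  imports Defs
begin

text \<open>
  Let \<open>\<nabla>\<close> be the Levi-Civita connection of \<open>g\<close> and \<open>\<omega> = *H\<close>. By the Koszul formula the torsion-free
  connection \<open>D\<close> with \<open>Dg = \<omega> \<otimes> g\<close> is \<open>\<nabla>\<close> plus the tensor with lowered form
  \<open>b(X,Y,Z) = 1/2 (\<omega>(Z) g(X,Y) - \<omega>(X) g(Y,Z) - \<omega>(Y) g(X,Z))\<close>, whereas the connection \<open>T\<close> with skew torsion
  is \<open>\<nabla>\<close> plus \<open>1/2 H\<close>. In dimension four the quadratic contributions of both tensors to the symmetrized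
  Ricci curvature agree: both are \<open>1/2 (\<omega> \<otimes> \<omega> - |\<omega>|\<^sup>2 g)\<close>, for \<open>1/2 H\<close> because
  \<open>\<Sum> H(X,e\<^sub>i,e\<^sub>j) H(Y,e\<^sub>i,e\<^sub>j) = 2 (|\<omega>|\<^sup>2 g(X,Y) - \<omega>(X) \<omega>(Y))\<close>. The linear contribution of \<open>H\<close> is skew and that
  of \<open>b\<close> is \<open>S(\<nabla>\<omega>) + 1/2 (div \<omega>) g\<close>. Since \<open>*dH = - div \<omega>\<close>, the tensor \<open>Z\<^sup>T + S(T\<omega>) + (*dH/4) g\<close>
  coincides with the trace-free symmetric Ricci tensor of \<open>D\<close>, which gives both directions.
\<close>

section \<open>Smooth maps between normed spaces\<close>

lemma Ck_on_subset: "Ck_on k S f \<Longrightarrow> T \<subseteq> S \<Longrightarrow> Ck_on k T f"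
  by (induction k arbitrary: f) (auto intro: continuous_on_subset)

lemma Ck_on_Suc_imp: "Ck_on (Suc k) S f \<Longrightarrow> Ck_on k S f"
proof (induction k arbitrary: f)
  case 0
  then show ?case
    by (simp add: continuous_at_imp_continuous_on differentiable_imp_continuous_within)
next
  case (Suc k)
  then show ?case by (metis Ck_on.simps(2))
qed

lemma Ck_on_cong:
  assumes "open S" "\<And>x. x \<in> S \<Longrightarrow> f x = g x" "Ck_on k S f"
  shows "Ck_on k S g"
  using assms(2,3)
proof (induction k arbitrary: f g)
  case 0
  then show ?case by (auto intro: continuous_on_eq)
next
  case (Suc k)
  have d: "\<forall>x\<in>S. f differentiable (at x)" and c: "\<And>v. Ck_on k S (\<lambda>x. frechet_derivative f (at x) v)"
    using Suc.prems(2) by auto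
  have "g differentiable (at x)" if "x \<in> S" for x
    using d that Suc.prems(1) assms(1)
    by (metis (no_types, lifting) differentiable_def has_derivative_transform_within_open)
  moreover have "frechet_derivative f (at x) = frechet_derivative g (at x)" if "x \<in> S" for x
    using frechet_derivative_transform_within_open[of f x S g] d that Suc.prems(1) assms(1) by blast
  moreover have "Ck_on k S (\<lambda>x. frechet_derivative g (at x) v)" for v
    by (rule Suc.IH[OF _ c[of v]]) (simp add: calculation)
  ultimately show ?case
    by auto
qed

lemma Ck_on_Union:
  assumes "\<And>T. T \<in> \<T> \<Longrightarrow> open T" "\<And>T. T \<in> \<T> \<Longrightarrow> Ck_on k T f"
  shows "Ck_on k (\<Union>\<T>) f"
  using assms(2)
proof (induction k arbitrary: f)
  case 0
  then show ?case
    using assms(1) continuous_on_open_Union[of \<T> f] by auto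
qed auto

lemma Ck_on_const [simp]: "Ck_on k S (\<lambda>x. c)"
  by (induction k arbitrary: c) simp_all

lemma Ck_on_SucI:
  assumes "open S" "\<And>x. x \<in> S \<Longrightarrow> (f has_derivative f' x) (at x)" "\<And>v. Ck_on k S (\<lambda>x. f' x v)"
  shows "Ck_on (Suc k) S f"
proof -
  have "frechet_derivative f (at x) = f' x" if "x \<in> S" for x
    using assms(2)[OF that] frechet_derivative_at by metis
  then show ?thesis
    using assms Ck_on_cong[OF assms(1), of "\<lambda>x. f' x v" "\<lambda>x. frechet_derivative f (at x) v" k for v]
    by (auto simp: differentiable_def)
qed

lemma Ck_on_SucD:
  assumes "Ck_on (Suc k) S f" "x \<in> S"
  shows "(f has_derivative frechet_derivative f (at x)) (at x)"
  using assms frechet_derivative_works by auto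

lemma Ck_on_add:
  assumes "open S" "Ck_on k S f" "Ck_on k S g"
  shows "Ck_on k S (\<lambda>x. f x + g x)"
  using assms(2,3)
proof (induction k arbitrary: f g)
  case 0
  then show ?case by (auto intro: continuous_intros)
next
  case (Suc k)
  show ?case
    by (rule Ck_on_SucI[OF assms(1) has_derivative_add[OF Ck_on_SucD Ck_on_SucD]])
      (use Suc in auto)
qed

lemma Ck_on_linear:
  assumes "open S" "bounded_linear L" "Ck_on k S f"
  shows "Ck_on k S (\<lambda>x. L (f x))"
  using assms(3)
proof (induction k arbitrary: f)
  case 0
  then show ?case using bounded_linear.continuous_on[OF assms(2)] by auto
next
  case (Suc k)
  show ?case
    by (rule Ck_on_SucI[OF assms(1) bounded_linear.has_derivative[OF assms(2) Ck_on_SucD]])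
      (use Suc in auto)
qed

lemma Ck_on_bilinear:
  assumes "open S" "bounded_bilinear B" "Ck_on k S f" "Ck_on k S g"
  shows "Ck_on k S (\<lambda>x. B (f x) (g x))"
  using assms(3,4)
proof (induction k arbitrary: f g)
  case 0
  then show ?case using bounded_bilinear.continuous_on[OF assms(2)] by auto
next
  case (Suc k)
  have "Ck_on k S f" "Ck_on k S g"
    using Suc.prems Ck_on_Suc_imp by blast+
  then show ?case
    by (intro Ck_on_SucI[OF assms(1) bounded_bilinear.FDERIV[OF assms(2) Ck_on_SucD Ck_on_SucD]]
        Ck_on_add[OF assms(1)] Suc.IH)
      (use Suc.prems in auto)
qed

lemma Ck_on_sum:
  assumes "open S" "\<And>i. i \<in> I \<Longrightarrow> Ck_on k S (f i)"
  shows "Ck_on k S (\<lambda>x. \<Sum>i\<in>I. f i x)"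
  using assms(2) by (induction I rule: infinite_finite_induct) (auto intro: Ck_on_add[OF assms(1)])

lemma frechet_derivative_Basis_expand:
  fixes f :: "'a::euclidean_space \<Rightarrow> 'b::real_normed_vector"
  assumes "f differentiable (at x)"
  shows "frechet_derivative f (at x) v = (\<Sum>b\<in>Basis. (v \<bullet> b) *\<^sub>R frechet_derivative f (at x) b)"
proof -
  have l: "linear (frechet_derivative f (at x))"
    using assms by (rule linear_frechet_derivative)
  have "frechet_derivative f (at x) v = frechet_derivative f (at x) (\<Sum>b\<in>Basis. (v \<bullet> b) *\<^sub>R b)"
    by (simp add: euclidean_representation)
  then show ?thesis
    by (simp add: linear_sum[OF l] linear_scale[OF l])
qed

lemma Ck_on_compose:
  fixes f :: "'b::euclidean_space \<Rightarrow> 'c::real_normed_vector"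
  assumes "open S" "open T" "g ` S \<subseteq> T" "Ck_on k T f" "Ck_on k S g"
  shows "Ck_on k S (\<lambda>x. f (g x))"
  using assms(4,5)
proof (induction k arbitrary: f)
  case 0
  then show ?case using assms(3) by (auto intro: continuous_on_compose2)
next
  case (Suc k)
  have g: "Ck_on k S g"
    using Suc.prems Ck_on_Suc_imp by blast
  have d: "((\<lambda>x. f (g x)) has_derivative
     (\<lambda>v. \<Sum>b\<in>Basis. (frechet_derivative g (at x) v \<bullet> b) *\<^sub>R frechet_derivative f (at (g x)) b)) (at x)"
    if "x \<in> S" for x
  proof -
    have fd: "f differentiable (at (g x))"
      using Suc.prems(1) that assms(3) by auto
    then have "((\<lambda>x. f (g x)) has_derivative
       (\<lambda>v. frechet_derivative f (at (g x)) (frechet_derivative g (at x) v))) (at x)"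
      using has_derivative_compose[OF Ck_on_SucD[OF Suc.prems(2) that],
          of f "frechet_derivative f (at (g x))"] frechet_derivative_works by auto
    then show ?thesis
      by (subst (asm) frechet_derivative_Basis_expand[OF fd])
  qed
  show ?case
    by (intro Ck_on_SucI[OF assms(1) d] Ck_on_sum[OF assms(1)]
        Ck_on_bilinear[OF assms(1) bounded_bilinear_scaleR] Suc.IH
        Ck_on_linear[OF assms(1) bounded_linear_inner_left])
      (use Suc.prems g in auto)
qed

lemma Ck_on_powr: "Ck_on k {0<..} (\<lambda>x::real. x powr a)"
proof (induction k arbitrary: a)
  case 0
  then show ?case by (auto intro!: continuous_intros)
next
  case (Suc k)
  have d: "((\<lambda>x. x powr a) has_derivative (\<lambda>v. v *\<^sub>R (a * x powr (a - 1)))) (at x)" if "x \<in> {0<..}" for x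
  proof -
    have "((\<lambda>x. x powr a) has_field_derivative (a * x powr (a - 1))) (at x)"
      using that by (intro has_real_derivative_powr) simp
    then show ?thesis
      by (simp add: has_field_derivative_def mult_commute_abs)
  qed
  show ?case
    by (rule Ck_on_SucI[OF _ d]) 
      (auto intro!: Ck_on_bilinear[OF _ bounded_bilinear_mult] Suc.IH)
qed

lemma Ck_on_exp: "Ck_on k UNIV (exp :: real \<Rightarrow> real)"
proof (induction k)
  case 0
  show ?case by (auto intro!: continuous_intros)
next
  case (Suc k)
  have d: "((exp :: real \<Rightarrow> real) has_derivative (\<lambda>v. v *\<^sub>R exp x)) (at x)" for x
    using DERIV_exp[of x] by (simp add: has_field_derivative_def mult_commute_abs)
  show ?case
    by (rule Ck_on_SucI[OF open_UNIV d],
        rule Ck_on_bilinear[OF open_UNIV bounded_bilinear_scaleR Ck_on_const Suc.IH])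
qed

lemma smooth_on_subset: "smooth_on S f \<Longrightarrow> T \<subseteq> S \<Longrightarrow> smooth_on T f"
  unfolding smooth_on_def using Ck_on_subset by blast

lemma smooth_on_cong:
  "open S \<Longrightarrow> smooth_on S f \<Longrightarrow> (\<And>x. x \<in> S \<Longrightarrow> f x = g x) \<Longrightarrow> smooth_on S g"
  unfolding smooth_on_def using Ck_on_cong by metis

lemma smooth_on_local:
  assumes "\<And>x. x \<in> S \<Longrightarrow> \<exists>T. open T \<and> x \<in> T \<and> T \<subseteq> S \<and> smooth_on T f"
  shows "smooth_on S f"
proof -
  have "S = \<Union>{T. open T \<and> T \<subseteq> S \<and> smooth_on T f}"
    using assms by blast
  moreover have "Ck_on k (\<Union>{T. open T \<and> T \<subseteq> S \<and> smooth_on T f}) f" for k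
    by (rule Ck_on_Union) (auto simp: smooth_on_def)
  ultimately show ?thesis
    unfolding smooth_on_def by simp
qed

lemma smooth_on_const [simp]: "smooth_on S (\<lambda>x. c)"
  by (simp add: smooth_on_def)

lemma smooth_on_add: "open S \<Longrightarrow> smooth_on S f \<Longrightarrow> smooth_on S g \<Longrightarrow> smooth_on S (\<lambda>x. f x + g x)"
  by (simp add: smooth_on_def Ck_on_add)

lemma smooth_on_linear: "open S \<Longrightarrow> bounded_linear L \<Longrightarrow> smooth_on S f \<Longrightarrow> smooth_on S (\<lambda>x. L (f x))"
  by (simp add: smooth_on_def Ck_on_linear)

lemma smooth_on_bilinear:
  "open S \<Longrightarrow> bounded_bilinear B \<Longrightarrow> smooth_on S f \<Longrightarrow> smooth_on S g \<Longrightarrow> smooth_on S (\<lambda>x. B (f x) (g x))"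
  by (simp add: smooth_on_def Ck_on_bilinear)

lemmas smooth_on_mult = smooth_on_bilinear[OF _ bounded_bilinear_mult]
lemmas smooth_on_scaleR = smooth_on_bilinear[OF _ bounded_bilinear_scaleR]
lemmas smooth_on_vec_nth = smooth_on_linear[OF _ bounded_linear_vec_nth]

lemma smooth_on_sum:
  "open S \<Longrightarrow> (\<And>i. i \<in> I \<Longrightarrow> smooth_on S (f i)) \<Longrightarrow> smooth_on S (\<lambda>x. \<Sum>i\<in>I. f i x)"
  by (simp add: smooth_on_def Ck_on_sum)

lemma smooth_on_compose:
  fixes f :: "'b::euclidean_space \<Rightarrow> 'c::real_normed_vector"
  shows "open S \<Longrightarrow> open T \<Longrightarrow> g ` S \<subseteq> T \<Longrightarrow> smooth_on T f \<Longrightarrow> smooth_on S g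
    \<Longrightarrow> smooth_on S (\<lambda>x. f (g x))"
  by (metis smooth_on_def Ck_on_compose)

lemma smooth_on_powr:
  fixes f :: "'a::real_normed_vector \<Rightarrow> real"
  assumes "open S" "smooth_on S f" "\<And>x. x \<in> S \<Longrightarrow> f x > 0"
  shows "smooth_on S (\<lambda>x. f x powr a)"
  by (rule smooth_on_compose[OF assms(1), where T = "{0<..}" and f = "\<lambda>x. x powr a"])
    (use assms in \<open>auto simp: smooth_on_def Ck_on_powr\<close>)

lemma smooth_on_imp_differentiable: "smooth_on S f \<Longrightarrow> x \<in> S \<Longrightarrow> f differentiable (at x)"
  unfolding smooth_on_def by (metis Ck_on.simps(2))

lemma smooth_on_imp_continuous_on: "smooth_on S f \<Longrightarrow> continuous_on S f"
  unfolding smooth_on_def by (metis Ck_on.simps(1))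

lemma smooth_on_frechet_derivative:
  assumes "smooth_on S f"
  shows "smooth_on S (\<lambda>x. frechet_derivative f (at x) v)"
  unfolding smooth_on_def
proof
  show "Ck_on k S (\<lambda>x. frechet_derivative f (at x) v)" for k
    using assms[unfolded smooth_on_def, rule_format, of "Suc k"] by auto
qed

lemma smooth_on_frechet_derivative_var:
  fixes f :: "'a::euclidean_space \<Rightarrow> 'b::real_normed_vector"
  assumes "open S" "smooth_on S f" "smooth_on S X"
  shows "smooth_on S (\<lambda>x. frechet_derivative f (at x) (X x))"
proof (rule smooth_on_cong[OF assms(1)])
  show "smooth_on S (\<lambda>x. \<Sum>b\<in>Basis. (X x \<bullet> b) *\<^sub>R frechet_derivative f (at x) b)"
    by (intro smooth_on_sum smooth_on_scaleR smooth_on_frechet_derivative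
        smooth_on_linear[OF _ bounded_linear_inner_left] assms)
  show "(\<Sum>b\<in>Basis. (X x \<bullet> b) *\<^sub>R frechet_derivative f (at x) b) = frechet_derivative f (at x) (X x)"
    if "x \<in> S" for x
    using frechet_derivative_Basis_expand[of f x "X x"] smooth_on_imp_differentiable[OF assms(2) that] by simp
qed

section \<open>Smooth functions and fields on an oriented manifold\<close>

lemma scaleR_fun_apply [simp]: "(a *\<^sub>R f) x = a *\<^sub>R f x"
  by (simp add: scaleR_fun_def)

locale oriented_manifold =
  fixes A :: "('m::topological_space) atlas"
  assumes oriented: "oriented_atlas A"
begin

lemma is_chart: "c \<in> A \<Longrightarrow> is_chart c"
  using oriented unfolding oriented_atlas_def smooth_atlas_def by blast

lemma open_dom: "c \<in> A \<Longrightarrow> open (dom c)"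
  using is_chart unfolding is_chart_def by blast

lemma open_Int_dom: "c \<in> A \<Longrightarrow> open U \<Longrightarrow> open (U \<inter> dom c)"
  using open_dom open_Int by blast

lemma open_coords: "c \<in> A \<Longrightarrow> open (coords c ` dom c)"
  using is_chart unfolding is_chart_def by blast

lemma param_coords [simp]: "c \<in> A \<Longrightarrow> p \<in> dom c \<Longrightarrow> param c (coords c p) = p"
  using is_chart unfolding is_chart_def homeomorphism_def by blast

lemma param_coords_pair [simp]: "(D, \<phi>) \<in> A \<Longrightarrow> p \<in> D \<Longrightarrow> param (D, \<phi>) (\<phi> p) = p"
  using param_coords[of "(D, \<phi>)"] by simp

lemma continuous_coords: "c \<in> A \<Longrightarrow> continuous_on (dom c) (coords c)"
  using is_chart unfolding is_chart_def homeomorphism_def by blast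

lemma continuous_param: "c \<in> A \<Longrightarrow> continuous_on (coords c ` dom c) (param c)"
  using is_chart unfolding is_chart_def homeomorphism_def by blast

lemma open_coords_image:
  assumes "c \<in> A" "open U"
  shows "open (coords c ` (U \<inter> dom c))"
proof -
  have "coords c ` (U \<inter> dom c) = param c -` U \<inter> coords c ` dom c"
    using assms(1) by auto
  then show ?thesis
    using continuous_on_open_vimage[OF open_coords[OF assms(1)]] continuous_param assms by metis
qed

lemma ex_chart: "\<exists>c\<in>A. p \<in> dom c"
  using oriented unfolding oriented_atlas_def smooth_atlas_def by blast

lemma chart_at: "chart_at A p \<in> A" "p \<in> dom (chart_at A p)"
proof -
  have "chart_at A p \<in> A \<and> p \<in> dom (chart_at A p)"
    unfolding chart_at_def by (rule someI_ex) (use ex_chart in blast)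
  then show "chart_at A p \<in> A" "p \<in> dom (chart_at A p)" by auto
qed

lemma smooth_transition:
  "c \<in> A \<Longrightarrow> c' \<in> A \<Longrightarrow> smooth_on (coords c ` (dom c \<inter> dom c')) (transition c c')"
  using oriented unfolding oriented_atlas_def smooth_atlas_def by blast

lemma transition_coords [simp]:
  "c \<in> A \<Longrightarrow> p \<in> dom c \<Longrightarrow> transition c c' (coords c p) = coords c' p"
  by (simp add: transition_def)

definition jac :: "'m chart \<Rightarrow> 'm chart \<Rightarrow> 'm \<Rightarrow> real^4 \<Rightarrow> real^4"
  where "jac c c' p = frechet_derivative (transition c c') (at (coords c p))"

lemma transition_differentiable:
  assumes "c \<in> A" "c' \<in> A" "p \<in> dom c" "p \<in> dom c'"
  shows "transition c c' differentiable (at (coords c p))"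
  using smooth_on_imp_differentiable[OF smooth_transition[OF assms(1,2)]] assms by blast

lemma has_derivative_transition:
  assumes "c \<in> A" "c' \<in> A" "p \<in> dom c" "p \<in> dom c'"
  shows "(transition c c' has_derivative jac c c' p) (at (coords c p))"
  using transition_differentiable[OF assms] frechet_derivative_works unfolding jac_def by blast

lemma linear_jac:
  assumes "c \<in> A" "c' \<in> A" "p \<in> dom c" "p \<in> dom c'"
  shows "linear (jac c c' p)"
  using has_derivative_linear[OF has_derivative_transition[OF assms]] .

lemma det_jac:
  assumes "c \<in> A" "c' \<in> A" "p \<in> dom c" "p \<in> dom c'"
  shows "det (matrix (jac c c' p)) > 0"
  using oriented assms unfolding oriented_atlas_def jac_def by blast

lemma jac_compose:
  assumes "c \<in> A" "c' \<in> A" "c'' \<in> A" "p \<in> dom c" "p \<in> dom c'" "p \<in> dom c''"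
  shows "jac c' c'' p (jac c c' p v) = jac c c'' p v"
proof -
  have "((\<lambda>x. transition c' c'' (transition c c' x)) has_derivative (\<lambda>v. jac c' c'' p (jac c c' p v)))
      (at (coords c p))"
    using has_derivative_compose[OF has_derivative_transition[of c c' p],
        of "transition c' c''" "jac c' c'' p"]
      has_derivative_transition[of c' c'' p] assms by simp
  then have "(transition c c'' has_derivative (\<lambda>v. jac c' c'' p (jac c c' p v))) (at (coords c p))"
    by (rule has_derivative_transform_within_open[where s = "coords c ` (dom c' \<inter> dom c)"])
      (use assms open_coords_image[OF assms(1) open_dom[OF assms(2)]] in auto)
  then show ?thesis
    using has_derivative_unique[OF _ has_derivative_transition[of c c'' p]] assms
    by (metis (no_types))
qed

lemma jac_same [simp]:
  assumes "c \<in> A" "p \<in> dom c"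
  shows "jac c c p v = v"
proof -
  have "(transition c c has_derivative (\<lambda>v. v)) (at (coords c p))"
    by (rule has_derivative_transform_within_open[where s = "coords c ` dom c" and f = "\<lambda>x. x"])
      (use assms open_coords in \<open>auto intro: has_derivative_ident\<close>)
  then show ?thesis
    using has_derivative_unique[OF _ has_derivative_transition[of c c p]] assms by (metis (no_types))
qed

lemma tangent_iff:
  "v \<in> tangent A p \<longleftrightarrow>
    (\<forall>c\<in>A. \<forall>c'\<in>A. p \<in> dom c \<longrightarrow> p \<in> dom c' \<longrightarrow> v c' = jac c c' p (v c)) \<and>
    (\<forall>c. \<not> (c \<in> A \<and> p \<in> dom c) \<longrightarrow> v c = 0)"
  by (simp add: tangent_def jac_def)

lemma tangentI:
  assumes "\<And>c c'. c \<in> A \<Longrightarrow> c' \<in> A \<Longrightarrow> p \<in> dom c \<Longrightarrow> p \<in> dom c' \<Longrightarrow> v c' = jac c c' p (v c)"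
    "\<And>c. \<not> (c \<in> A \<and> p \<in> dom c) \<Longrightarrow> v c = 0"
  shows "v \<in> tangent A p"
  using assms unfolding tangent_iff by blast

lemma tangent_jac:
  "v \<in> tangent A p \<Longrightarrow> c \<in> A \<Longrightarrow> c' \<in> A \<Longrightarrow> p \<in> dom c \<Longrightarrow> p \<in> dom c' \<Longrightarrow> v c' = jac c c' p (v c)"
  unfolding tangent_iff by blast

lemma tangent_outside: "v \<in> tangent A p \<Longrightarrow> \<not> (c \<in> A \<and> p \<in> dom c) \<Longrightarrow> v c = 0"
  unfolding tangent_iff by blast

lemma tangent_0 [simp]: "0 \<in> tangent A p"
  by (rule tangentI) (simp_all add: linear_0[OF linear_jac])

lemma tangent_add [intro]:
  assumes "u \<in> tangent A p" "v \<in> tangent A p"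
  shows "u + v \<in> tangent A p"
proof (rule tangentI)
  fix c c' assume c: "c \<in> A" "c' \<in> A" "p \<in> dom c" "p \<in> dom c'"
  show "(u + v) c' = jac c c' p ((u + v) c)"
    by (simp only: plus_fun_apply linear_add[OF linear_jac[OF c]]
        flip: tangent_jac[OF assms(1) c] tangent_jac[OF assms(2) c])
next
  fix c assume "\<not> (c \<in> A \<and> p \<in> dom c)"
  then show "(u + v) c = 0"
    using tangent_outside[OF assms(1)] tangent_outside[OF assms(2)] by simp
qed

lemma tangent_scaleR [intro]:
  assumes "u \<in> tangent A p"
  shows "a *\<^sub>R u \<in> tangent A p"
proof (rule tangentI)
  fix c c' assume c: "c \<in> A" "c' \<in> A" "p \<in> dom c" "p \<in> dom c'"
  show "(a *\<^sub>R u) c' = jac c c' p ((a *\<^sub>R u) c)"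
    by (simp only: scaleR_fun_apply linear_scale[OF linear_jac[OF c]] flip: tangent_jac[OF assms c])
next
  fix c assume "\<not> (c \<in> A \<and> p \<in> dom c)"
  then show "(a *\<^sub>R u) c = 0"
    using tangent_outside[OF assms] by simp
qed

lemma subspace_tangent: "subspace (tangent A p)"
  by (auto simp: subspace_def)

lemma tangent_diff [intro]: "u \<in> tangent A p \<Longrightarrow> v \<in> tangent A p \<Longrightarrow> u - v \<in> tangent A p"
  using subspace_diff[OF subspace_tangent] .

lemma tangent_uminus [intro]: "u \<in> tangent A p \<Longrightarrow> - u \<in> tangent A p"
  using subspace_neg[OF subspace_tangent] .

lemma tangent_sum [intro]: "(\<And>i. i \<in> I \<Longrightarrow> f i \<in> tangent A p) \<Longrightarrow> (\<Sum>i\<in>I. f i) \<in> tangent A p"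
  using subspace_sum[OF subspace_tangent] .

lemma tangent_eqI:
  assumes "u \<in> tangent A p" "v \<in> tangent A p" "c \<in> A" "p \<in> dom c" "u c = v c"
  shows "u = v"
proof
  fix c'
  show "u c' = v c'"
    using assms(5) tangent_jac[OF assms(1,3) _ assms(4)] tangent_jac[OF assms(2,3) _ assms(4)]
      tangent_outside[OF assms(1)] tangent_outside[OF assms(2)]
    by (metis (no_types))
qed

lemma coord_field_eq: "coord_field A c i p c' = (if c' \<in> A \<and> p \<in> dom c' then jac c c' p (axis i 1) else 0)"
  by (simp add: coord_field_def jac_def)

lemma coord_field_tangent:
  assumes "c \<in> A" "p \<in> dom c"
  shows "coord_field A c i p \<in> tangent A p"
  by (rule tangentI) (use assms jac_compose in \<open>auto simp: coord_field_eq\<close>)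

lemma smooth_fun_onD: "smooth_fun_on A U f \<Longrightarrow> c \<in> A \<Longrightarrow> smooth_on (coords c ` (U \<inter> dom c)) (\<lambda>x. f (param c x))"
  by (simp add: smooth_fun_on_def o_def)

lemma smooth_fun_onI:
  "(\<And>c. c \<in> A \<Longrightarrow> smooth_on (coords c ` (U \<inter> dom c)) (\<lambda>x. f (param c x))) \<Longrightarrow> smooth_fun_on A U f"
  by (simp add: smooth_fun_on_def o_def)

lemma smooth_field_onD: "smooth_field_on A U X \<Longrightarrow> c \<in> A \<Longrightarrow> smooth_on (coords c ` (U \<inter> dom c)) (\<lambda>x. X (param c x) c)"
  by (simp add: smooth_field_on_def)

lemma smooth_field_tangent: "smooth_field_on A U X \<Longrightarrow> p \<in> U \<Longrightarrow> X p \<in> tangent A p"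
  by (simp add: smooth_field_on_def)

lemma smooth_fun_on_subset: "smooth_fun_on A U f \<Longrightarrow> V \<subseteq> U \<Longrightarrow> smooth_fun_on A V f"
  unfolding smooth_fun_on_def by (blast intro: smooth_on_subset)

lemma smooth_field_on_subset: "smooth_field_on A U f \<Longrightarrow> V \<subseteq> U \<Longrightarrow> smooth_field_on A V f"
  unfolding smooth_field_on_def by (blast intro: smooth_on_subset)

lemma smooth_fun_on_cong:
  assumes "open U" "smooth_fun_on A U f" "\<And>p. p \<in> U \<Longrightarrow> f p = h p"
  shows "smooth_fun_on A U h"
proof (rule smooth_fun_onI)
  fix c assume c: "c \<in> A"
  show "smooth_on (coords c ` (U \<inter> dom c)) (\<lambda>x. h (param c x))"
    by (rule smooth_on_cong[OF open_coords_image[OF c assms(1)] smooth_fun_onD[OF assms(2) c]])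
      (use c assms(3) in auto)
qed

lemma smooth_field_on_cong:
  assumes "open U" "smooth_field_on A U X" "\<And>p. p \<in> U \<Longrightarrow> X p = Y p"
  shows "smooth_field_on A U Y"
  unfolding smooth_field_on_def
proof (intro conjI ballI)
  fix c assume c: "c \<in> A"
  show "smooth_on (coords c ` (U \<inter> dom c)) (\<lambda>x. Y (param c x) c)"
    by (rule smooth_on_cong[OF open_coords_image[OF c assms(1)] smooth_field_onD[OF assms(2) c]])
      (use c assms(3) in auto)
qed (use smooth_field_tangent[OF assms(2)] assms(3) in auto)

lemma smooth_fun_on_local:
  assumes "\<And>p. p \<in> U \<Longrightarrow> \<exists>V. open V \<and> p \<in> V \<and> V \<subseteq> U \<and> smooth_fun_on A V f"
  shows "smooth_fun_on A U f"
proof (rule smooth_fun_onI, rule smooth_on_local)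
  fix c x assume c: "c \<in> A" and "x \<in> coords c ` (U \<inter> dom c)"
  then obtain p where p: "p \<in> U" "p \<in> dom c" "x = coords c p" by blast
  then obtain V where V: "open V" "p \<in> V" "V \<subseteq> U" "smooth_fun_on A V f"
    using assms by blast
  show "\<exists>T. open T \<and> x \<in> T \<and> T \<subseteq> coords c ` (U \<inter> dom c) \<and> smooth_on T (\<lambda>x. f (param c x))"
    by (rule exI[of _ "coords c ` (V \<inter> dom c)"])
      (use V p c open_coords_image smooth_fun_onD in auto)
qed

lemma smooth_field_on_local:
  assumes "\<And>p. p \<in> U \<Longrightarrow> \<exists>V. open V \<and> p \<in> V \<and> V \<subseteq> U \<and> smooth_field_on A V X"
  shows "smooth_field_on A U X"
  unfolding smooth_field_on_def
proof (intro conjI ballI)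
  fix c assume c: "c \<in> A"
  show "smooth_on (coords c ` (U \<inter> dom c)) (\<lambda>x. X (param c x) c)"
  proof (rule smooth_on_local)
    fix x assume "x \<in> coords c ` (U \<inter> dom c)"
    then obtain p where p: "p \<in> U" "p \<in> dom c" "x = coords c p" by blast
    then obtain V where V: "open V" "p \<in> V" "V \<subseteq> U" "smooth_field_on A V X"
      using assms by blast
    show "\<exists>T. open T \<and> x \<in> T \<and> T \<subseteq> coords c ` (U \<inter> dom c) \<and> smooth_on T (\<lambda>x. X (param c x) c)"
      by (rule exI[of _ "coords c ` (V \<inter> dom c)"])
        (use V p c open_coords_image smooth_field_onD in auto)
  qed
qed (use assms smooth_field_tangent in blast)

lemma smooth_fun_on_const [simp]: "smooth_fun_on A U (\<lambda>p. a)"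
  by (auto intro: smooth_fun_onI)

lemma smooth_fun_on_add:
  "open U \<Longrightarrow> smooth_fun_on A U f \<Longrightarrow> smooth_fun_on A U h \<Longrightarrow> smooth_fun_on A U (\<lambda>p. f p + h p)"
  by (rule smooth_fun_onI, rule smooth_on_add) (simp_all add: open_coords_image smooth_fun_onD)

lemma smooth_fun_on_mult:
  "open U \<Longrightarrow> smooth_fun_on A U f \<Longrightarrow> smooth_fun_on A U h \<Longrightarrow> smooth_fun_on A U (\<lambda>p. f p * h p)"
  by (rule smooth_fun_onI, rule smooth_on_mult) (simp_all add: open_coords_image smooth_fun_onD)

lemma smooth_fun_on_cmult:
  "open U \<Longrightarrow> smooth_fun_on A U f \<Longrightarrow> smooth_fun_on A U (\<lambda>p. a * f p)"
  by (intro smooth_fun_on_mult smooth_fun_on_const)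

lemma smooth_fun_on_uminus:
  "open U \<Longrightarrow> smooth_fun_on A U f \<Longrightarrow> smooth_fun_on A U (\<lambda>p. - f p)"
  using smooth_fun_on_cmult[of U f "-1"] by simp

lemma smooth_fun_on_diff:
  "open U \<Longrightarrow> smooth_fun_on A U f \<Longrightarrow> smooth_fun_on A U h \<Longrightarrow> smooth_fun_on A U (\<lambda>p. f p - h p)"
  using smooth_fun_on_add[of U f "\<lambda>p. - h p"] smooth_fun_on_uminus by simp

lemma smooth_fun_on_sum:
  "open U \<Longrightarrow> (\<And>i. i \<in> I \<Longrightarrow> smooth_fun_on A U (f i)) \<Longrightarrow> smooth_fun_on A U (\<lambda>p. \<Sum>i\<in>I. f i p)"
  by (rule smooth_fun_onI, rule smooth_on_sum) (simp_all add: open_coords_image smooth_fun_onD)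

lemma smooth_fun_on_prod:
  "open U \<Longrightarrow> (\<And>i. i \<in> I \<Longrightarrow> smooth_fun_on A U (f i)) \<Longrightarrow> smooth_fun_on A U (\<lambda>p. \<Prod>i\<in>I. f i p)"
  by (induction I rule: infinite_finite_induct) (auto intro: smooth_fun_on_mult)

lemma smooth_fun_on_powr:
  assumes "open U" "smooth_fun_on A U f" "\<And>p. p \<in> U \<Longrightarrow> f p > 0"
  shows "smooth_fun_on A U (\<lambda>p. f p powr a)"
  by (rule smooth_fun_onI, rule smooth_on_powr) (use assms in \<open>auto simp: open_coords_image smooth_fun_onD\<close>)

lemma smooth_field_on_0 [simp]: "smooth_field_on A U (\<lambda>p. 0)" "smooth_field_on A U 0"
  by (auto simp: smooth_field_on_def)

lemma smooth_field_on_add: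
  "open U \<Longrightarrow> smooth_field_on A U X \<Longrightarrow> smooth_field_on A U Y \<Longrightarrow> smooth_field_on A U (\<lambda>p. X p + Y p)"
  by (auto simp: smooth_field_on_def intro: smooth_on_add open_coords_image)

lemma smooth_field_on_scaleR:
  "open U \<Longrightarrow> smooth_fun_on A U f \<Longrightarrow> smooth_field_on A U X \<Longrightarrow> smooth_field_on A U (\<lambda>p. f p *\<^sub>R X p)"
  by (auto simp: smooth_field_on_def intro!: smooth_on_scaleR open_coords_image smooth_fun_onD)

lemma smooth_field_on_cscaleR:
  "open U \<Longrightarrow> smooth_field_on A U X \<Longrightarrow> smooth_field_on A U (\<lambda>p. a *\<^sub>R X p)"
  by (intro smooth_field_on_scaleR smooth_fun_on_const)

lemma smooth_field_on_diff:
  "open U \<Longrightarrow> smooth_field_on A U X \<Longrightarrow> smooth_field_on A U Y \<Longrightarrow> smooth_field_on A U (\<lambda>p. X p - Y p)"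
  using smooth_field_on_add[of U X "\<lambda>p. (-1) *\<^sub>R Y p"] smooth_field_on_cscaleR[of U Y "-1"] by simp

lemma smooth_field_on_sum:
  "open U \<Longrightarrow> (\<And>i. i \<in> I \<Longrightarrow> smooth_field_on A U (X i)) \<Longrightarrow> smooth_field_on A U (\<lambda>p. \<Sum>i\<in>I. X i p)"
  by (induction I rule: infinite_finite_induct) (auto intro: smooth_field_on_add)

lemma smooth_on_transition_compose:
  fixes h :: "real^4 \<Rightarrow> 'b::real_normed_vector"
  assumes "c \<in> A" "c' \<in> A" "open U" "smooth_on (coords c ` (U \<inter> dom c)) h"
  shows "smooth_on (coords c' ` (U \<inter> dom c \<inter> dom c')) (\<lambda>x. h (coords c (param c' x)))"
proof (rule smooth_on_compose[where f = h and T = "coords c ` (U \<inter> dom c)"])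
  have "open (U \<inter> dom c)"
    using assms open_dom by blast
  then show op: "open (coords c' ` (U \<inter> dom c \<inter> dom c'))"
    by (rule open_coords_image[OF assms(2)])
  have "smooth_on (coords c' ` (U \<inter> dom c \<inter> dom c')) (transition c' c)"
    by (rule smooth_on_subset[OF smooth_transition]) (use assms in auto)
  then show "smooth_on (coords c' ` (U \<inter> dom c \<inter> dom c')) (\<lambda>x. coords c (param c' x))"
    by (rule smooth_on_cong[OF op]) (simp add: transition_def)
qed (use assms open_coords_image in auto)

lemma smooth_fun_on_chartI:
  assumes "c \<in> A" "open U" "U \<subseteq> dom c" "smooth_on (coords c ` U) (\<lambda>x. f (param c x))"
  shows "smooth_fun_on A U f"
proof (rule smooth_fun_onI)
  fix c' assume c': "c' \<in> A"
  have U: "U \<inter> dom c = U" using assms by auto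
  show "smooth_on (coords c' ` (U \<inter> dom c')) (\<lambda>x. f (param c' x))"
    by (rule smooth_on_cong[OF open_coords_image[OF c' assms(2)]
          smooth_on_transition_compose[OF assms(1) c' assms(2), of "\<lambda>x. f (param c x)", unfolded U]])
      (use assms c' in auto)
qed

lemma smooth_field_on_chartI:
  assumes "c \<in> A" "open U" "U \<subseteq> dom c" "smooth_on (coords c ` U) (\<lambda>x. X (param c x) c)"
    "\<And>p. p \<in> U \<Longrightarrow> X p \<in> tangent A p"
  shows "smooth_field_on A U X"
  unfolding smooth_field_on_def
proof (intro conjI ballI)
  fix c' assume c': "c' \<in> A"
  have U: "U \<inter> dom c = U" using assms by auto
  let ?h = "\<lambda>x. frechet_derivative (transition c c') (at x) (X (param c x) c)"
  have W: "(U \<inter> dom c') \<inter> dom c = U \<inter> dom c'" using assms by auto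
  have h: "smooth_on (coords c ` (U \<inter> dom c')) ?h"
  proof (rule smooth_on_frechet_derivative_var)
    show "open (coords c ` (U \<inter> dom c'))"
      using open_coords_image[OF assms(1) open_Int[OF assms(2) open_dom[OF c']]] unfolding W .
    show "smooth_on (coords c ` (U \<inter> dom c')) (transition c c')"
      by (rule smooth_on_subset[OF smooth_transition[OF assms(1) c']]) (use assms in auto)
    show "smooth_on (coords c ` (U \<inter> dom c')) (\<lambda>x. X (param c x) c)"
      by (rule smooth_on_subset[OF assms(4)]) auto
  qed
  have W2: "(U \<inter> dom c') \<inter> dom c' = U \<inter> dom c'" using assms by auto
  show "smooth_on (coords c' ` (U \<inter> dom c')) (\<lambda>x. X (param c' x) c')"
  proof (rule smooth_on_cong[OF open_coords_image[OF c' assms(2)]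
          smooth_on_transition_compose[OF assms(1) c', of "U \<inter> dom c'" ?h, unfolded W W2]])
    show "open (U \<inter> dom c')" using open_dom[OF c'] assms(2) by blast
    fix x assume "x \<in> coords c' ` (U \<inter> dom c')"
    then obtain p where p: "p \<in> U" "p \<in> dom c'" "x = coords c' p" by blast
    have "p \<in> dom c" using p assms by blast
    then show "frechet_derivative (transition c c') (at (coords c (param c' x)))
          (X (param c (coords c (param c' x))) c) = X (param c' x) c'"
      using p c' assms(1) tangent_jac[OF assms(5), of p c c'] by (simp add: jac_def)
  qed (rule h)
qed (use assms in auto)

lemma smooth_coord_field:
  assumes "c \<in> A"
  shows "smooth_field_on A (dom c) (coord_field A c i)"
proof (rule smooth_field_on_chartI[OF assms open_dom[OF assms] subset_refl])
  show "smooth_on (coords c ` dom c) (\<lambda>x. coord_field A c i (param c x) c)"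
    by (rule smooth_on_cong[OF open_coords[OF assms] smooth_on_const[of _ "axis i 1"]])
      (use assms in \<open>auto simp: coord_field_eq\<close>)
qed (use coord_field_tangent assms in auto)

lemma smooth_component:
  assumes "c \<in> A" "open U" "smooth_field_on A U X"
  shows "smooth_fun_on A (U \<inter> dom c) (\<lambda>p. X p c $ j)"
proof (rule smooth_fun_on_chartI[OF assms(1)])
  show "smooth_on (coords c ` (U \<inter> dom c)) (\<lambda>x. X (param c x) c $ j)"
    by (intro smooth_on_vec_nth open_coords_image assms smooth_field_onD)
qed (use assms open_Int_dom in blast)+

lemma smooth_fun_on_continuous:
  assumes "open U" "smooth_fun_on A U f"
  shows "continuous_on U f"
proof -
  have "continuous_on (U \<inter> dom c) f" if c: "c \<in> A" for c
  proof -
    have "continuous_on (U \<inter> dom c) (\<lambda>p. f (param c (coords c p)))"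
      by (rule continuous_on_compose2[OF smooth_on_imp_continuous_on[OF smooth_fun_onD[OF assms(2) c]]])
        (use continuous_on_subset[OF continuous_coords[OF c]] in auto)
    then show ?thesis
      by (rule continuous_on_eq) (use c in auto)
  qed
  then have "continuous_on (\<Union>c\<in>A. U \<inter> dom c) f"
    by (intro continuous_on_open_UN) (use assms open_dom in auto)
  moreover have "(\<Union>c\<in>A. U \<inter> dom c) = U"
    using ex_chart by blast
  ultimately show ?thesis by simp
qed

lemma open_smooth_positive:
  assumes "open U" "smooth_fun_on A U f"
  shows "open {p \<in> U. f p > 0}"
proof -
  have "{p \<in> U. f p > 0} = f -` {0<..} \<inter> U" by auto
  then show ?thesis
    using continuous_on_open_vimage[OF assms(1)] smooth_fun_on_continuous[OF assms] by (metis open_greaterThan)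
qed

lemma smooth_fun_on_differentiable:
  assumes "open U" "smooth_fun_on A U f" "p \<in> U" "c \<in> A" "p \<in> dom c"
  shows "(\<lambda>x. f (param c x)) differentiable (at (coords c p))"
  by (rule smooth_on_imp_differentiable[OF smooth_fun_onD[OF assms(2,4)]]) (use assms in auto)

lemma smooth_fun_on_has_derivative:
  assumes "open U" "smooth_fun_on A U f" "p \<in> U" "c \<in> A" "p \<in> dom c"
  shows "((\<lambda>x. f (param c x)) has_derivative
    frechet_derivative (\<lambda>x. f (param c x)) (at (coords c p))) (at (coords c p))"
  using smooth_fun_on_differentiable[OF assms] frechet_derivative_works by blast

lemma deriv_along_eq:
  assumes "open U" "smooth_fun_on A U f" "p \<in> U" "c \<in> A" "p \<in> dom c" "X p \<in> tangent A p"
  shows "deriv_along A X f p = frechet_derivative (\<lambda>x. f (param c x)) (at (coords c p)) (X p c)"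
proof -
  let ?d = "chart_at A p"
  note d = chart_at[of p]
  have "((\<lambda>x. f (param c (transition ?d c x))) has_derivative
      (\<lambda>v. frechet_derivative (\<lambda>x. f (param c x)) (at (coords c p)) (jac ?d c p v))) (at (coords ?d p))"
    using has_derivative_compose[OF has_derivative_transition[of ?d c p],
        of "\<lambda>x. f (param c x)"] smooth_fun_on_has_derivative[OF assms(1-5)] d assms by simp
  then have "((\<lambda>x. f (param ?d x)) has_derivative
      (\<lambda>v. frechet_derivative (\<lambda>x. f (param c x)) (at (coords c p)) (jac ?d c p v))) (at (coords ?d p))"
    by (rule has_derivative_transform_within_open[where s = "coords ?d ` (dom c \<inter> dom ?d)"])
      (use d assms open_dom open_coords_image in auto)
  then have "frechet_derivative (\<lambda>x. f (param ?d x)) (at (coords ?d p)) (X p ?d) =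
      frechet_derivative (\<lambda>x. f (param c x)) (at (coords c p)) (jac ?d c p (X p ?d))"
    using frechet_derivative_at by metis
  then show ?thesis
    using tangent_jac[OF assms(6) d(1) assms(4) d(2) assms(5)]
    by (simp add: deriv_along_def Let_def o_def)
qed

lemma deriv_alongI:
  assumes "((\<lambda>x. f (param (chart_at A p) x)) has_derivative F) (at (coords (chart_at A p) p))"
  shows "deriv_along A X f p = F (X p (chart_at A p))"
  using frechet_derivative_at[OF assms] by (simp add: deriv_along_def Let_def o_def)

lemma deriv_along_has_derivative:
  assumes "open U" "smooth_fun_on A U f" "p \<in> U"
  obtains F where "((\<lambda>x. f (param (chart_at A p) x)) has_derivative F) (at (coords (chart_at A p) p))"
  using smooth_fun_on_has_derivative[OF assms chart_at] by blast

lemma deriv_along_cong: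
  assumes "open U" "smooth_fun_on A U f" "p \<in> U" "\<And>q. q \<in> U \<Longrightarrow> f q = h q" "X p = Y p"
  shows "deriv_along A X f p = deriv_along A Y h p"
proof -
  let ?d = "chart_at A p"
  note d = chart_at[of p]
  obtain F where F: "((\<lambda>x. f (param ?d x)) has_derivative F) (at (coords ?d p))"
    using deriv_along_has_derivative[OF assms(1-3)] .
  have "((\<lambda>x. h (param ?d x)) has_derivative F) (at (coords ?d p))"
    by (rule has_derivative_transform_within_open[OF F, where s = "coords ?d ` (U \<inter> dom ?d)"])
      (use d assms open_coords_image in auto)
  then show ?thesis
    using deriv_alongI[OF F] deriv_alongI assms(5) by metis
qed

lemma deriv_along_const [simp]: "deriv_along A X (\<lambda>q. a) p = 0"
  by (simp add: deriv_along_def Let_def o_def)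

lemma deriv_along_add:
  assumes "open U" "smooth_fun_on A U f" "smooth_fun_on A U h" "p \<in> U"
  shows "deriv_along A X (\<lambda>q. f q + h q) p = deriv_along A X f p + deriv_along A X h p"
proof -
  obtain F H where F: "((\<lambda>x. f (param (chart_at A p) x)) has_derivative F) (at (coords (chart_at A p) p))"
     and H: "((\<lambda>x. h (param (chart_at A p) x)) has_derivative H) (at (coords (chart_at A p) p))"
    using deriv_along_has_derivative assms by meson
  show ?thesis
    using deriv_alongI[OF F] deriv_alongI[OF H] deriv_alongI[OF has_derivative_add[OF F H]] by simp
qed

lemma deriv_along_mult:
  assumes "open U" "smooth_fun_on A U f" "smooth_fun_on A U h" "p \<in> U"
  shows "deriv_along A X (\<lambda>q. f q * h q) p = deriv_along A X f p * h p + f p * deriv_along A X h p"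
proof -
  obtain F H where F: "((\<lambda>x. f (param (chart_at A p) x)) has_derivative F) (at (coords (chart_at A p) p))"
     and H: "((\<lambda>x. h (param (chart_at A p) x)) has_derivative H) (at (coords (chart_at A p) p))"
    using deriv_along_has_derivative assms by meson
  show ?thesis
    using deriv_alongI[OF F] deriv_alongI[OF H] deriv_alongI[OF has_derivative_mult[OF F H]]
    by (simp add: chart_at)
qed

lemma deriv_along_cmult:
  "open U \<Longrightarrow> smooth_fun_on A U f \<Longrightarrow> p \<in> U \<Longrightarrow> deriv_along A X (\<lambda>q. a * f q) p = a * deriv_along A X f p"
  using deriv_along_mult[of U "\<lambda>q. a" f p X] by simp

lemma deriv_along_uminus:
  "open U \<Longrightarrow> smooth_fun_on A U f \<Longrightarrow> p \<in> U \<Longrightarrow> deriv_along A X (\<lambda>q. - f q) p = - deriv_along A X f p"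
  using deriv_along_cmult[of U f p X "-1"] by simp

lemma deriv_along_diff:
  "open U \<Longrightarrow> smooth_fun_on A U f \<Longrightarrow> smooth_fun_on A U h \<Longrightarrow> p \<in> U \<Longrightarrow>
    deriv_along A X (\<lambda>q. f q - h q) p = deriv_along A X f p - deriv_along A X h p"
  using deriv_along_add[of U f "\<lambda>q. - h q" p X] deriv_along_uminus[of U h p X] smooth_fun_on_uminus[of U h]
  by simp

lemma deriv_along_linear_field:
  assumes "open U" "smooth_fun_on A U f" "p \<in> U" "X p = (\<Sum>i\<in>I. a i *\<^sub>R E i p)"
  shows "deriv_along A X f p = (\<Sum>i\<in>I. a i * deriv_along A (E i) f p)"
proof -
  obtain F where F: "((\<lambda>x. f (param (chart_at A p) x)) has_derivative F) (at (coords (chart_at A p) p))"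
    using deriv_along_has_derivative assms by meson
  have l: "linear F" using F by (rule has_derivative_linear)
  have "X p (chart_at A p) = (\<Sum>i\<in>I. a i *\<^sub>R E i p (chart_at A p))"
    unfolding assms(4) by (induction I rule: infinite_finite_induct) auto
  then show ?thesis
    using deriv_alongI[OF F] by (simp add: linear_sum[OF l] linear_scale[OF l])
qed

lemma deriv_along_exp:
  assumes "open U" "smooth_fun_on A U f" "p \<in> U"
  shows "deriv_along A X (\<lambda>q. exp (f q)) p = exp (f p) * deriv_along A X f p"
proof -
  obtain F where F: "((\<lambda>x. f (param (chart_at A p) x)) has_derivative F) (at (coords (chart_at A p) p))"
    using deriv_along_has_derivative assms by meson
  show ?thesis
    using deriv_alongI[OF F] deriv_alongI[OF has_derivative_exp[OF F]] by (simp add: chart_at)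
qed

lemma smooth_deriv_along:
  assumes "open U" "smooth_fun_on A U f" "smooth_field_on A U X"
  shows "smooth_fun_on A U (deriv_along A X f)"
proof (rule smooth_fun_on_local)
  fix p assume p: "p \<in> U"
  obtain c where c: "c \<in> A" "p \<in> dom c" using ex_chart by blast
  have o: "open (coords c ` (U \<inter> dom c))" using open_coords_image c assms by blast
  have "smooth_fun_on A (U \<inter> dom c) (deriv_along A X f)"
  proof (rule smooth_fun_on_chartI[OF c(1)])
    show "smooth_on (coords c ` (U \<inter> dom c)) (\<lambda>x. deriv_along A X f (param c x))"
    proof (rule smooth_on_cong[OF o])
      show "smooth_on (coords c ` (U \<inter> dom c))
          (\<lambda>x. frechet_derivative (\<lambda>x. f (param c x)) (at x) (X (param c x) c))"
        by (intro smooth_on_frechet_derivative_var o smooth_fun_onD smooth_field_onD assms c)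
      show "frechet_derivative (\<lambda>x. f (param c x)) (at x) (X (param c x) c) = deriv_along A X f (param c x)"
        if "x \<in> coords c ` (U \<inter> dom c)" for x
        using that c deriv_along_eq[OF assms(1,2) _ c(1)] smooth_field_tangent[OF assms(3)] by auto
    qed
  qed (use assms open_Int_dom c in blast)+
  then show "\<exists>V. open V \<and> p \<in> V \<and> V \<subseteq> U \<and> smooth_fun_on A V (deriv_along A X f)"
    using assms(1) open_dom[OF c(1)] c p by (intro exI[of _ "U \<inter> dom c"]) auto
qed

end

section \<open>Orthonormal frames\<close>

locale riemannian_manifold = oriented_manifold A for A :: "('m::topological_space) atlas" +
  fixes g :: "'m metric"
  assumes metric: "riemannian_metric A g"
begin

lemma g_sym: "u \<in> tangent A p \<Longrightarrow> v \<in> tangent A p \<Longrightarrow> g p u v = g p v u"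
  using metric unfolding riemannian_metric_def by blast

lemma g_add_left: "u \<in> tangent A p \<Longrightarrow> v \<in> tangent A p \<Longrightarrow> w \<in> tangent A p
    \<Longrightarrow> g p (u + v) w = g p u w + g p v w"
  using metric unfolding riemannian_metric_def by blast

lemma g_scale_left: "u \<in> tangent A p \<Longrightarrow> v \<in> tangent A p \<Longrightarrow> g p (a *\<^sub>R u) v = a * g p u v"
  using metric unfolding riemannian_metric_def by blast

lemma g_pos: "u \<in> tangent A p \<Longrightarrow> u \<noteq> 0 \<Longrightarrow> g p u u > 0"
  using metric unfolding riemannian_metric_def by blast

lemma smooth_g: "open U \<Longrightarrow> smooth_field_on A U X \<Longrightarrow> smooth_field_on A U Y
    \<Longrightarrow> smooth_fun_on A U (\<lambda>p. g p (X p) (Y p))"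
  using metric unfolding riemannian_metric_def by blast

lemma g_add_right: "u \<in> tangent A p \<Longrightarrow> v \<in> tangent A p \<Longrightarrow> w \<in> tangent A p
    \<Longrightarrow> g p w (u + v) = g p w u + g p w v"
  by (metis g_sym g_add_left tangent_add)

lemma g_scale_right: "u \<in> tangent A p \<Longrightarrow> v \<in> tangent A p \<Longrightarrow> g p u (a *\<^sub>R v) = a * g p u v"
  by (metis g_sym g_scale_left tangent_scaleR)

lemma g_zero_left [simp]: "v \<in> tangent A p \<Longrightarrow> g p 0 v = 0"
  using g_scale_left[of 0 p v 0] by simp

lemma g_uminus_left: "u \<in> tangent A p \<Longrightarrow> v \<in> tangent A p \<Longrightarrow> g p (- u) v = - g p u v"
  using g_scale_left[of u p v "-1"] by simp

lemma g_diff_left: "u \<in> tangent A p \<Longrightarrow> v \<in> tangent A p \<Longrightarrow> w \<in> tangent A p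
    \<Longrightarrow> g p (u - v) w = g p u w - g p v w"
  using g_add_left[of u p "- v" w] g_uminus_left[of v p w] by (simp add: tangent_uminus)

lemma g_sum_left: "(\<And>i. i \<in> I \<Longrightarrow> f i \<in> tangent A p) \<Longrightarrow> v \<in> tangent A p
    \<Longrightarrow> g p (\<Sum>i\<in>I. f i) v = (\<Sum>i\<in>I. g p (f i) v)"
  by (induction I rule: infinite_finite_induct) (auto simp: g_add_left tangent_sum)

lemma g_nondegenerate:
  assumes "u \<in> tangent A p" "v \<in> tangent A p" "\<And>w. w \<in> tangent A p \<Longrightarrow> g p u w = g p v w"
  shows "u = v"
proof (rule ccontr)
  assume "u \<noteq> v"
  then have "g p (u - v) (u - v) > 0"
    using assms by (intro g_pos) auto
  then show False
    using assms g_diff_left[of u p v "u - v"] tangent_diff by auto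
qed

definition orthonormal :: "'m \<Rightarrow> (4 \<Rightarrow> 'm tvec) \<Rightarrow> bool"
  where "orthonormal p e \<longleftrightarrow> (\<forall>i. e i \<in> tangent A p) \<and>
    (\<forall>i j. g p (e i) (e j) = (if i = j then 1 else 0))"

lemma orthonormal_tangent: "orthonormal p e \<Longrightarrow> e i \<in> tangent A p"
  by (simp add: orthonormal_def)

lemma orthonormal_g: "orthonormal p e \<Longrightarrow> g p (e i) (e j) = (if i = j then 1 else 0)"
  by (simp add: orthonormal_def)

lemma lincomb_tangent: "orthonormal p e \<Longrightarrow> (\<Sum>i\<in>I. a i *\<^sub>R e i) \<in> tangent A p"
  by (intro tangent_sum tangent_scaleR orthonormal_tangent)

lemma sum_fun_apply: "(\<Sum>i\<in>I. f i) x = (\<Sum>i\<in>I. f i x)"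
  by (induction I rule: infinite_finite_induct) auto

lemma g_lincomb_frame:
  assumes "orthonormal p e"
  shows "g p (\<Sum>i\<in>UNIV. a i *\<^sub>R e i) (e j) = a j"
proof -
  have "g p (\<Sum>i\<in>UNIV. a i *\<^sub>R e i) (e j) = (\<Sum>i\<in>UNIV. g p (a i *\<^sub>R e i) (e j))"
    by (rule g_sum_left) (use assms orthonormal_tangent in blast)+
  also have "\<dots> = (\<Sum>i\<in>UNIV. if i = j then a i else 0)"
    by (rule sum.cong) (use assms in \<open>auto simp: g_scale_left orthonormal_tangent orthonormal_g\<close>)
  finally show ?thesis by simp
qed

lemma det_orthonormal:
  assumes "orthonormal p e" "c \<in> A" "p \<in> dom c"
  shows "det (\<chi> i. e i c) \<noteq> 0"
proof -
  let ?M = "\<chi> i. e i c"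
  have "a i = 0" if "(\<Sum>i\<in>UNIV. a i *s row i ?M) = 0" for a i
  proof -
    have "(\<Sum>i\<in>UNIV. a i *\<^sub>R e i) = 0"
    proof (rule tangent_eqI[OF _ _ assms(2,3)])
      show "(\<Sum>i\<in>UNIV. a i *\<^sub>R e i) \<in> tangent A p"
        by (rule lincomb_tangent[OF assms(1)])
      show "(\<Sum>i\<in>UNIV. a i *\<^sub>R e i) c = 0 c"
        using that by (simp add: sum_fun_apply row_def scalar_mult_eq_scaleR vec_lambda_eta)
    qed simp
    then show ?thesis
      using g_lincomb_frame[OF assms(1), of a i] orthonormal_tangent[OF assms(1)] by simp
  qed
  then have "\<exists>B. ?M ** B = mat 1"
    unfolding matrix_right_invertible_independent_rows by blast
  then show ?thesis
    using invertible_right_inverse invertible_det_nz by blast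
qed

lemma orthonormal_expand:
  assumes "orthonormal p e" "u \<in> tangent A p"
  shows "u = (\<Sum>i\<in>UNIV. g p u (e i) *\<^sub>R e i)"
proof -
  obtain c where c: "c \<in> A" "p \<in> dom c" using ex_chart by blast
  let ?M = "\<chi> i. e i c"
  obtain B where B: "B ** ?M = mat 1"
    using det_orthonormal[OF assms(1) c] invertible_det_nz invertible_left_inverse by blast
  define a where "a = u c v* B"
  have "a v* ?M = u c"
    unfolding a_def using B by (simp add: vector_matrix_mul_assoc)
  then have "u c = (\<Sum>i\<in>UNIV. a $ i *\<^sub>R e i c)"
    by (simp add: vec_eq_iff vector_matrix_mult_def mult.commute)
  then have u: "u = (\<Sum>i\<in>UNIV. a $ i *\<^sub>R e i)"
    by (intro tangent_eqI[OF assms(2) _ c] lincomb_tangent[OF assms(1)]) (simp add: sum_fun_apply)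
  have "g p u (e i) = a $ i" for i
    unfolding u by (rule g_lincomb_frame[OF assms(1)])
  then show ?thesis
    using u by simp
qed

lemma g_expand:
  assumes "orthonormal p e" "u \<in> tangent A p" "v \<in> tangent A p"
  shows "g p u v = (\<Sum>i\<in>UNIV. g p u (e i) * g p v (e i))"
proof -
  have "g p u v = g p (\<Sum>i\<in>UNIV. g p u (e i) *\<^sub>R e i) v"
    using orthonormal_expand[OF assms(1,2)] by simp
  also have "\<dots> = (\<Sum>i\<in>UNIV. g p (g p u (e i) *\<^sub>R e i) v)"
    by (rule g_sum_left) (use assms orthonormal_tangent in auto)
  also have "\<dots> = (\<Sum>i\<in>UNIV. g p u (e i) * g p v (e i))"
    by (rule sum.cong) (use assms orthonormal_tangent g_sym in \<open>auto simp: g_scale_left\<close>)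
  finally show ?thesis .
qed

lemma ex_partial_frame:
  fixes S :: "4 set"
  shows "\<exists>U E. open U \<and> p \<in> U \<and> (\<forall>i\<in>S. smooth_field_on A U (E i)) \<and>
     (\<forall>q\<in>U. \<forall>i\<in>S. \<forall>j\<in>S. g q (E i q) (E j q) = (if i = j then 1 else 0))"
  using finite[of S]
proof (induction S rule: finite_induct)
  case empty
  show ?case by (intro exI[of _ UNIV]) auto
next
  case (insert k S)
  from insert.IH obtain U and E :: "4 \<Rightarrow> 'm field" where
    UE: "open U \<and> p \<in> U \<and> (\<forall>i\<in>S. smooth_field_on A U (E i)) \<and>
     (\<forall>q\<in>U. \<forall>i\<in>S. \<forall>j\<in>S. g q (E i q) (E j q) = (if i = j then 1 else 0))"
    by (elim exE) (rule that)
  then have U: "open U" "p \<in> U" and E: "\<And>i. i \<in> S \<Longrightarrow> smooth_field_on A U (E i)" by simp_all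
  have on: "g q (E i q) (E j q) = (if i = j then 1 else 0)" if "q \<in> U" "i \<in> S" "j \<in> S" for q i j
    using UE that by simp
  obtain c where c: "c \<in> A" "p \<in> dom c" using ex_chart by blast
  have "card S < 4"
    using psubset_card_mono[of "UNIV :: 4 set" S] insert.hyps by auto
  then have dim_less: "dim ((\<lambda>i. E i p c) ` S) < 4"
    using dim_le_card'[of "(\<lambda>i. E i p c) ` S"] card_image_le[of S "\<lambda>i. E i p c"] by simp
  have "span ((\<lambda>i. E i p c) ` S) \<noteq> UNIV"
  proof (intro notI)
    assume "span ((\<lambda>i. E i p c) ` S) = UNIV"
    then have "dim ((\<lambda>i. E i p c) ` S) = dim (UNIV :: (real^4) set)"
      by (metis dim_span)
    then show False
      using dim_less by simp
  qed
  then obtain x where x: "x \<notin> span ((\<lambda>i. E i p c) ` S)" by blast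
  define V where "V = U \<inter> dom c"
  have V: "open V" "p \<in> V" "V \<subseteq> U" "V \<subseteq> dom c"
    using U c open_dom by (auto simp: V_def open_Int_dom)
  define Y where "Y = (\<lambda>q. \<Sum>j\<in>UNIV. (x $ j) *\<^sub>R coord_field A c j q)"
  have Y: "smooth_field_on A V Y"
    unfolding Y_def
    by (intro smooth_field_on_sum smooth_field_on_cscaleR V smooth_field_on_subset[OF smooth_coord_field[OF c(1)]])
  have Yp: "Y p c = x"
    using c by (simp add: Y_def sum_fun_apply coord_field_eq basis_expansion flip: scalar_mult_eq_scaleR)
  have EV: "smooth_field_on A V (E i)" if "i \<in> S" for i
    using smooth_field_on_subset[OF E[OF that] V(3)] .
  define Y' where "Y' = (\<lambda>q. Y q - (\<Sum>i\<in>S. g q (Y q) (E i q) *\<^sub>R E i q))"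
  have Y': "smooth_field_on A V Y'"
    unfolding Y'_def
    by (intro smooth_field_on_diff smooth_field_on_sum smooth_field_on_scaleR smooth_g V Y EV)
  have Y'p: "Y' p \<noteq> 0"
  proof
    assume "Y' p = 0"
    then have "Y p = (\<Sum>i\<in>S. g p (Y p) (E i p) *\<^sub>R E i p)"
      by (simp add: Y'_def)
    then have "x = (\<Sum>i\<in>S. g p (Y p) (E i p) *\<^sub>R E i p c)"
      using Yp by (metis (no_types, lifting) scaleR_fun_apply sum.cong sum_fun_apply)
    also have "\<dots> \<in> span ((\<lambda>i. E i p c) ` S)"
      by (intro span_sum span_mul span_base) auto
    finally show False using x by blast
  qed
  define N where "N = (\<lambda>q. g q (Y' q) (Y' q))"
  have N: "smooth_fun_on A V N"
    unfolding N_def by (intro smooth_g V Y')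
  define W where "W = {q \<in> V. N q > 0}"
  have W: "open W" "p \<in> W" "W \<subseteq> V"
    using open_smooth_positive[OF V(1) N] g_pos[of "Y' p" p] smooth_field_tangent[OF Y' V(2)] Y'p V(2)
    by (auto simp: W_def N_def)
  have Et: "E i q \<in> tangent A q" if "i \<in> S" "q \<in> W" for i q
    using smooth_field_tangent[OF EV] that W by blast
  have Yt: "Y q \<in> tangent A q" "Y' q \<in> tangent A q" if "q \<in> W" for q
    using smooth_field_tangent[OF Y] smooth_field_tangent[OF Y'] that W by blast+
  define F where "F = E(k := \<lambda>q. N q powr (-1/2) *\<^sub>R Y' q)"
  have FE: "F i = E i" if "i \<in> S" for i
    using that insert.hyps by (auto simp: F_def)
  have Fk: "F k = (\<lambda>q. N q powr (-1/2) *\<^sub>R Y' q)" by (simp add: F_def)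
  have smF: "smooth_field_on A W (F i)" if "i \<in> insert k S" for i
  proof (cases "i = k")
    case True
    show ?thesis
      unfolding True Fk
      by (intro smooth_field_on_scaleR smooth_fun_on_powr W smooth_fun_on_subset[OF N] 
          smooth_field_on_subset[OF Y']) (simp add: W_def)
  next
    case False
    then show ?thesis
      using that FE smooth_field_on_subset[OF EV W(3)] by auto
  qed
  have orth: "g q (Y' q) (E j q) = 0" if "q \<in> W" "j \<in> S" for q j
  proof -
    have "g q (Y' q) (E j q) = g q (Y q) (E j q) - g q (\<Sum>i\<in>S. g q (Y q) (E i q) *\<^sub>R E i q) (E j q)"
      unfolding Y'_def by (rule g_diff_left) (use Et Yt that in auto)
    also have "g q (\<Sum>i\<in>S. g q (Y q) (E i q) *\<^sub>R E i q) (E j q)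
        = (\<Sum>i\<in>S. g q (g q (Y q) (E i q) *\<^sub>R E i q) (E j q))"
      by (rule g_sum_left) (use Et that in auto)
    also have "\<dots> = (\<Sum>i\<in>S. if i = j then g q (Y q) (E i q) else 0)"
      by (rule sum.cong) (use Et that W V on in \<open>auto simp: g_scale_left\<close>)
    also have "\<dots> = g q (Y q) (E j q)"
      using that insert.hyps by simp
    finally show ?thesis by simp
  qed
  have gF: "g q (F i q) (F j q) = (if i = j then 1 else 0)"
    if q: "q \<in> W" and i: "i \<in> insert k S" and j: "j \<in> insert k S" for q i j
  proof -
    have kk: "g q (F k q) (F k q) = 1"
    proof -
      have "N q > 0" using q by (simp add: W_def)
      then have "N q powr (-1/2) * (N q powr (-1/2) * N q) = 1"
        by (simp add: powr_add[symmetric] powr_mult_base flip: mult.assoc)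
      then show ?thesis
        using Yt q tangent_scaleR by (simp add: Fk g_scale_left g_scale_right N_def)
    qed
    have ks: "g q (F k q) (F j q) = 0" "g q (F j q) (F k q) = 0" if "j \<in> S" for j
      using orth[OF q that] g_sym[of "Y' q" q "E j q"] Yt[OF q] Et[OF that q] tangent_scaleR
      by (simp_all add: Fk FE[OF that] g_scale_left g_scale_right)
    have "i \<in> S \<Longrightarrow> j \<in> S \<Longrightarrow> ?thesis"
      using FE on q W V by auto
    then show ?thesis
      using i j kk ks insert.hyps by auto
  qed
  show ?case
    by (rule exI[of _ W], rule exI[of _ F], intro conjI ballI W) (fact smF gF)+
qed

end

context riemannian_manifold
begin

definition oriented_onb :: "'m \<Rightarrow> (4 \<Rightarrow> 'm tvec) \<Rightarrow> bool"
  where "oriented_onb p e \<longleftrightarrow> orthonormal p e \<and> (\<forall>c\<in>A. p \<in> dom c \<longrightarrow> det (\<chi> i. e i c) > 0)"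

definition frame_on :: "'m set \<Rightarrow> (4 \<Rightarrow> 'm field) \<Rightarrow> bool"
  where "frame_on U E \<longleftrightarrow> open U \<and> (\<forall>i. smooth_field_on A U (E i)) \<and>
    (\<forall>q\<in>U. oriented_onb q (\<lambda>i. E i q))"

lemma oriented_frame_near_iff: "oriented_frame_near A g p E \<longleftrightarrow> (\<exists>U. p \<in> U \<and> frame_on U E)"
proof -
  have "oriented_onb q (\<lambda>i. E i q) \<longleftrightarrow> (\<forall>i j. g q (E i q) (E j q) = (if i = j then 1 else 0)) \<and>
      (\<forall>c\<in>A. q \<in> dom c \<longrightarrow> det (\<chi> i. E i q c) > 0)"
    if "\<forall>i. smooth_field_on A U (E i)" "q \<in> U" for U q
    unfolding oriented_onb_def orthonormal_def
    using smooth_field_tangent[OF that(1)[rule_format] that(2)] by simp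
  then have "open U \<and> p \<in> U \<and> (\<forall>i. smooth_field_on A U (E i)) \<and>
     (\<forall>q\<in>U. \<forall>i j. g q (E i q) (E j q) = (if i = j then 1 else 0)) \<and>
     (\<forall>q\<in>U. \<forall>c\<in>A. q \<in> dom c \<longrightarrow> det (\<chi> i. E i q c) > 0) \<longleftrightarrow> p \<in> U \<and> frame_on U E" for U
    unfolding frame_on_def by meson
  then show ?thesis
    unfolding oriented_frame_near_def by presburger
qed

lemma frame_on_subset: "frame_on U E \<Longrightarrow> open V \<Longrightarrow> V \<subseteq> U \<Longrightarrow> frame_on V E"
  unfolding frame_on_def using smooth_field_on_subset by blast

lemma det_change_chart:
  assumes "\<And>i. e i \<in> tangent A p" "c \<in> A" "c' \<in> A" "p \<in> dom c" "p \<in> dom c'"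
  shows "det (\<chi> i. e i c') = det (matrix (jac c c' p)) * det (\<chi> i. e i c)"
proof -
  have l: "linear (jac c c' p)" using linear_jac assms by blast
  have "(\<chi> i. e i c') = (\<chi> i. e i c) ** transpose (matrix (jac c c' p))"
  proof -
    have "e i c' = matrix (jac c c' p) *v e i c" for i
      using tangent_jac[OF assms(1) assms(2-5)] l by (simp add: matrix_works)
    then show ?thesis
      by (simp add: vec_eq_iff matrix_matrix_mult_def transpose_def matrix_vector_mult_def mult.commute)
  qed
  then show ?thesis by (simp add: det_mul)
qed

lemma oriented_onbI:
  assumes "orthonormal p e" "c \<in> A" "p \<in> dom c" "det (\<chi> i. e i c) > 0"
  shows "oriented_onb p e"
  unfolding oriented_onb_def
proof (intro conjI ballI impI)
  fix c' assume c': "c' \<in> A" "p \<in> dom c'"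
  show "det (\<chi> i. e i c') > 0"
    using det_change_chart[OF orthonormal_tangent[OF assms(1)] assms(2) c'(1) assms(3) c'(2)]
      det_jac[OF assms(2) c'(1) assms(3) c'(2)] assms(4) by simp
qed (rule assms)

lemma smooth_det:
  assumes "c \<in> A" "open U" "U \<subseteq> dom c" "\<And>i. smooth_field_on A U (E i)"
  shows "smooth_fun_on A U (\<lambda>q. det (\<chi> i. E i q c))"
proof -
  have "smooth_fun_on A U (\<lambda>q. E i q c $ j)" for i j
    using smooth_component[OF assms(1,2,4)] assms(3) by (metis inf.absorb1)
  then show ?thesis
    unfolding det_def
    by (intro smooth_fun_on_sum smooth_fun_on_cmult smooth_fun_on_prod assms) simp
qed

lemma ex_frame: "\<exists>U E. p \<in> U \<and> frame_on U E"
proof -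
  from ex_partial_frame[of p "UNIV :: 4 set"] obtain U and E :: "4 \<Rightarrow> 'm field" where
    UE: "open U \<and> p \<in> U \<and> (\<forall>i\<in>UNIV. smooth_field_on A U (E i)) \<and>
     (\<forall>q\<in>U. \<forall>i\<in>UNIV. \<forall>j\<in>UNIV. g q (E i q) (E j q) = (if i = j then 1 else 0))"
    by (elim exE) (rule that)
  then have U: "open U" "p \<in> U" and E: "\<And>i. smooth_field_on A U (E i)" by simp_all
  have on: "g q (E i q) (E j q) = (if i = j then 1 else 0)" if "q \<in> U" for q i j
    using UE that by simp
  obtain c where c: "c \<in> A" "p \<in> dom c" using ex_chart by blast
  define V where "V = U \<inter> dom c"
  have V: "open V" "p \<in> V" "V \<subseteq> U" "V \<subseteq> dom c"
    using U c open_dom by (auto simp: V_def open_Int_dom)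
  have EV: "smooth_field_on A V (E i)" for i
    using smooth_field_on_subset[OF E V(3)] .
  define s :: real where "s = sgn (det (\<chi> i. E i p c))"
  define F where "F = (\<lambda>i q. (if i = 1 then s else 1) *\<^sub>R E i q)"
  have F: "smooth_field_on A V (F i)" for i
    unfolding F_def by (intro smooth_field_on_cscaleR V EV)
  have onE: "orthonormal q (\<lambda>i. E i q)" if "q \<in> U" for q
    using on[OF that] smooth_field_tangent[OF E that] by (simp add: orthonormal_def)
  have d0: "det (\<chi> i. E i p c) \<noteq> 0"
    using det_orthonormal[OF onE[OF U(2)] c] .
  then have s: "s * s = 1" "s * det (\<chi> i. E i p c) > 0"
    by (auto simp: s_def sgn_real_def)
  have onF: "orthonormal q (\<lambda>i. F i q)" if "q \<in> V" for q
    using onE[of q] that V(3) s(1)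
    by (auto simp: orthonormal_def F_def g_scale_left g_scale_right tangent_scaleR)
  have detF: "det (\<chi> i. F i q c) = s * det (\<chi> i. E i q c)" for q
  proof -
    have "(\<chi> i. F i q c) = (\<chi> i. if i = 1 then s *s E i q c else E i q c)"
      by (auto simp: F_def vec_eq_iff)
    then show ?thesis
      using det_row_mul[of 1 s "\<lambda>i. E i q c" "\<lambda>i. E i q c"] by simp
  qed
  define W where "W = {q \<in> V. det (\<chi> i. F i q c) > 0}"
  have "open W"
    unfolding W_def by (rule open_smooth_positive[OF V(1) smooth_det[OF c(1) V(1,4) F]])
  moreover have "p \<in> W" "W \<subseteq> V"
    using s V(2) by (auto simp: W_def detF)
  moreover have "oriented_onb q (\<lambda>i. F i q)" if "q \<in> W" for q
    by (rule oriented_onbI[OF onF c(1)]) (use that V in \<open>auto simp: W_def\<close>)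
  ultimately have "p \<in> W \<and> frame_on W F"
    using smooth_field_on_subset[OF F] by (auto simp: frame_on_def)
  then show ?thesis by blast
qed

lemma frame_near:
  obtains U where "p \<in> U" "frame_on U (frame A g p)"
proof -
  from ex_frame[of p] obtain U E where "p \<in> U \<and> frame_on U E"
    by (elim exE) (rule that)
  then have "oriented_frame_near A g p E"
    unfolding oriented_frame_near_iff by (rule exI)
  then have "oriented_frame_near A g p (frame A g p)"
    unfolding frame_def by (rule someI[where P = "oriented_frame_near A g p"])
  then obtain V where "p \<in> V \<and> frame_on V (frame A g p)"
    unfolding oriented_frame_near_iff by (rule exE)
  then show ?thesis
    by (intro that[of V]) simp_all
qed

lemma oriented_onb_frame: "oriented_onb p (\<lambda>i. frame A g p i p)"
  by (rule frame_near[of p]) (auto simp: frame_on_def)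

lemma orthonormal_frame: "orthonormal p (\<lambda>i. frame A g p i p)"
  using oriented_onb_frame by (simp add: oriented_onb_def)

lemma det_gram_eq:
  assumes "oriented_onb p e" "oriented_onb p e'" "\<And>j. v j \<in> tangent A p"
  shows "det (\<chi> i j. g p (e i) (v j)) = det (\<chi> i j. g p (e' i) (v j))"
proof -
  obtain c where c: "c \<in> A" "p \<in> dom c" using ex_chart by blast
  have oe: "orthonormal p e" "orthonormal p e'" and
    d: "det (\<chi> i. e i c) > 0" "det (\<chi> i. e' i c) > 0"
    using assms c by (auto simp: oriented_onb_def)
  define Q :: "real^4^4" where "Q = (\<chi> i k. g p (e i) (e' k))"
  have "(\<chi> i j. g p (e i) (v j)) = Q ** (\<chi> i j. g p (e' i) (v j))"
    using g_expand[OF oe(2) orthonormal_tangent[OF oe(1)] assms(3)] g_sym assms(3) orthonormal_tangent[OF oe(2)]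
    by (simp add: vec_eq_iff matrix_matrix_mult_def Q_def)
  moreover have "det Q = 1"
  proof -
    have "(\<chi> i. e i c) = Q ** (\<chi> i. e' i c)"
    proof -
      have "e i c = (\<Sum>k\<in>UNIV. Q $ i $ k *\<^sub>R e' k c)" for i
      proof -
        have "e i = (\<Sum>k\<in>UNIV. g p (e i) (e' k) *\<^sub>R e' k)"
          by (rule orthonormal_expand[OF oe(2) orthonormal_tangent[OF oe(1)]])
        then have "e i c = (\<Sum>k\<in>UNIV. g p (e i) (e' k) *\<^sub>R e' k) c" by simp
        then show ?thesis by (simp add: sum_fun_apply Q_def)
      qed
      then show ?thesis
        by (simp add: vec_eq_iff matrix_matrix_mult_def)
    qed
    then have "det Q > 0"
      using d by (simp add: det_mul zero_less_mult_iff)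
    moreover have "Q ** transpose Q = mat 1"
      using g_expand[OF oe(2) orthonormal_tangent[OF oe(1)] orthonormal_tangent[OF oe(1)]]
        orthonormal_g[OF oe(1)]
      by (simp add: vec_eq_iff matrix_matrix_mult_def Q_def transpose_def mat_def)
    then have "det Q * det Q = 1"
      by (metis det_I det_mul det_transpose)
    ultimately show ?thesis
      by (auto simp: square_eq_1_iff)
  qed
  ultimately show ?thesis by (simp add: det_mul)
qed

lemma vol_eq:
  assumes "oriented_onb p e" "\<And>j. v j \<in> tangent A p"
  shows "vol A g p v = det (\<chi> i j. g p (e i) (v j))"
  unfolding vol_def by (rule det_gram_eq[OF oriented_onb_frame assms])

end

section \<open>Forms and the Hodge star in dimension four\<close>

lemma det_4:
  fixes M :: "'a::comm_ring_1^4^4"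
  shows "det M =
    M$1$1 * M$2$2 * M$3$3 * M$4$4 + M$1$1 * M$2$3 * M$3$4 * M$4$2 + M$1$1 * M$2$4 * M$3$2 * M$4$3
  + M$1$2 * M$2$1 * M$3$4 * M$4$3 + M$1$2 * M$2$3 * M$3$1 * M$4$4 + M$1$2 * M$2$4 * M$3$3 * M$4$1
  + M$1$3 * M$2$1 * M$3$2 * M$4$4 + M$1$3 * M$2$2 * M$3$4 * M$4$1 + M$1$3 * M$2$4 * M$3$1 * M$4$2
  + M$1$4 * M$2$1 * M$3$3 * M$4$2 + M$1$4 * M$2$2 * M$3$1 * M$4$3 + M$1$4 * M$2$3 * M$3$2 * M$4$1
  - M$1$1 * M$2$2 * M$3$4 * M$4$3 - M$1$1 * M$2$3 * M$3$2 * M$4$4 - M$1$1 * M$2$4 * M$3$3 * M$4$2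
  - M$1$2 * M$2$1 * M$3$3 * M$4$4 - M$1$2 * M$2$3 * M$3$4 * M$4$1 - M$1$2 * M$2$4 * M$3$1 * M$4$3
  - M$1$3 * M$2$1 * M$3$4 * M$4$2 - M$1$3 * M$2$2 * M$3$1 * M$4$4 - M$1$3 * M$2$4 * M$3$2 * M$4$1
  - M$1$4 * M$2$1 * M$3$2 * M$4$3 - M$1$4 * M$2$2 * M$3$3 * M$4$1 - M$1$4 * M$2$3 * M$3$1 * M$4$2"
proof -
  have f: "finite {4::4}" "1 \<notin> {2::4,3,4}" "2 \<notin> {3::4,4}" "3 \<notin> {4::4}" "finite {2::4,3,4}" "finite {3::4,4}"
    by auto
  show ?thesis
    unfolding det_def UNIV_4
    unfolding sum_over_permutations_insert[OF f(5,2)]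
    unfolding sum_over_permutations_insert[OF f(6,3)]
    unfolding sum_over_permutations_insert[OF f(1,4)]
    unfolding permutes_sing
    by (simp add: sign_swap_id permutation_swap_id sign_compose sign_id swap_id_eq permutation_compose)
qed

locale alternating3 =
  fixes h :: "4 \<Rightarrow> 4 \<Rightarrow> 4 \<Rightarrow> real"
  assumes swap12: "h j i k = - h i j k" and swap23: "h i k j = - h i j k"
begin

lemma diagonal [simp]: "h i i k = 0" "h k i i = 0" "h i k i = 0"
proof -
  show a: "h i i k = 0" "h k i i = 0"
    using swap12[of i i k] swap23[of k i i] by auto
  show "h i k i = 0"
    using swap23[of i i k] a by simp
qed

lemma sorted:
  "h 2 1 3 = - h 1 2 3" "h 1 3 2 = - h 1 2 3" "h 3 2 1 = - h 1 2 3" "h 2 3 1 = h 1 2 3" "h 3 1 2 = h 1 2 3"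
  "h 2 1 4 = - h 1 2 4" "h 1 4 2 = - h 1 2 4" "h 4 2 1 = - h 1 2 4" "h 2 4 1 = h 1 2 4" "h 4 1 2 = h 1 2 4"
  "h 3 1 4 = - h 1 3 4" "h 1 4 3 = - h 1 3 4" "h 4 3 1 = - h 1 3 4" "h 3 4 1 = h 1 3 4" "h 4 1 3 = h 1 3 4"
  "h 3 2 4 = - h 2 3 4" "h 2 4 3 = - h 2 3 4" "h 4 3 2 = - h 2 3 4" "h 3 4 2 = h 2 3 4" "h 4 2 3 = h 2 3 4"
  by (metis swap12 swap23 minus_minus)+

definition star :: "4 \<Rightarrow> real"
  where "star = tuple4 (- h 2 3 4) (h 1 3 4) (- h 1 2 4) (h 1 2 3)"

lemma star_simps: "star 1 = - h 2 3 4" "star 2 = h 1 3 4" "star 3 = - h 1 2 4" "star 4 = h 1 2 3"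
  by (simp_all add: star_def tuple4_def)

lemma trilinear_eq_det:
  "(\<Sum>i\<in>UNIV. \<Sum>j\<in>UNIV. \<Sum>k\<in>UNIV. a i * b j * c k * h i j k)
    = - det (\<chi> i j. tuple4 (star i) (a i) (b i) (c i) j)"
  by (simp add: sum_4 det_4 star_simps sorted tuple4_def algebra_simps)

lemma star_sum:
  "(\<Sum>i\<in>UNIV. \<Sum>j\<in>UNIV. \<Sum>k\<in>UNIV. h i j k *
      det (\<chi> l m. tuple4 (if l = i then 1 else 0) (if l = j then 1 else 0) (if l = k then 1 else 0) (v l) m))
    = fact 3 * (\<Sum>i\<in>UNIV. star i * v i)"
  by (simp add: sum_4 det_4 star_simps sorted tuple4_def fact_numeral)

lemma contraction:
  "(\<Sum>i\<in>UNIV. \<Sum>j\<in>UNIV. (\<Sum>a\<in>UNIV. x a * h a i j) * (\<Sum>a\<in>UNIV. y a * h a i j))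
    = 2 * ((\<Sum>i\<in>UNIV. star i * star i) * (\<Sum>i\<in>UNIV. x i * y i)
         - (\<Sum>i\<in>UNIV. star i * x i) * (\<Sum>i\<in>UNIV. star i * y i))"
  by (simp add: sum_4 star_simps sorted) algebra

end


lemma tuple4_apply: "f (tuple4 a b c d i) = tuple4 (f a) (f b) (f c) (f d) i"
  by (simp add: tuple4_def)

lemma tuple4_sel [simp]:
  "tuple4 a b c d 1 = a" "tuple4 a b c d 2 = b" "tuple4 a b c d 3 = c" "tuple4 a b c d 4 = d"
  by (simp_all add: tuple4_def)

context oriented_manifold
begin

definition alternating_at :: "'m form3 \<Rightarrow> 'm \<Rightarrow> bool"
  where "alternating_at H p \<longleftrightarrow> (\<forall>u\<in>tangent A p. \<forall>v\<in>tangent A p. \<forall>w\<in>tangent A p.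
        (\<forall>u'\<in>tangent A p. H p (u + u') v w = H p u v w + H p u' v w) \<and>
        (\<forall>a. H p (a *\<^sub>R u) v w = a * H p u v w) \<and>
        H p v u w = - H p u v w \<and> H p u w v = - H p u v w)"

definition linear_at :: "'m form1 \<Rightarrow> 'm \<Rightarrow> bool"
  where "linear_at \<omega> p \<longleftrightarrow> (\<forall>u\<in>tangent A p. (\<forall>v\<in>tangent A p. \<omega> p (u + v) = \<omega> p u + \<omega> p v) \<and>
        (\<forall>a. \<omega> p (a *\<^sub>R u) = a * \<omega> p u))"

lemma linear_at_add: "linear_at \<omega> p \<Longrightarrow> u \<in> tangent A p \<Longrightarrow> v \<in> tangent A p \<Longrightarrow> \<omega> p (u + v) = \<omega> p u + \<omega> p v"
  by (simp add: linear_at_def)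

lemma linear_at_scale: "linear_at \<omega> p \<Longrightarrow> u \<in> tangent A p \<Longrightarrow> \<omega> p (a *\<^sub>R u) = a * \<omega> p u"
  by (simp add: linear_at_def)

lemma linear_at_zero: "linear_at \<omega> p \<Longrightarrow> \<omega> p 0 = 0"
  using linear_at_scale[of \<omega> p 0 0] by simp

lemma linear_at_sum:
  assumes "linear_at \<omega> p" "\<And>i. i \<in> I \<Longrightarrow> f i \<in> tangent A p"
  shows "\<omega> p (\<Sum>i\<in>I. f i) = (\<Sum>i\<in>I. \<omega> p (f i))"
  using assms(2)
  by (induction I rule: infinite_finite_induct)
    (auto simp: linear_at_zero[OF assms(1)] linear_at_add[OF assms(1)] tangent_sum)

lemma linear_at_lincomb:
  assumes "linear_at \<omega> p" "\<And>i. f i \<in> tangent A p"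
  shows "\<omega> p (\<Sum>i\<in>I. a i *\<^sub>R f i) = (\<Sum>i\<in>I. a i * \<omega> p (f i))"
  using linear_at_sum[OF assms(1), of I "\<lambda>i. a i *\<^sub>R f i"] linear_at_scale[OF assms(1)] assms(2)
  by (simp add: tangent_scaleR)

lemma alternating_at_linear1:
  "alternating_at H p \<Longrightarrow> v \<in> tangent A p \<Longrightarrow> w \<in> tangent A p \<Longrightarrow> linear_at (\<lambda>p u. H p u v w) p"
  unfolding alternating_at_def linear_at_def by blast

lemma alternating_at_swap12:
  "alternating_at H p \<Longrightarrow> u \<in> tangent A p \<Longrightarrow> v \<in> tangent A p \<Longrightarrow> w \<in> tangent A p \<Longrightarrow> H p v u w = - H p u v w"
  unfolding alternating_at_def by blast

lemma alternating_at_swap23: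
  "alternating_at H p \<Longrightarrow> u \<in> tangent A p \<Longrightarrow> v \<in> tangent A p \<Longrightarrow> w \<in> tangent A p \<Longrightarrow> H p u w v = - H p u v w"
  unfolding alternating_at_def by blast

lemma linear_at_uminus:
  "linear_at \<theta> p \<Longrightarrow> (\<And>v. v \<in> tangent A p \<Longrightarrow> \<omega> p v = - \<theta> p v) \<Longrightarrow> linear_at \<omega> p"
  by (simp add: linear_at_def tangent_add tangent_scaleR)

lemma alternating_at_linear2:
  assumes "alternating_at H p" "u \<in> tangent A p" "w \<in> tangent A p"
  shows "linear_at (\<lambda>p v. H p u v w) p"
  by (rule linear_at_uminus[OF alternating_at_linear1[OF assms]])
    (rule alternating_at_swap12[OF assms(1) _ assms(2,3)])

lemma alternating_at_linear3:
  assumes "alternating_at H p" "u \<in> tangent A p" "v \<in> tangent A p"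
  shows "linear_at (\<lambda>p w. H p u v w) p"
  by (rule linear_at_uminus[OF alternating_at_linear2[OF assms]])
    (rule alternating_at_swap23[OF assms(1,2) _ assms(3)])

lemma three_form_iff: "three_form A H \<longleftrightarrow> (\<forall>p. alternating_at H p) \<and>
     (\<forall>U X Y Z. open U \<longrightarrow> smooth_field_on A U X \<longrightarrow> smooth_field_on A U Y \<longrightarrow> smooth_field_on A U Z \<longrightarrow>
        smooth_fun_on A U (\<lambda>p. H p (X p) (Y p) (Z p)))"
  unfolding three_form_def alternating_at_def ..

lemma one_form_iff: "one_form A \<omega> \<longleftrightarrow> (\<forall>p. linear_at \<omega> p) \<and>
     (\<forall>U X. open U \<longrightarrow> smooth_field_on A U X \<longrightarrow> smooth_fun_on A U (\<lambda>p. \<omega> p (X p)))"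
  unfolding one_form_def linear_at_def ..

end

context riemannian_manifold
begin

lemma linear_at_expand:
  assumes "orthonormal p e" "linear_at \<omega> p" "u \<in> tangent A p"
  shows "\<omega> p u = (\<Sum>i\<in>UNIV. g p u (e i) * \<omega> p (e i))"
proof -
  have "\<omega> p u = \<omega> p (\<Sum>i\<in>UNIV. g p u (e i) *\<^sub>R e i)"
    using orthonormal_expand[OF assms(1,3)] by simp
  then show ?thesis
    using linear_at_lincomb[OF assms(2) orthonormal_tangent[OF assms(1)]] by simp
qed

lemma alternating_at_expand:
  assumes e: "orthonormal p e" and H: "alternating_at H p"
    and uvw: "u \<in> tangent A p" "v \<in> tangent A p" "w \<in> tangent A p"
  shows "H p u v w = (\<Sum>i\<in>UNIV. \<Sum>j\<in>UNIV. \<Sum>k\<in>UNIV. 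
    g p u (e i) * g p v (e j) * g p w (e k) * H p (e i) (e j) (e k))"
proof -
  note t = orthonormal_tangent[OF e]
  have "H p u v w = (\<Sum>i\<in>UNIV. g p u (e i) * H p (e i) v w)"
    by (rule linear_at_expand[OF e alternating_at_linear1[OF H uvw(2,3)] uvw(1)])
  also have "\<dots> = (\<Sum>i\<in>UNIV. g p u (e i) * (\<Sum>j\<in>UNIV. g p v (e j) * H p (e i) (e j) w))"
    by (subst linear_at_expand[OF e alternating_at_linear2[OF H t uvw(3)] uvw(2)]) (rule refl)
  also have "\<dots> = (\<Sum>i\<in>UNIV. g p u (e i) * (\<Sum>j\<in>UNIV. g p v (e j) *
      (\<Sum>k\<in>UNIV. g p w (e k) * H p (e i) (e j) (e k))))"
    by (subst linear_at_expand[OF e alternating_at_linear3[OF H t t] uvw(3)]) (rule refl)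
  finally show ?thesis
    by (simp add: sum_distrib_left mult.assoc)
qed

lemma alternating3_frame:
  assumes "orthonormal p e" "alternating_at H p"
  shows "alternating3 (\<lambda>i j k. H p (e i) (e j) (e k))"
  by unfold_locales
    (use alternating_at_swap12[OF assms(2)] alternating_at_swap23[OF assms(2)] orthonormal_tangent[OF assms(1)]
      in blast)+

abbreviation star_coeff :: "'m form3 \<Rightarrow> 'm \<Rightarrow> (4 \<Rightarrow> 'm tvec) \<Rightarrow> 4 \<Rightarrow> real"
  where "star_coeff H p e \<equiv> alternating3.star (\<lambda>i j k. H p (e i) (e j) (e k))"

lemma star_coeff_simps:
  assumes "orthonormal p e" "alternating_at H p"
  shows "star_coeff H p e 1 = - H p (e 2) (e 3) (e 4)" "star_coeff H p e 2 = H p (e 1) (e 3) (e 4)"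
    "star_coeff H p e 3 = - H p (e 1) (e 2) (e 4)" "star_coeff H p e 4 = H p (e 1) (e 2) (e 3)"
  using alternating3.star_simps[OF alternating3_frame[OF assms]] by auto

lemma alternating_at_eq_det:
  assumes "orthonormal p e" "alternating_at H p"
    "u \<in> tangent A p" "v \<in> tangent A p" "w \<in> tangent A p"
  shows "H p u v w = - det (\<chi> i j. tuple4 (star_coeff H p e i) (g p u (e i)) (g p v (e i)) (g p w (e i)) j)"
  unfolding alternating_at_expand[OF assms]
  by (rule alternating3.trilinear_eq_det[OF alternating3_frame[OF assms(1,2)]])

lemma hodge3_own_frame:
  assumes H: "alternating_at H p" and v: "v \<in> tangent A p"
  defines "e \<equiv> \<lambda>i. frame A g p i p"
  shows "hodge3 A g H p v = (\<Sum>i\<in>UNIV. star_coeff H p e i * g p v (e i))"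
proof -
  have on: "orthonormal p e" unfolding e_def by (rule orthonormal_frame)
  have vol: "vol A g p (tuple4 (e i) (e j) (e k) v) =
     det (\<chi> l m. tuple4 (if l = i then 1 else 0) (if l = j then 1 else 0) (if l = k then 1 else 0) (g p v (e l)) m)"
    for i j k
    unfolding vol_def e_def[symmetric] tuple4_apply
    using orthonormal_g[OF on] g_sym[OF v orthonormal_tangent[OF on]] e_def by simp
  show ?thesis
    unfolding hodge3_def Let_def e_def[symmetric] vol
      alternating3.star_sum[OF alternating3_frame[OF on H]]
    by simp
qed

lemma hodge3_frame:
  assumes e: "oriented_onb p e" and H: "alternating_at H p" and v: "v \<in> tangent A p"
  shows "hodge3 A g H p v = (\<Sum>i\<in>UNIV. star_coeff H p e i * g p v (e i))"
proof -
  define f where "f = (\<lambda>i. frame A g p i p)"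
  have onf: "orthonormal p f" and of: "oriented_onb p f"
    unfolding f_def by (rule orthonormal_frame oriented_onb_frame)+
  have one: "orthonormal p e" using e by (simp add: oriented_onb_def)
  note te = orthonormal_tangent[OF one] and tf = orthonormal_tangent[OF onf]
  define W where "W = (\<Sum>i\<in>UNIV. star_coeff H p f i *\<^sub>R f i)"
  have W: "W \<in> tangent A p"
    unfolding W_def by (rule lincomb_tangent[OF onf])
  have Wf: "g p W (f i) = star_coeff H p f i" for i
    unfolding W_def by (rule g_lincomb_frame[OF onf])
  have HW: "H p u v w = - det (\<chi> i j. tuple4 (g p W (e i)) (g p u (e i)) (g p v (e i)) (g p w (e i)) j)"
    if uvw: "u \<in> tangent A p" "v \<in> tangent A p" "w \<in> tangent A p" for u v w
  proof -
    have t: "tuple4 W u v w j \<in> tangent A p" for j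
      using uvw W by (simp add: tuple4_def)
    have swap: "(\<chi> i j. tuple4 (g p W (x i)) (g p u (x i)) (g p v (x i)) (g p w (x i)) j)
      = (\<chi> i j. g p (x i) (tuple4 W u v w j))" if "\<And>i. x i \<in> tangent A p" for x
      unfolding tuple4_apply using g_sym[OF that] uvw W by simp
    show ?thesis
      unfolding alternating_at_eq_det[OF onf H uvw] Wf[symmetric] swap[of e, OF te] swap[of f, OF tf]
        det_gram_eq[OF e of, of "tuple4 W u v w", OF t] ..
  qed
  have "star_coeff H p e i = g p W (e i)" for i
  proof -
    have "\<forall>i. star_coeff H p e i = g p W (e i)"
      unfolding forall_4 star_coeff_simps[OF one H]
      using HW[OF te te te] orthonormal_g[OF one] by (simp add: det_4)
    then show ?thesis by blast
  qed
  moreover have "hodge3 A g H p v = g p W v"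
    unfolding g_expand[OF onf W v] Wf unfolding f_def by (rule hodge3_own_frame[OF H v])
  ultimately show ?thesis
    using g_expand[OF one W v] by simp
qed

lemma linear_at_hodge3:
  assumes "alternating_at H p"
  shows "linear_at (hodge3 A g H) p"
  unfolding linear_at_def
  by (simp add: hodge3_own_frame[OF assms] tangent_add tangent_scaleR g_add_left g_scale_left
      orthonormal_tangent[OF orthonormal_frame] sum.distrib sum_distrib_left algebra_simps)

lemma hodge3_frame_vector:
  assumes e: "oriented_onb p e" and H: "alternating_at H p"
  shows "hodge3 A g H p (e i) = star_coeff H p e i"
proof -
  have on: "orthonormal p e" using e by (simp add: oriented_onb_def)
  have "hodge3 A g H p (e i) = (\<Sum>j\<in>UNIV. star_coeff H p e j * (if i = j then 1 else 0))"
    unfolding hodge3_frame[OF e H orthonormal_tangent[OF on]] orthonormal_g[OF on] ..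
  then show ?thesis by (simp add: if_distrib cong: if_cong)
qed

lemma one_form_hodge3:
  assumes H: "three_form A H"
  shows "one_form A (hodge3 A g H)"
  unfolding one_form_iff
proof (intro conjI allI impI)
  have alt: "alternating_at H p" for p using H three_form_iff by blast
  show "linear_at (hodge3 A g H) p" for p by (rule linear_at_hodge3[OF alt])
  fix U X assume U: "open U" and X: "smooth_field_on A U X"
  show "smooth_fun_on A U (\<lambda>p. hodge3 A g H p (X p))"
  proof (rule smooth_fun_on_local)
    fix p assume p: "p \<in> U"
    obtain V where V: "p \<in> V" "frame_on V (frame A g p)" by (rule frame_near)
    define E where "E = frame A g p"
    have fr: "frame_on (U \<inter> V) E"
      using frame_on_subset[OF V(2), of "U \<inter> V"] U V(2) by (auto simp: E_def frame_on_def)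
    have o: "open (U \<inter> V)" and E: "smooth_field_on A (U \<inter> V) (E i)"
      and onb: "q \<in> U \<inter> V \<Longrightarrow> oriented_onb q (\<lambda>i. E i q)" for q i
      using fr by (auto simp: frame_on_def)
    have X': "smooth_field_on A (U \<inter> V) X" using smooth_field_on_subset[OF X] by simp
    have Hs: "smooth_fun_on A (U \<inter> V) (\<lambda>q. H q (E i q) (E j q) (E k q))" for i j k
      using H o E unfolding three_form_iff by blast
    have "smooth_fun_on A (U \<inter> V) (\<lambda>q. - H q (E 2 q) (E 3 q) (E 4 q) * g q (X q) (E 1 q)
        + H q (E 1 q) (E 3 q) (E 4 q) * g q (X q) (E 2 q)
        + - H q (E 1 q) (E 2 q) (E 4 q) * g q (X q) (E 3 q)
        + H q (E 1 q) (E 2 q) (E 3 q) * g q (X q) (E 4 q))"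
      by (intro smooth_fun_on_add smooth_fun_on_mult smooth_fun_on_uminus Hs smooth_g o E X')
    then have "smooth_fun_on A (U \<inter> V) (\<lambda>q. hodge3 A g H q (X q))"
    proof (rule smooth_fun_on_cong[OF o])
      fix q assume q: "q \<in> U \<inter> V"
      then have on: "orthonormal q (\<lambda>i. E i q)" using onb by (simp add: oriented_onb_def)
      show "- H q (E 2 q) (E 3 q) (E 4 q) * g q (X q) (E 1 q)
        + H q (E 1 q) (E 3 q) (E 4 q) * g q (X q) (E 2 q)
        + - H q (E 1 q) (E 2 q) (E 4 q) * g q (X q) (E 3 q)
        + H q (E 1 q) (E 2 q) (E 3 q) * g q (X q) (E 4 q) = hodge3 A g H q (X q)"
        unfolding hodge3_frame[OF onb[OF q] alt smooth_field_tangent[OF X' q]]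
        by (simp add: sum_4 star_coeff_simps[OF on alt])
    qed
    then show "\<exists>V. open V \<and> p \<in> V \<and> V \<subseteq> U \<and> smooth_fun_on A V (\<lambda>p. hodge3 A g H p (X p))"
      using o p V(1) by (intro exI[of _ "U \<inter> V"]) auto
  qed
qed

lemma hodge1_frame:
  assumes e: "oriented_onb p e" and \<omega>: "linear_at \<omega> p"
    and uvw: "u \<in> tangent A p" "v \<in> tangent A p" "w \<in> tangent A p"
  shows "hodge1 A g \<omega> p u v w = det (\<chi> i j. tuple4 (\<omega> p (e i)) (g p u (e i)) (g p v (e i)) (g p w (e i)) j)"
proof -
  define f where "f = (\<lambda>i. frame A g p i p)"
  have onf: "orthonormal p f" unfolding f_def by (rule orthonormal_frame)
  have one: "orthonormal p e" using e by (simp add: oriented_onb_def)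
  note te = orthonormal_tangent[OF one] and tf = orthonormal_tangent[OF onf]
  have "vol A g p (tuple4 (f l) u v w) =
      det (\<chi> i j. tuple4 (g p (f l) (e i)) (g p u (e i)) (g p v (e i)) (g p w (e i)) j)" for l
  proof -
    have t: "tuple4 (f l) u v w j \<in> tangent A p" for j
      using uvw tf by (simp add: tuple4_def)
    have "(\<chi> i j. tuple4 (g p (f l) (e i)) (g p u (e i)) (g p v (e i)) (g p w (e i)) j)
      = (\<chi> i j. g p (e i) (tuple4 (f l) u v w j))"
      unfolding tuple4_apply using g_sym[OF te] uvw tf by simp
    then show ?thesis
      using vol_eq[OF e t] by simp
  qed
  then have "hodge1 A g \<omega> p u v w = (\<Sum>l\<in>UNIV. \<omega> p (f l) *
      det (\<chi> i j. tuple4 (g p (f l) (e i)) (g p u (e i)) (g p v (e i)) (g p w (e i)) j))"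
    by (simp add: hodge1_def Let_def f_def)
  also have "\<dots> = det (\<chi> i j. tuple4 (\<Sum>l\<in>UNIV. \<omega> p (f l) * g p (f l) (e i))
      (g p u (e i)) (g p v (e i)) (g p w (e i)) j)"
    by (simp add: det_4 sum_4 algebra_simps)
  also have "\<dots> = det (\<chi> i j. tuple4 (\<omega> p (e i)) (g p u (e i)) (g p v (e i)) (g p w (e i)) j)"
    using linear_at_expand[OF onf \<omega> te] g_sym[OF te tf] by (simp add: mult.commute)
  finally show ?thesis .
qed

lemma three_form_minus_hodge1:
  assumes \<omega>: "one_form A \<omega>"
  shows "three_form A (- hodge1 A g \<omega>)"
  unfolding three_form_iff
proof (intro conjI allI impI)
  have lin: "linear_at \<omega> p" for p using \<omega> one_form_iff by blast
  show "alternating_at (- hodge1 A g \<omega>) p" for p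
    unfolding alternating_at_def
    by (simp add: hodge1_frame[OF oriented_onb_frame lin] tangent_add tangent_scaleR g_add_left g_scale_left
      orthonormal_tangent[OF orthonormal_frame] det_4 algebra_simps)
  fix U X Y Z assume U: "open U" and X: "smooth_field_on A U X" and Y: "smooth_field_on A U Y"
    and Z: "smooth_field_on A U Z"
  show "smooth_fun_on A U (\<lambda>p. (- hodge1 A g \<omega>) p (X p) (Y p) (Z p))"
  proof (rule smooth_fun_on_local)
    fix p assume p: "p \<in> U"
    obtain V where V: "p \<in> V" "frame_on V (frame A g p)" by (rule frame_near)
    define E where "E = frame A g p"
    have fr: "frame_on (U \<inter> V) E"
      using frame_on_subset[OF V(2), of "U \<inter> V"] U V(2) by (auto simp: E_def frame_on_def)
    have o: "open (U \<inter> V)" and E: "smooth_field_on A (U \<inter> V) (E i)"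
      and onb: "q \<in> U \<inter> V \<Longrightarrow> oriented_onb q (\<lambda>i. E i q)" for q i
      using fr by (auto simp: frame_on_def)
    have XYZ: "smooth_field_on A (U \<inter> V) X" "smooth_field_on A (U \<inter> V) Y" "smooth_field_on A (U \<inter> V) Z"
      using smooth_field_on_subset X Y Z by (metis inf_le1)+
    have \<omega>E: "smooth_fun_on A (U \<inter> V) (\<lambda>q. \<omega> q (E i q))" for i
      using \<omega> o E unfolding one_form_iff by blast
    have col: "smooth_fun_on A (U \<inter> V) (\<lambda>q. tuple4 (\<omega> q (E i q)) (g q (X q) (E i q))
        (g q (Y q) (E i q)) (g q (Z q) (E i q)) j)" for i j
      using exhaust_4[of j] by (auto intro!: smooth_g o E XYZ \<omega>E)
    have "smooth_fun_on A (U \<inter> V) (\<lambda>q. - det (\<chi> i j. tuple4 (\<omega> q (E i q)) (g q (X q) (E i q))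
        (g q (Y q) (E i q)) (g q (Z q) (E i q)) j))"
      unfolding det_def
      by (intro smooth_fun_on_uminus smooth_fun_on_sum smooth_fun_on_cmult smooth_fun_on_prod o)
        (simp add: col)
    then have "smooth_fun_on A (U \<inter> V) (\<lambda>p. (- hodge1 A g \<omega>) p (X p) (Y p) (Z p))"
      by (rule smooth_fun_on_cong[OF o])
        (use hodge1_frame[OF onb lin] smooth_field_tangent XYZ in auto)
    then show "\<exists>V. open V \<and> p \<in> V \<and> V \<subseteq> U \<and> smooth_fun_on A V (\<lambda>p. (- hodge1 A g \<omega>) p (X p) (Y p) (Z p))"
      using o p V(1) by (intro exI[of _ "U \<inter> V"]) auto
  qed
qed

lemma hodge3_minus_hodge1:
  assumes \<omega>: "one_form A \<omega>" and v: "v \<in> tangent A p"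
  shows "hodge3 A g (- hodge1 A g \<omega>) p v = \<omega> p v"
proof -
  define e where "e = (\<lambda>i. frame A g p i p)"
  have oe: "oriented_onb p e" and on: "orthonormal p e"
    unfolding e_def by (rule orthonormal_frame oriented_onb_frame)+
  have lin: "linear_at \<omega> p" using \<omega> one_form_iff by blast
  have alt: "alternating_at (- hodge1 A g \<omega>) p"
    using three_form_minus_hodge1[OF \<omega>] three_form_iff by blast
  note t = orthonormal_tangent[OF on]
  have "\<forall>i. star_coeff (- hodge1 A g \<omega>) p e i = \<omega> p (e i)"
    unfolding forall_4 star_coeff_simps[OF on alt]
    using hodge1_frame[OF oe lin t t t] orthonormal_g[OF on] by (simp add: det_4)
  then show ?thesis
    using hodge3_frame[OF oe alt v] linear_at_expand[OF on lin v] by (simp add: mult.commute)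
qed

end

section \<open>Connections\<close>

context oriented_manifold
begin

lemma smooth_field_nearI: "open U \<Longrightarrow> p \<in> U \<Longrightarrow> smooth_field_on A U X \<Longrightarrow> smooth_field_near A p X"
  unfolding smooth_field_near_def by blast

lemma smooth_field_near_cong:
  assumes "open U" "p \<in> U" "\<And>q. q \<in> U \<Longrightarrow> X q = Y q" "smooth_field_near A p X"
  shows "smooth_field_near A p Y"
proof -
  obtain V where V: "open V" "p \<in> V" "smooth_field_on A V X"
    using assms(4) unfolding smooth_field_near_def by blast
  have "smooth_field_on A (U \<inter> V) Y"
    by (rule smooth_field_on_cong[OF _ smooth_field_on_subset[OF V(3)]])
      (use V assms in auto)
  then show ?thesis
    using V assms by (intro smooth_field_nearI[of "U \<inter> V"]) auto
qed

lemma connection_outside: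
  assumes "affine_connection A D" "\<not> (smooth_field_near A p X \<and> smooth_field_near A p Y)"
  shows "D X Y p = 0"
  by (rule assms(1)[unfolded affine_connection_def, THEN conjunct1, rule_format, OF assms(2)])

lemma connection_cong:
  assumes "affine_connection A D" "open U" "p \<in> U" "\<And>q. q \<in> U \<Longrightarrow> X q = X' q" "\<And>q. q \<in> U \<Longrightarrow> Y q = Y' q"
  shows "D X Y p = D X' Y' p"
  by (rule assms(1)[unfolded affine_connection_def, THEN conjunct2, THEN conjunct1, rule_format, OF assms(2) _ assms(3)])
    (use assms(4,5) in simp)

lemma smooth_connection:
  assumes "affine_connection A D" "open U" "smooth_field_on A U X" "smooth_field_on A U Y"
  shows "smooth_field_on A U (D X Y)"
  by (rule assms(1)[unfolded affine_connection_def, THEN conjunct2, THEN conjunct2, THEN conjunct1, rule_format,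
        OF assms(2-4)])

lemma connection_rules:
  assumes "affine_connection A D" "open U" "smooth_fun_on A U f"
    "smooth_field_on A U X" "smooth_field_on A U X'"
    "smooth_field_on A U Y" "smooth_field_on A U Y'" "p \<in> U"
  shows "D (\<lambda>q. X q + X' q) Y p = D X Y p + D X' Y p \<and>
    D (\<lambda>q. f q *\<^sub>R X q) Y p = f p *\<^sub>R D X Y p \<and>
    D X (\<lambda>q. Y q + Y' q) p = D X Y p + D X Y' p \<and>
    D X (\<lambda>q. f q *\<^sub>R Y q) p = deriv_along A X f p *\<^sub>R Y p + f p *\<^sub>R D X Y p"
  using assms(1)[unfolded affine_connection_def plus_fun_def, THEN conjunct2, THEN conjunct2, THEN conjunct2,
      rule_format, OF assms(2-8)] by (simp add: plus_fun_def)

lemma connection_add_left: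
  "affine_connection A D \<Longrightarrow> open U \<Longrightarrow> smooth_field_on A U X \<Longrightarrow> smooth_field_on A U X' \<Longrightarrow>
    smooth_field_on A U Y \<Longrightarrow> p \<in> U \<Longrightarrow> D (\<lambda>q. X q + X' q) Y p = D X Y p + D X' Y p"
  using connection_rules[of D U "\<lambda>_. 0" X X' Y Y p] by simp

lemma connection_scale_left:
  "affine_connection A D \<Longrightarrow> open U \<Longrightarrow> smooth_fun_on A U f \<Longrightarrow> smooth_field_on A U X \<Longrightarrow>
    smooth_field_on A U Y \<Longrightarrow> p \<in> U \<Longrightarrow> D (\<lambda>q. f q *\<^sub>R X q) Y p = f p *\<^sub>R D X Y p"
  using connection_rules[of D U f X X Y Y p] by simp

lemma connection_add_right:
  "affine_connection A D \<Longrightarrow> open U \<Longrightarrow> smooth_field_on A U X \<Longrightarrow> smooth_field_on A U Y' \<Longrightarrow>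
    smooth_field_on A U Y \<Longrightarrow> p \<in> U \<Longrightarrow> D X (\<lambda>q. Y q + Y' q) p = D X Y p + D X Y' p"
  using connection_rules[of D U "\<lambda>_. 0" X X Y Y' p] by simp

lemma connection_scale_right:
  "affine_connection A D \<Longrightarrow> open U \<Longrightarrow> smooth_fun_on A U f \<Longrightarrow> smooth_field_on A U X \<Longrightarrow>
    smooth_field_on A U Y \<Longrightarrow> p \<in> U \<Longrightarrow>
    D X (\<lambda>q. f q *\<^sub>R Y q) p = deriv_along A X f p *\<^sub>R Y p + f p *\<^sub>R D X Y p"
  using connection_rules[of D U f X X Y Y p] by simp

lemma torsion_freeD:
  "torsion_free A D \<Longrightarrow> open U \<Longrightarrow> smooth_field_on A U X \<Longrightarrow> smooth_field_on A U Y \<Longrightarrow> p \<in> U \<Longrightarrow>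
    lie_bracket A X Y p = D X Y p - D Y X p"
  unfolding torsion_free_def by metis

end

context riemannian_manifold
begin

lemma metric_deriv_eqD:
  assumes "metric_deriv_eq A D g \<omega>" "open U" "smooth_field_on A U X" "smooth_field_on A U Y"
    "smooth_field_on A U Z" "p \<in> U"
  shows "deriv_along A X (\<lambda>q. g q (Y q) (Z q)) p
    = \<omega> p (X p) * g p (Y p) (Z p) + g p (D X Y p) (Z p) + g p (Y p) (D X Z p)"
  using assms(1)[unfolded metric_deriv_eq_def metric_deriv_def, rule_format, OF assms(2-6)] by simp

lemma koszul:
  assumes D: "affine_connection A D" "torsion_free A D" "metric_deriv_eq A D g \<omega>"
    and U: "open U" and X: "smooth_field_on A U X" and Y: "smooth_field_on A U Y"
    and Z: "smooth_field_on A U Z" and p: "p \<in> U"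
  shows "2 * g p (D X Y p) (Z p) = deriv_along A X (\<lambda>q. g q (Y q) (Z q)) p
    + deriv_along A Y (\<lambda>q. g q (X q) (Z q)) p - deriv_along A Z (\<lambda>q. g q (X q) (Y q)) p
    + g p (lie_bracket A X Y p) (Z p) - g p (lie_bracket A X Z p) (Y p) - g p (lie_bracket A Y Z p) (X p)
    - \<omega> p (X p) * g p (Y p) (Z p) - \<omega> p (Y p) * g p (X p) (Z p) + \<omega> p (Z p) * g p (X p) (Y p)"
proof -
  have t: "D V W p \<in> tangent A p" if "smooth_field_on A U V" "smooth_field_on A U W" for V W
    using smooth_field_tangent[OF smooth_connection[OF D(1) U that] p] .
  have tt: "X p \<in> tangent A p" "Y p \<in> tangent A p" "Z p \<in> tangent A p"
    using smooth_field_tangent p X Y Z by blast+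
  note m = metric_deriv_eqD[OF D(3) U]
  note b = torsion_freeD[OF D(2) U]
  show ?thesis
    unfolding m[OF X Y Z p] m[OF Y X Z p] m[OF Z X Y p] b[OF X Y p] b[OF X Z p] b[OF Y Z p]
    using t X Y Z tt g_sym[OF tt(2) t[OF X Z]] g_sym[OF tt(1) t[OF Y Z]] g_sym[OF tt(1) t[OF Z Y]]
    by (simp add: g_diff_left)
qed

definition weyl_form :: "'m form1 \<Rightarrow> 'm form3"
  where "weyl_form \<omega> p u v w =
    1/2 * (\<omega> p w * g p u v - \<omega> p u * g p v w - \<omega> p v * g p u w)"

lemma connection_weyl_form:
  assumes D: "affine_connection A D" "torsion_free A D" "metric_deriv_eq A D g \<omega>"
    and L: "levi_civita A g L"
    and U: "open U" and X: "smooth_field_on A U X" and Y: "smooth_field_on A U Y"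
    and Z: "smooth_field_on A U Z" and p: "p \<in> U"
  shows "g p (D X Y p) (Z p) = g p (L X Y p) (Z p) + weyl_form \<omega> p (X p) (Y p) (Z p)"
  using koszul[OF D U X Y Z p] koszul[OF _ _ _ U X Y Z p, of L "\<lambda>_ _. 0"] L
  by (simp add: levi_civita_def weyl_form_def field_simps)

lemma connection_eqI:
  assumes D: "affine_connection A D" and D': "affine_connection A D'"
    and eq: "\<And>U X Y Z p. open U \<Longrightarrow> smooth_field_on A U X \<Longrightarrow> smooth_field_on A U Y \<Longrightarrow> smooth_field_on A U Z \<Longrightarrow>
      p \<in> U \<Longrightarrow> g p (D X Y p) (Z p) = g p (D' X Y p) (Z p)"
  shows "D = D'"
proof (intro ext)
  fix X Y p c
  have "D X Y p = D' X Y p"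
  proof (cases "smooth_field_near A p X \<and> smooth_field_near A p Y")
    case True
    then obtain U V where "open U" "p \<in> U" "smooth_field_on A U X" "open V" "p \<in> V" "smooth_field_on A V Y"
      unfolding smooth_field_near_def by blast
    then have W: "open (U \<inter> V)" "p \<in> U \<inter> V" and
      X: "smooth_field_on A (U \<inter> V) X" and Y: "smooth_field_on A (U \<inter> V) Y"
      using smooth_field_on_subset by (blast, blast, metis inf_le1, metis inf_le2)
    have DD: "smooth_field_on A (U \<inter> V) (D X Y)" "smooth_field_on A (U \<inter> V) (D' X Y)"
      using smooth_connection[OF D W(1) X Y] smooth_connection[OF D' W(1) X Y] .
    define Z where "Z = (\<lambda>q. D X Y q - D' X Y q)"
    have Z: "smooth_field_on A (U \<inter> V) Z"
      unfolding Z_def by (rule smooth_field_on_diff[OF W(1) DD])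
    have t: "D X Y p \<in> tangent A p" "D' X Y p \<in> tangent A p" "Z p \<in> tangent A p"
      using smooth_field_tangent DD Z W(2) by blast+
    have "g p (D X Y p - D' X Y p) (Z p) = 0"
      using eq[OF W(1) X Y Z W(2)] g_diff_left[OF t] by simp
    then have "Z p = 0"
      using g_pos[OF t(3)] by (force simp: Z_def)
    then show ?thesis
      by (simp add: Z_def)
  qed (use connection_outside D D' in metis)
  then show "D X Y p c = D' X Y p c" by simp
qed

definition trilinear_form :: "'m form3 \<Rightarrow> bool"
  where "trilinear_form b \<longleftrightarrow>
    (\<forall>p. \<forall>u\<in>tangent A p. \<forall>v\<in>tangent A p. linear_at (\<lambda>p w. b p w u v) p \<and>
       linear_at (\<lambda>p w. b p u w v) p \<and> linear_at (\<lambda>p w. b p u v w) p) \<and>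
    (\<forall>U X Y Z. open U \<longrightarrow> smooth_field_on A U X \<longrightarrow> smooth_field_on A U Y \<longrightarrow> smooth_field_on A U Z \<longrightarrow>
       smooth_fun_on A U (\<lambda>p. b p (X p) (Y p) (Z p)))"

definition raise :: "'m form3 \<Rightarrow> 'm \<Rightarrow> 'm tvec \<Rightarrow> 'm tvec \<Rightarrow> 'm tvec"
  where "raise b p u v = (\<Sum>i\<in>UNIV. b p u v (frame A g p i p) *\<^sub>R frame A g p i p)"

lemma raise_tangent: "raise b p u v \<in> tangent A p"
  unfolding raise_def by (rule lincomb_tangent[OF orthonormal_frame])

lemma g_raise:
  assumes "trilinear_form b" "u \<in> tangent A p" "v \<in> tangent A p" "w \<in> tangent A p"
  shows "g p (raise b p u v) w = b p u v w"
proof -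
  have "linear_at (\<lambda>p w. b p u v w) p"
    using assms unfolding trilinear_form_def by blast
  then have "b p u v w = (\<Sum>i\<in>UNIV. g p w (frame A g p i p) * b p u v (frame A g p i p))"
    using linear_at_expand[OF orthonormal_frame _ assms(4), of "\<lambda>p w. b p u v w"] by simp
  also have "\<dots> = g p (raise b p u v) w"
    unfolding g_expand[OF orthonormal_frame raise_tangent assms(4)]
    unfolding raise_def g_lincomb_frame[OF orthonormal_frame] by (simp add: mult.commute)
  finally show ?thesis by simp
qed

lemma raise_eqI:
  assumes "trilinear_form b" "u \<in> tangent A p" "v \<in> tangent A p" "x \<in> tangent A p"
    "\<And>w. w \<in> tangent A p \<Longrightarrow> g p x w = b p u v w"
  shows "raise b p u v = x"
  by (rule g_nondegenerate[OF raise_tangent assms(4)]) (simp add: g_raise assms)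

lemma raise_add_left:
  assumes b: "trilinear_form b" and t: "u \<in> tangent A p" "u' \<in> tangent A p" "v \<in> tangent A p"
  shows "raise b p (u + u') v = raise b p u v + raise b p u' v"
proof (rule raise_eqI[OF b])
  fix w assume w: "w \<in> tangent A p"
  then have "linear_at (\<lambda>p u. b p u v w) p" using b t unfolding trilinear_form_def by blast
  from linear_at_add[OF this t(1,2)] show "g p (raise b p u v + raise b p u' v) w = b p (u + u') v w"
    by (simp add: g_add_left raise_tangent w g_raise b t)
qed (use t raise_tangent in auto)

lemma raise_add_right:
  assumes b: "trilinear_form b" and t: "u \<in> tangent A p" "u' \<in> tangent A p" "v \<in> tangent A p"
  shows "raise b p v (u + u') = raise b p v u + raise b p v u'"
proof (rule raise_eqI[OF b])
  fix w assume w: "w \<in> tangent A p"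
  then have "linear_at (\<lambda>p u. b p v u w) p" using b t unfolding trilinear_form_def by blast
  from linear_at_add[OF this t(1,2)] show "g p (raise b p v u + raise b p v u') w = b p v (u + u') w"
    by (simp add: g_add_left raise_tangent w g_raise b t)
qed (use t raise_tangent in auto)

lemma raise_scale_left:
  assumes b: "trilinear_form b" and t: "u \<in> tangent A p" "v \<in> tangent A p"
  shows "raise b p (a *\<^sub>R u) v = a *\<^sub>R raise b p u v"
proof (rule raise_eqI[OF b])
  fix w assume w: "w \<in> tangent A p"
  then have "linear_at (\<lambda>p u. b p u v w) p" using b t unfolding trilinear_form_def by blast
  from linear_at_scale[OF this t(1)] show "g p (a *\<^sub>R raise b p u v) w = b p (a *\<^sub>R u) v w"
    by (simp add: g_scale_left raise_tangent w g_raise b t)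
qed (use t raise_tangent in auto)

lemma raise_scale_right:
  assumes b: "trilinear_form b" and t: "u \<in> tangent A p" "v \<in> tangent A p"
  shows "raise b p v (a *\<^sub>R u) = a *\<^sub>R raise b p v u"
proof (rule raise_eqI[OF b])
  fix w assume w: "w \<in> tangent A p"
  then have "linear_at (\<lambda>p u. b p v u w) p" using b t unfolding trilinear_form_def by blast
  from linear_at_scale[OF this t(1)] show "g p (a *\<^sub>R raise b p v u) w = b p v (a *\<^sub>R u) w"
    by (simp add: g_scale_left raise_tangent w g_raise b t)
qed (use t raise_tangent in auto)

lemma smooth_raise:
  assumes b: "trilinear_form b" and U: "open U" and X: "smooth_field_on A U X" and Y: "smooth_field_on A U Y"
  shows "smooth_field_on A U (\<lambda>p. raise b p (X p) (Y p))"
proof (rule smooth_field_on_local)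
  fix p assume p: "p \<in> U"
  obtain V where V: "p \<in> V" "frame_on V (frame A g p)" by (rule frame_near)
  define E where "E = frame A g p"
  have fr: "frame_on (U \<inter> V) E"
    using frame_on_subset[OF V(2), of "U \<inter> V"] U V(2) by (auto simp: E_def frame_on_def)
  have o: "open (U \<inter> V)" and E: "smooth_field_on A (U \<inter> V) (E i)"
    and onb: "q \<in> U \<inter> V \<Longrightarrow> oriented_onb q (\<lambda>i. E i q)" for q i
    using fr by (auto simp: frame_on_def)
  have XY: "smooth_field_on A (U \<inter> V) X" "smooth_field_on A (U \<inter> V) Y"
    using smooth_field_on_subset X Y by (metis inf_le1)+
  have bs: "smooth_fun_on A (U \<inter> V) (\<lambda>q. b q (X q) (Y q) (E i q))" for i
    using b o E XY unfolding trilinear_form_def by blast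
  have "smooth_field_on A (U \<inter> V) (\<lambda>q. \<Sum>i\<in>UNIV. b q (X q) (Y q) (E i q) *\<^sub>R E i q)"
    by (intro smooth_field_on_sum smooth_field_on_scaleR bs o E)
  then have "smooth_field_on A (U \<inter> V) (\<lambda>q. raise b q (X q) (Y q))"
  proof (rule smooth_field_on_cong[OF o])
    fix q assume q: "q \<in> U \<inter> V"
    have on: "orthonormal q (\<lambda>i. E i q)" using onb[OF q] by (simp add: oriented_onb_def)
    have t: "X q \<in> tangent A q" "Y q \<in> tangent A q" "E i q \<in> tangent A q" for i
      using smooth_field_tangent XY E q by blast+
    show "(\<Sum>i\<in>UNIV. b q (X q) (Y q) (E i q) *\<^sub>R E i q) = raise b q (X q) (Y q)"
      using orthonormal_expand[OF on raise_tangent, of b "X q" "Y q"] by (simp add: g_raise b t)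
  qed
  then show "\<exists>V. open V \<and> p \<in> V \<and> V \<subseteq> U \<and> smooth_field_on A V (\<lambda>p. raise b p (X p) (Y p))"
    using o p V(1) by (intro exI[of _ "U \<inter> V"]) auto
qed

text \<open>The guard keeps the convention that a connection vanishes where its arguments are not smooth.\<close>

definition perturb :: "'m connection \<Rightarrow> 'm form3 \<Rightarrow> 'm connection"
  where "perturb D b X Y p = (if smooth_field_near A p X \<and> smooth_field_near A p Y
    then D X Y p + raise b p (X p) (Y p) else 0)"

lemma perturb_eq:
  "open U \<Longrightarrow> smooth_field_on A U X \<Longrightarrow> smooth_field_on A U Y \<Longrightarrow> p \<in> U \<Longrightarrow>
    perturb D b X Y p = D X Y p + raise b p (X p) (Y p)"
  unfolding perturb_def using smooth_field_nearI by simp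

lemma affine_perturb:
  assumes D: "affine_connection A D" and b: "trilinear_form b"
  shows "affine_connection A (perturb D b)"
  unfolding affine_connection_def
proof (intro conjI allI impI)
  show "perturb D b X Y p = 0" if "\<not> (smooth_field_near A p X \<and> smooth_field_near A p Y)" for X Y :: "'m field" and p
    using that by (simp only: perturb_def if_False)
next
  fix U :: "'m set" and X X' Y Y' :: "'m field"
  assume U: "open U" and eq: "\<forall>p\<in>U. X p = X' p \<and> Y p = Y' p"
  show "\<forall>p\<in>U. perturb D b X Y p = perturb D b X' Y' p"
  proof
    fix p assume p: "p \<in> U"
    have "smooth_field_near A p X \<longleftrightarrow> smooth_field_near A p X'" "smooth_field_near A p Y \<longleftrightarrow> smooth_field_near A p Y'"
      using smooth_field_near_cong[OF U p] eq by metis+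
    moreover have "D X Y p = D X' Y' p"
      using connection_cong[OF D U p] eq by blast
    ultimately show "perturb D b X Y p = perturb D b X' Y' p"
      using eq p by (simp add: perturb_def)
  qed
next
  fix U X Y assume U: "open U" and X: "smooth_field_on A U X" and Y: "smooth_field_on A U Y"
  show "smooth_field_on A U (perturb D b X Y)"
    by (rule smooth_field_on_cong[OF U smooth_field_on_add[OF U smooth_connection[OF D U X Y] smooth_raise[OF b U X Y]]])
      (simp add: perturb_eq[OF U X Y])
next
  fix U X X' Y Y' f
  assume U: "open U" and f: "smooth_fun_on A U f" and X: "smooth_field_on A U X" and X': "smooth_field_on A U X'"
    and Y: "smooth_field_on A U Y" and Y': "smooth_field_on A U Y'"
  show "\<forall>p\<in>U. perturb D b (X + X') Y p = perturb D b X Y p + perturb D b X' Y p \<and>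
                perturb D b (\<lambda>q. f q *\<^sub>R X q) Y p = f p *\<^sub>R perturb D b X Y p \<and>
                perturb D b X (Y + Y') p = perturb D b X Y p + perturb D b X Y' p \<and>
                perturb D b X (\<lambda>q. f q *\<^sub>R Y q) p = deriv_along A X f p *\<^sub>R Y p + f p *\<^sub>R perturb D b X Y p"
  proof
    fix p assume p: "p \<in> U"
    have t: "X p \<in> tangent A p" "X' p \<in> tangent A p" "Y p \<in> tangent A p" "Y' p \<in> tangent A p"
      using smooth_field_tangent X X' Y Y' p by blast+
    have s: "smooth_field_on A U (\<lambda>q. X q + X' q)" "smooth_field_on A U (\<lambda>q. Y q + Y' q)"
      "smooth_field_on A U (\<lambda>q. f q *\<^sub>R X q)" "smooth_field_on A U (\<lambda>q. f q *\<^sub>R Y q)"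
      by (intro smooth_field_on_add smooth_field_on_scaleR U X X' Y Y' f)+
    have pf: "X + X' = (\<lambda>q. X q + X' q)" "Y + Y' = (\<lambda>q. Y q + Y' q)"
      by (auto simp: plus_fun_def)
    note r = connection_rules[OF D U f X X' Y Y' p]
    note r' = r[THEN conjunct1] r[THEN conjunct2, THEN conjunct1]
      r[THEN conjunct2, THEN conjunct2, THEN conjunct1] r[THEN conjunct2, THEN conjunct2, THEN conjunct2]
    show "perturb D b (X + X') Y p = perturb D b X Y p + perturb D b X' Y p \<and>
                perturb D b (\<lambda>q. f q *\<^sub>R X q) Y p = f p *\<^sub>R perturb D b X Y p \<and>
                perturb D b X (Y + Y') p = perturb D b X Y p + perturb D b X Y' p \<and>
                perturb D b X (\<lambda>q. f q *\<^sub>R Y q) p = deriv_along A X f p *\<^sub>R Y p + f p *\<^sub>R perturb D b X Y p"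
      unfolding pf perturb_eq[OF U X Y p] perturb_eq[OF U X' Y p] perturb_eq[OF U X Y' p]
        perturb_eq[OF U s(1) Y p] perturb_eq[OF U X s(2) p] perturb_eq[OF U s(3) Y p] perturb_eq[OF U X s(4) p] r'
        raise_add_left[OF b t(1,2,3)] raise_add_right[OF b t(3,4,1)]
        raise_scale_left[OF b t(1,3)] raise_scale_right[OF b t(3,1)]
      by (simp add: scaleR_add_right)
  qed
qed

lemma g_perturb:
  assumes D: "affine_connection A D" and b: "trilinear_form b"
    and U: "open U" and X: "smooth_field_on A U X" and Y: "smooth_field_on A U Y" and Z: "smooth_field_on A U Z"
    and p: "p \<in> U"
  shows "g p (perturb D b X Y p) (Z p) = g p (D X Y p) (Z p) + b p (X p) (Y p) (Z p)"
proof -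
  have t: "X p \<in> tangent A p" "Y p \<in> tangent A p" "Z p \<in> tangent A p" "D X Y p \<in> tangent A p"
    using smooth_field_tangent smooth_connection[OF D U X Y] X Y Z p by blast+
  show ?thesis
    unfolding perturb_eq[OF U X Y p] g_add_left[OF t(4) raise_tangent t(3)] g_raise[OF b t(1-3)] ..
qed

lemma trilinear_weyl_form:
  assumes "one_form A \<omega>"
  shows "trilinear_form (weyl_form \<omega>)"
  unfolding trilinear_form_def
proof (intro conjI allI ballI impI)
  have lin: "linear_at \<omega> p" for p using assms one_form_iff by blast
  fix p u v assume t: "u \<in> tangent A p" "v \<in> tangent A p"
  show "linear_at (\<lambda>p w. weyl_form \<omega> p w u v) p" "linear_at (\<lambda>p w. weyl_form \<omega> p u w v) p"
    "linear_at (\<lambda>p w. weyl_form \<omega> p u v w) p"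
    unfolding linear_at_def weyl_form_def
    by (simp_all add: linear_at_add[OF lin] linear_at_scale[OF lin] g_add_left g_add_right
        g_scale_left g_scale_right t algebra_simps)
next
  fix U X Y Z assume a: "open U" "smooth_field_on A U X" "smooth_field_on A U Y" "smooth_field_on A U Z"
  then have "smooth_fun_on A U (\<lambda>p. \<omega> p (X p))" "smooth_fun_on A U (\<lambda>p. \<omega> p (Y p))" "smooth_fun_on A U (\<lambda>p. \<omega> p (Z p))"
    using assms one_form_iff by blast+
  then show "smooth_fun_on A U (\<lambda>p. weyl_form \<omega> p (X p) (Y p) (Z p))"
    unfolding weyl_form_def
    by (intro smooth_fun_on_cmult smooth_fun_on_diff smooth_fun_on_mult smooth_g a)
qed

lemma trilinear_three_form:
  assumes "three_form A H"
  shows "trilinear_form (\<lambda>p u v w. a * H p u v w)"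
  unfolding trilinear_form_def
proof (intro conjI allI ballI impI)
  have alt: "alternating_at H p" for p using assms three_form_iff by blast
  have lin: "linear_at (\<lambda>p v. a * \<theta> p v) p" if "linear_at \<theta> p" for p and \<theta> :: "'m form1"
    using that by (simp add: linear_at_def algebra_simps)
  fix p u v assume t: "u \<in> tangent A p" "v \<in> tangent A p"
  show "linear_at (\<lambda>p w. a * H p w u v) p" "linear_at (\<lambda>p w. a * H p u w v) p"
    "linear_at (\<lambda>p w. a * H p u v w) p"
    by (rule lin[OF alternating_at_linear1[OF alt t]] lin[OF alternating_at_linear2[OF alt t]]
        lin[OF alternating_at_linear3[OF alt t]])+
next
  fix U X Y Z assume a: "open U" "smooth_field_on A U X" "smooth_field_on A U Y" "smooth_field_on A U Z"
  then show "smooth_fun_on A U (\<lambda>p. a * H p (X p) (Y p) (Z p))"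
    using assms three_form_iff by (intro smooth_fun_on_cmult) blast+
qed

lemma torsion_free_perturb_weyl:
  assumes "torsion_free A D" "one_form A \<omega>"
  shows "torsion_free A (perturb D (weyl_form \<omega>))"
  unfolding torsion_free_def
proof (intro allI impI ballI)
  fix U X Y p assume U: "open U" and X: "smooth_field_on A U X" and Y: "smooth_field_on A U Y" and p: "p \<in> U"
  have t: "X p \<in> tangent A p" "Y p \<in> tangent A p"
    using smooth_field_tangent X Y p by blast+
  have "raise (weyl_form \<omega>) p (X p) (Y p) = raise (weyl_form \<omega>) p (Y p) (X p)"
    by (rule raise_eqI[OF trilinear_weyl_form[OF assms(2)] t raise_tangent])
      (use t g_sym[OF t] in \<open>simp add: g_raise[OF trilinear_weyl_form[OF assms(2)]] weyl_form_def\<close>)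
  then show "perturb D (weyl_form \<omega>) X Y p - perturb D (weyl_form \<omega>) Y X p = lie_bracket A X Y p"
    unfolding perturb_eq[OF U X Y p] perturb_eq[OF U Y X p] torsion_freeD[OF assms(1) U X Y p] by simp
qed

lemma metric_deriv_eq_perturb_weyl:
  assumes D: "affine_connection A D" and \<theta>: "metric_deriv_eq A D g \<theta>" and \<omega>: "one_form A \<omega>"
  shows "metric_deriv_eq A (perturb D (weyl_form \<omega>)) g (\<lambda>p v. \<theta> p v + \<omega> p v)"
  unfolding metric_deriv_eq_def metric_deriv_def
proof (intro allI impI ballI)
  fix U X Y Z p assume U: "open U" and X: "smooth_field_on A U X" and Y: "smooth_field_on A U Y"
    and Z: "smooth_field_on A U Z" and p: "p \<in> U"
  have t: "X p \<in> tangent A p" "Y p \<in> tangent A p" "Z p \<in> tangent A p"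
    using smooth_field_tangent X Y Z p by blast+
  note b = trilinear_weyl_form[OF \<omega>]
  have tD: "D X Z p \<in> tangent A p" "perturb D (weyl_form \<omega>) X Z p \<in> tangent A p"
    using smooth_field_tangent[OF smooth_connection[OF D U X Z] p]
      smooth_field_tangent[OF smooth_connection[OF affine_perturb[OF D b] U X Z] p] .
  show "deriv_along A X (\<lambda>q. g q (Y q) (Z q)) p - g p (perturb D (weyl_form \<omega>) X Y p) (Z p)
       - g p (Y p) (perturb D (weyl_form \<omega>) X Z p) = (\<theta> p (X p) + \<omega> p (X p)) * g p (Y p) (Z p)"
    unfolding g_sym[OF t(2) tD(2)] g_perturb[OF D b U X Y Z p] g_perturb[OF D b U X Z Y p]
      metric_deriv_eqD[OF \<theta> U X Y Z p] g_sym[OF t(2) tD(1)] weyl_form_def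
    using g_sym[OF t(2,3)] by (simp add: algebra_simps)
qed

end

section \<open>Curvature\<close>

context oriented_manifold
begin

lemma connection_tangent:
  "affine_connection A D \<Longrightarrow> open U \<Longrightarrow> smooth_field_on A U X \<Longrightarrow> smooth_field_on A U Y \<Longrightarrow> p \<in> U
    \<Longrightarrow> D X Y p \<in> tangent A p"
  using smooth_field_tangent smooth_connection by blast

lemma smooth_lie_bracket:
  assumes D: "affine_connection A D" "torsion_free A D" and U: "open U"
    and X: "smooth_field_on A U X" and Y: "smooth_field_on A U Y"
  shows "smooth_field_on A U (lie_bracket A X Y)"
  by (rule smooth_field_on_cong[OF U smooth_field_on_diff[OF U smooth_connection[OF D(1) U X Y] smooth_connection[OF D(1) U Y X]]])
    (simp add: torsion_freeD[OF D(2) U X Y])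

lemma curvature_apply:
  "curvature A D X Y Z p = D X (D Y Z) p - D Y (D X Z) p - D (lie_bracket A X Y) Z p"
  by (simp add: curvature_def)

lemma curvature_tangent:
  assumes D: "affine_connection A D" "torsion_free A D" and U: "open U"
    and V: "smooth_field_on A U V" and X: "smooth_field_on A U X" and Y: "smooth_field_on A U Y" and p: "p \<in> U"
  shows "curvature A D V X Y p \<in> tangent A p"
  unfolding curvature_apply
  by (intro tangent_diff connection_tangent[OF D(1) U _ _ p] smooth_connection[OF D(1) U]
      smooth_lie_bracket[OF D U] V X Y)

lemma curvature_add_left:
  assumes D: "affine_connection A D" "torsion_free A D" and U: "open U"
    and V: "smooth_field_on A U V" and W: "smooth_field_on A U W"
    and X: "smooth_field_on A U X" and Y: "smooth_field_on A U Y" and p: "p \<in> U"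
  shows "curvature A D (\<lambda>q. V q + W q) X Y p = curvature A D V X Y p + curvature A D W X Y p"
proof -
  note c = smooth_connection[OF D(1) U] and add = connection_add_left[OF D(1) U] and addr = connection_add_right[OF D(1) U]
  have VW: "smooth_field_on A U (\<lambda>q. V q + W q)" by (rule smooth_field_on_add[OF U V W])
  have 1: "D (\<lambda>q. V q + W q) (D X Y) p = D V (D X Y) p + D W (D X Y) p"
    by (rule add[OF V W c[OF X Y] p])
  have "D X (D (\<lambda>q. V q + W q) Y) p = D X (\<lambda>q. D V Y q + D W Y q) p"
    by (rule connection_cong[OF D(1) U p refl add[OF V W Y]])
  then have 2: "D X (D (\<lambda>q. V q + W q) Y) p = D X (D V Y) p + D X (D W Y) p"
    using addr[OF X c[OF W Y] c[OF V Y] p] by simp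
  have "lie_bracket A (\<lambda>q. V q + W q) X q = lie_bracket A V X q + lie_bracket A W X q" if "q \<in> U" for q
    using torsion_freeD[OF D(2) U VW X that] torsion_freeD[OF D(2) U V X that] torsion_freeD[OF D(2) U W X that]
      add[OF V W X that] addr[OF X W V that] by simp
  then have "D (lie_bracket A (\<lambda>q. V q + W q) X) Y p = D (\<lambda>q. lie_bracket A V X q + lie_bracket A W X q) Y p"
    by (rule connection_cong[OF D(1) U p _ refl])
  then have 3: "D (lie_bracket A (\<lambda>q. V q + W q) X) Y p = D (lie_bracket A V X) Y p + D (lie_bracket A W X) Y p"
    using add[OF smooth_lie_bracket[OF D U V X] smooth_lie_bracket[OF D U W X] Y p] by simp
  show ?thesis
    unfolding curvature_apply 1 2 3 by simp
qed

lemma curvature_scale_left: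
  assumes D: "affine_connection A D" "torsion_free A D" and U: "open U"
    and f: "smooth_fun_on A U f" and V: "smooth_field_on A U V"
    and X: "smooth_field_on A U X" and Y: "smooth_field_on A U Y" and p: "p \<in> U"
  shows "curvature A D (\<lambda>q. f q *\<^sub>R V q) X Y p = f p *\<^sub>R curvature A D V X Y p"
proof -
  note c = smooth_connection[OF D(1) U] and sl = connection_scale_left[OF D(1) U] and sr = connection_scale_right[OF D(1) U]
  define f' where "f' = (\<lambda>q. - deriv_along A X f q)"
  have f': "smooth_fun_on A U f'"
    unfolding f'_def by (rule smooth_fun_on_uminus[OF U smooth_deriv_along[OF U f X]])
  have fV: "smooth_field_on A U (\<lambda>q. f q *\<^sub>R V q)" by (rule smooth_field_on_scaleR[OF U f V])
  have 1: "D (\<lambda>q. f q *\<^sub>R V q) (D X Y) p = f p *\<^sub>R D V (D X Y) p"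
    by (rule sl[OF f V c[OF X Y] p])
  have "D X (D (\<lambda>q. f q *\<^sub>R V q) Y) p = D X (\<lambda>q. f q *\<^sub>R D V Y q) p"
    by (rule connection_cong[OF D(1) U p refl sl[OF f V Y]])
  then have 2: "D X (D (\<lambda>q. f q *\<^sub>R V q) Y) p = f p *\<^sub>R D X (D V Y) p - f' p *\<^sub>R D V Y p"
    using sr[OF f X c[OF V Y] p] by (simp add: f'_def)
  have "lie_bracket A (\<lambda>q. f q *\<^sub>R V q) X q = f q *\<^sub>R lie_bracket A V X q + f' q *\<^sub>R V q" if "q \<in> U" for q
    unfolding torsion_freeD[OF D(2) U fV X that] torsion_freeD[OF D(2) U V X that]
      sl[OF f V X that] sr[OF f X V that] f'_def by (simp add: scaleR_diff_right)
  then have "D (lie_bracket A (\<lambda>q. f q *\<^sub>R V q) X) Y p = D (\<lambda>q. f q *\<^sub>R lie_bracket A V X q + f' q *\<^sub>R V q) Y p"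
    by (rule connection_cong[OF D(1) U p _ refl])
  also have "\<dots> = f p *\<^sub>R D (lie_bracket A V X) Y p + f' p *\<^sub>R D V Y p"
    unfolding connection_add_left[OF D(1) U smooth_field_on_scaleR[OF U f smooth_lie_bracket[OF D U V X]]
        smooth_field_on_scaleR[OF U f' V] Y p]
      sl[OF f smooth_lie_bracket[OF D U V X] Y p] sl[OF f' V Y p] ..
  finally have 3: "D (lie_bracket A (\<lambda>q. f q *\<^sub>R V q) X) Y p
      = f p *\<^sub>R D (lie_bracket A V X) Y p + f' p *\<^sub>R D V Y p" .
  show ?thesis
    unfolding curvature_apply 1 2 3 by (simp add: scaleR_diff_right)
qed

lemma curvature_lincomb_left:
  assumes D: "affine_connection A D" "torsion_free A D" and U: "open U"
    and f: "\<And>j. smooth_fun_on A U (f j)" and V: "\<And>j. smooth_field_on A U (V j)"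
    and X: "smooth_field_on A U X" and Y: "smooth_field_on A U Y" and p: "p \<in> U" and S: "finite S"
  shows "curvature A D (\<lambda>q. \<Sum>j\<in>S. f j q *\<^sub>R V j q) X Y p = (\<Sum>j\<in>S. f j p *\<^sub>R curvature A D (V j) X Y p)"
  using S
proof (induction S rule: finite_induct)
  case empty
  show ?case
    using curvature_scale_left[OF D U smooth_fun_on_const V X Y p, of 0 undefined] by (simp add: zero_fun_def)
next
  case (insert k S)
  show ?case
    unfolding sum.insert[OF insert.hyps] insert.IH[symmetric]
    by (subst curvature_add_left[OF D U _ _ X Y p])
      (simp_all add: smooth_field_on_scaleR smooth_field_on_sum U f V curvature_scale_left[OF D U f V X Y p])
qed

lemma connection_lincomb_left:
  assumes D: "affine_connection A D" and U: "open U"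
    and f: "\<And>j. smooth_fun_on A U (f j)" and V: "\<And>j. smooth_field_on A U (V j)"
    and Y: "smooth_field_on A U Y" and p: "p \<in> U" and S: "finite S"
  shows "D (\<lambda>q. \<Sum>j\<in>S. f j q *\<^sub>R V j q) Y p = (\<Sum>j\<in>S. f j p *\<^sub>R D (V j) Y p)"
  using S
proof (induction S rule: finite_induct)
  case empty
  show ?case
    using connection_scale_left[OF D U smooth_fun_on_const V Y p, of 0 undefined] by (simp add: zero_fun_def)
next
  case (insert k S)
  show ?case
    unfolding sum.insert[OF insert.hyps] insert.IH[symmetric]
    by (subst connection_add_left[OF D U _ _ Y p])
      (simp_all add: smooth_field_on_scaleR smooth_field_on_sum U f V connection_scale_left[OF D U f V Y p])
qed

end

context riemannian_manifold
begin

lemma affine_ricci_eq_metric_ricci: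
  assumes D: "affine_connection A D" "torsion_free A D" and U: "open U"
    and X: "smooth_field_on A U X" and Y: "smooth_field_on A U Y" and p: "p \<in> U"
  shows "affine_ricci A D X Y p = metric_ricci A g D X Y p"
proof -
  define c where "c = chart_at A p"
  have c: "c \<in> A" "p \<in> dom c" using chart_at by (auto simp: c_def)
  obtain V where V: "p \<in> V" "frame_on V (frame A g p)" by (rule frame_near)
  define E where "E = frame A g p"
  define W where "W = U \<inter> V \<inter> dom c"
  have W: "open W" "p \<in> W" "W \<subseteq> U" "W \<subseteq> V" "W \<subseteq> dom c"
    using U V c open_Int_dom[OF c(1), of "U \<inter> V"] p by (auto simp: W_def frame_on_def)
  have E: "smooth_field_on A W (E i)" for i
    using frame_on_subset[OF V(2) W(1,4)] by (auto simp: E_def frame_on_def)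
  have F: "smooth_field_on A W (coord_field A c j)" for j
    using smooth_field_on_subset[OF smooth_coord_field[OF c(1)] W(5)] .
  have X': "smooth_field_on A W X" and Y': "smooth_field_on A W Y"
    using smooth_field_on_subset X Y W(3) by blast+
  have on: "orthonormal p (\<lambda>i. E i p)" unfolding E_def by (rule orthonormal_frame)
  have a: "smooth_fun_on A W (\<lambda>q. E i q c $ j)" for i j
    using smooth_component[OF c(1) W(1) E] W(5) by (simp add: Int_absorb2)
  have expand: "E i q = (\<Sum>j\<in>UNIV. (E i q c $ j) *\<^sub>R coord_field A c j q)" if "q \<in> W" for i q
  proof (rule tangent_eqI[OF smooth_field_tangent[OF E that] _ c(1)])
    show "q \<in> dom c" using that W by blast
    then show "E i q c = (\<Sum>j\<in>UNIV. (E i q c $ j) *\<^sub>R coord_field A c j q) c"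
      using c by (simp add: sum_fun_apply coord_field_eq basis_expansion flip: scalar_mult_eq_scaleR)
    show "(\<Sum>j\<in>UNIV. (E i q c $ j) *\<^sub>R coord_field A c j q) \<in> tangent A q"
      by (intro tangent_sum tangent_scaleR smooth_field_tangent[OF F that])
  qed
  define r where "r j = curvature A D (coord_field A c j) X Y p" for j
  have r: "r j \<in> tangent A p" for j
    unfolding r_def by (rule curvature_tangent[OF D W(1) F X' Y' W(2)])
  have R: "curvature A D (E i) X Y p = (\<Sum>j\<in>UNIV. (E i p c $ j) *\<^sub>R r j)" for i
  proof -
    have eq: "D (E i) Z p = D (\<lambda>q. \<Sum>j\<in>UNIV. (E i q c $ j) *\<^sub>R coord_field A c j q) Z p" for Z
      by (rule connection_cong[OF D(1) W(1,2) expand refl])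
    have sE: "smooth_field_on A W (\<lambda>q. \<Sum>j\<in>UNIV. (E i q c $ j) *\<^sub>R coord_field A c j q)"
      by (intro smooth_field_on_sum smooth_field_on_scaleR W a F)
    have eqY: "D (E i) Y q = D (\<lambda>q. \<Sum>j\<in>UNIV. (E i q c $ j) *\<^sub>R coord_field A c j q) Y q" if "q \<in> W" for q
      by (rule connection_cong[OF D(1) W(1) that expand refl])
    have eqL: "lie_bracket A (E i) X q = lie_bracket A (\<lambda>q. \<Sum>j\<in>UNIV. (E i q c $ j) *\<^sub>R coord_field A c j q) X q"
      if "q \<in> W" for q
    proof -
      have "D (E i) X q = D (\<lambda>q. \<Sum>j\<in>UNIV. (E i q c $ j) *\<^sub>R coord_field A c j q) X q"
        by (rule connection_cong[OF D(1) W(1) that expand refl])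
      moreover have "D X (E i) q = D X (\<lambda>q. \<Sum>j\<in>UNIV. (E i q c $ j) *\<^sub>R coord_field A c j q) q"
        by (rule connection_cong[OF D(1) W(1) that refl expand])
      ultimately show ?thesis
        unfolding torsion_freeD[OF D(2) W(1) E X' that] torsion_freeD[OF D(2) W(1) sE X' that] by simp
    qed
    have e2: "D X (D (E i) Y) p = D X (D (\<lambda>q. \<Sum>j\<in>UNIV. (E i q c $ j) *\<^sub>R coord_field A c j q) Y) p"
      by (rule connection_cong[OF D(1) W(1,2) refl eqY])
    have e3: "D (lie_bracket A (E i) X) Y p
        = D (lie_bracket A (\<lambda>q. \<Sum>j\<in>UNIV. (E i q c $ j) *\<^sub>R coord_field A c j q) X) Y p"
      by (rule connection_cong[OF D(1) W(1,2) eqL refl])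
    have "curvature A D (E i) X Y p = curvature A D (\<lambda>q. \<Sum>j\<in>UNIV. (E i q c $ j) *\<^sub>R coord_field A c j q) X Y p"
      unfolding curvature_apply eq e2 e3 ..
    also have "\<dots> = (\<Sum>j\<in>UNIV. (E i p c $ j) *\<^sub>R r j)"
      unfolding r_def by (rule curvature_lincomb_left[OF D W(1) a F X' Y' W(2) finite])
    finally show ?thesis .
  qed
  have "r j c $ j = (\<Sum>i\<in>UNIV. g p (r j) (E i p) * E i p c $ j)" for j
  proof -
    have "r j c = (\<Sum>i\<in>UNIV. g p (r j) (E i p) *\<^sub>R E i p) c"
      using orthonormal_expand[OF on r] by simp
    then show ?thesis by (simp add: sum_fun_apply)
  qed
  then have "affine_ricci A D X Y p = (\<Sum>j\<in>UNIV. \<Sum>i\<in>UNIV. g p (r j) (E i p) * E i p c $ j)"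
    by (simp add: affine_ricci_def Let_def c_def[symmetric] r_def[symmetric] trace_def)
  also have "\<dots> = (\<Sum>i\<in>UNIV. \<Sum>j\<in>UNIV. g p (r j) (E i p) * E i p c $ j)"
    by (rule sum.swap)
  also have "\<dots> = (\<Sum>i\<in>UNIV. g p (\<Sum>j\<in>UNIV. (E i p c $ j) *\<^sub>R r j) (E i p))"
    using r orthonormal_tangent[OF on] by (simp add: g_sum_left g_scale_left tangent_scaleR mult.commute)
  also have "\<dots> = metric_ricci A g D X Y p"
    by (simp add: metric_ricci_def Let_def E_def[symmetric] R)
  finally show ?thesis .
qed

definition differ_by :: "'m connection \<Rightarrow> 'm connection \<Rightarrow> 'm form3 \<Rightarrow> bool"
  where "differ_by D L b \<longleftrightarrow> (\<forall>U X Y Z. open U \<longrightarrow>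
     smooth_field_on A U X \<longrightarrow> smooth_field_on A U Y \<longrightarrow> smooth_field_on A U Z \<longrightarrow>
     (\<forall>p\<in>U. g p (D X Y p) (Z p) = g p (L X Y p) (Z p) + b p (X p) (Y p) (Z p)))"

lemma differ_byD:
  "differ_by D L b \<Longrightarrow> open U \<Longrightarrow> smooth_field_on A U X \<Longrightarrow> smooth_field_on A U Y \<Longrightarrow> smooth_field_on A U Z \<Longrightarrow>
    p \<in> U \<Longrightarrow> g p (D X Y p) (Z p) = g p (L X Y p) (Z p) + b p (X p) (Y p) (Z p)"
  by (simp add: differ_by_def)

lemma curvature_difference:
  assumes L: "levi_civita A g L" and D: "affine_connection A D"
    and dif: "differ_by D L b"
    and U: "open U" and V: "smooth_field_on A U V" and X: "smooth_field_on A U X"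
    and Y: "smooth_field_on A U Y" and Z: "smooth_field_on A U Z" and p: "p \<in> U"
  shows "g p (curvature A D V X Y p) (Z p) = g p (curvature A L V X Y p) (Z p)
    + deriv_along A V (\<lambda>q. b q (X q) (Y q) (Z q)) p - b p (X p) (Y p) (L V Z p) + b p (V p) (D X Y p) (Z p)
    - deriv_along A X (\<lambda>q. b q (V q) (Y q) (Z q)) p + b p (V p) (Y p) (L X Z p) - b p (X p) (D V Y p) (Z p)
    - b p (L V X p - L X V p) (Y p) (Z p)"
proof -
  have L': "affine_connection A L" "torsion_free A L" "metric_deriv_eq A L g (\<lambda>_ _. 0)"
    using L by (auto simp: levi_civita_def)
  note diff = differ_byD[OF dif]
  note cL = smooth_connection[OF L'(1) U] and cD = smooth_connection[OF D U]
  have second: "g p (D V (D X Y) p) (Z p) = g p (L V (L X Y) p) (Z p)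
      + deriv_along A V (\<lambda>q. b q (X q) (Y q) (Z q)) p - b p (X p) (Y p) (L V Z p) + b p (V p) (D X Y p) (Z p)"
    if V: "smooth_field_on A U V" and X: "smooth_field_on A U X" for V X
  proof -
    have sm: "smooth_fun_on A U (\<lambda>q. g q (D X Y q) (Z q))" "smooth_fun_on A U (\<lambda>q. g q (L X Y q) (Z q))"
      by (intro smooth_g U cD cL X Y Z)+
    have "deriv_along A V (\<lambda>q. b q (X q) (Y q) (Z q)) p
        = deriv_along A V (\<lambda>q. g q (D X Y q) (Z q) - g q (L X Y q) (Z q)) p"
      by (rule deriv_along_cong[OF U smooth_fun_on_diff[OF U sm] p, symmetric])
        (simp_all add: diff[OF U X Y Z])
    also have "\<dots> = deriv_along A V (\<lambda>q. g q (D X Y q) (Z q)) p - deriv_along A V (\<lambda>q. g q (L X Y q) (Z q)) p"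
      by (rule deriv_along_diff[OF U sm p])
    finally show ?thesis
      using metric_deriv_eqD[OF L'(3) U V cD[OF X Y] Z p] metric_deriv_eqD[OF L'(3) U V cL[OF X Y] Z p]
        diff[OF U V cD[OF X Y] Z p] diff[OF U X Y cL[OF V Z] p] by simp
  qed
  note lie = smooth_lie_bracket[OF L'(1,2) U V X]
  have "g p (curvature A D V X Y p) (Z p)
      = g p (D V (D X Y) p) (Z p) - g p (D X (D V Y) p) (Z p) - g p (D (lie_bracket A V X) Y p) (Z p)"
    unfolding curvature_apply
    by (subst g_diff_left g_diff_left, (intro tangent_diff connection_tangent[OF D U _ _ p] cD lie V X Y 
          smooth_field_tangent[OF Z p])+)+ simp
  moreover have "g p (curvature A L V X Y p) (Z p)
      = g p (L V (L X Y) p) (Z p) - g p (L X (L V Y) p) (Z p) - g p (L (lie_bracket A V X) Y p) (Z p)"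
    unfolding curvature_apply
    by (subst g_diff_left g_diff_left, (intro tangent_diff connection_tangent[OF L'(1) U _ _ p] cL lie V X Y 
          smooth_field_tangent[OF Z p])+)+ simp
  ultimately show ?thesis
    using second[OF V X] second[OF X V] diff[OF U lie Y Z p] torsion_freeD[OF L'(2) U V X p] by simp
qed

end

section \<open>Ricci curvature of Weyl connections and of connections with skew torsion\<close>

context oriented_manifold
begin

lemma linear_at_uminus_arg: "linear_at \<omega> p \<Longrightarrow> u \<in> tangent A p \<Longrightarrow> \<omega> p (- u) = - \<omega> p u"
  using linear_at_scale[of \<omega> p u "-1"] by simp

lemma linear_at_diff:
  "linear_at \<omega> p \<Longrightarrow> u \<in> tangent A p \<Longrightarrow> v \<in> tangent A p \<Longrightarrow> \<omega> p (u - v) = \<omega> p u - \<omega> p v"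
  using linear_at_add[of \<omega> p u "- v"] linear_at_uminus_arg[of \<omega> p v] by (simp add: tangent_uminus)

end

context riemannian_manifold
begin

lemma trilinear_linear:
  assumes "trilinear_form b" "u \<in> tangent A p" "v \<in> tangent A p"
  shows "linear_at (\<lambda>p w. b p w u v) p" "linear_at (\<lambda>p w. b p u w v) p" "linear_at (\<lambda>p w. b p u v w) p"
  using assms unfolding trilinear_form_def by blast+

lemma smooth_trilinear:
  "trilinear_form b \<Longrightarrow> open U \<Longrightarrow> smooth_field_on A U X \<Longrightarrow> smooth_field_on A U Y \<Longrightarrow> smooth_field_on A U Z \<Longrightarrow>
    smooth_fun_on A U (\<lambda>p. b p (X p) (Y p) (Z p))"
  unfolding trilinear_form_def by blast

lemma frame_onD:
  assumes "frame_on U E"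
  shows "open U" "smooth_field_on A U (E i)" "p \<in> U \<Longrightarrow> oriented_onb p (\<lambda>i. E i p)"
    "p \<in> U \<Longrightarrow> orthonormal p (\<lambda>i. E i p)"
  using assms by (auto simp: frame_on_def oriented_onb_def)

lemma connection_eq_add_raise:
  assumes L: "levi_civita A g L" and D: "affine_connection A D" and b: "trilinear_form b"
    and dif: "differ_by D L b"
    and fr: "frame_on U E" and X: "smooth_field_on A U X" and Y: "smooth_field_on A U Y" and p: "p \<in> U"
  shows "D X Y p = L X Y p + raise b p (X p) (Y p)"
proof -
  note U = frame_onD(1)[OF fr] and E = frame_onD(2)[OF fr] and on = frame_onD(4)[OF fr p]
  have L': "affine_connection A L" using L by (simp add: levi_civita_def)
  have t: "D X Y p \<in> tangent A p" "L X Y p \<in> tangent A p" "X p \<in> tangent A p" "Y p \<in> tangent A p"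
    "E i p \<in> tangent A p" for i
    using connection_tangent[OF D U X Y p] connection_tangent[OF L' U X Y p] smooth_field_tangent X Y E p by blast+
  have "g p (D X Y p) (E i p) = g p (L X Y p + raise b p (X p) (Y p)) (E i p)" for i
    by (simp add: differ_byD[OF dif U X Y E p] g_add_left raise_tangent t g_raise[OF b])
  then show ?thesis
    using orthonormal_expand[OF on t(1)] orthonormal_expand[OF on tangent_add[OF t(2) raise_tangent]] by simp
qed

lemma cov_deriv1_expand:
  assumes L: "affine_connection A L" and \<omega>: "one_form A \<omega>"
    and fr: "frame_on U E" and X: "smooth_field_on A U X" and Y: "smooth_field_on A U Y" and p: "p \<in> U"
  shows "cov_deriv1 A L \<omega> X Y p = (\<Sum>i\<in>UNIV. g p (X p) (E i p) * cov_deriv1 A L \<omega> (E i) Y p)"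
proof -
  note U = frame_onD(1)[OF fr] and E = frame_onD(2)[OF fr]
  have lin: "linear_at \<omega> p" and s: "smooth_fun_on A U (\<lambda>q. \<omega> q (Y q))"
    using \<omega> Y U one_form_iff by blast+
  have ex: "X q = (\<Sum>i\<in>UNIV. g q (X q) (E i q) *\<^sub>R E i q)" if "q \<in> U" for q
    by (rule orthonormal_expand[OF frame_onD(4)[OF fr that] smooth_field_tangent[OF X that]])
  have "L X Y p = L (\<lambda>q. \<Sum>i\<in>UNIV. g q (X q) (E i q) *\<^sub>R E i q) Y p"
    by (rule connection_cong[OF L U p ex refl])
  also have "\<dots> = (\<Sum>i\<in>UNIV. g p (X p) (E i p) *\<^sub>R L (E i) Y p)"
    by (rule connection_lincomb_left[OF L U smooth_g[OF U X E] E Y p finite])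
  finally have "\<omega> p (L X Y p) = (\<Sum>i\<in>UNIV. g p (X p) (E i p) * \<omega> p (L (E i) Y p))"
    using linear_at_lincomb[OF lin, of "\<lambda>i. L (E i) Y p"] connection_tangent[OF L U E Y p] by simp
  then show ?thesis
    unfolding cov_deriv1_def deriv_along_linear_field[where X = X and p = p and E = E and a = "\<lambda>i. g p (X p) (E i p)", OF U s p ex[OF p]]
    by (simp add: sum_subtractf right_diff_distrib)
qed

lemma deriv_along_weyl_form:
  assumes L: "levi_civita A g L" and \<omega>: "one_form A \<omega>" and U: "open U"
    and V: "smooth_field_on A U V" and X: "smooth_field_on A U X" and Y: "smooth_field_on A U Y"
    and Z: "smooth_field_on A U Z" and p: "p \<in> U"
  shows "deriv_along A V (\<lambda>q. weyl_form \<omega> q (X q) (Y q) (Z q)) p =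
    weyl_form \<omega> p (L V X p) (Y p) (Z p) + weyl_form \<omega> p (X p) (L V Y p) (Z p) + weyl_form \<omega> p (X p) (Y p) (L V Z p)
    + 1/2 * (cov_deriv1 A L \<omega> V Z p * g p (X p) (Y p) - cov_deriv1 A L \<omega> V X p * g p (Y p) (Z p)
           - cov_deriv1 A L \<omega> V Y p * g p (X p) (Z p))"
proof -
  have L': "metric_deriv_eq A L g (\<lambda>_ _. 0)" using L by (simp add: levi_civita_def)
  have sw: "smooth_fun_on A U (\<lambda>q. \<omega> q (W q))" if "smooth_field_on A U W" for W
    using \<omega> that U one_form_iff by blast
  have m: "smooth_fun_on A U (\<lambda>q. \<omega> q (W q) * g q (W' q) (W'' q))"
    if "smooth_field_on A U W" "smooth_field_on A U W'" "smooth_field_on A U W''" for W W' W''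
    by (intro smooth_fun_on_mult U sw smooth_g that)
  show ?thesis
    unfolding weyl_form_def
      deriv_along_cmult[OF U smooth_fun_on_diff[OF U smooth_fun_on_diff[OF U m[OF Z X Y] m[OF X Y Z]] m[OF Y X Z]] p]
      deriv_along_diff[OF U smooth_fun_on_diff[OF U m[OF Z X Y] m[OF X Y Z]] m[OF Y X Z] p]
      deriv_along_diff[OF U m[OF Z X Y] m[OF X Y Z] p]
      deriv_along_mult[OF U sw[OF Z] smooth_g[OF U X Y] p] deriv_along_mult[OF U sw[OF X] smooth_g[OF U Y Z] p]
      deriv_along_mult[OF U sw[OF Y] smooth_g[OF U X Z] p]
      metric_deriv_eqD[OF L' U V X Y p] metric_deriv_eqD[OF L' U V Y Z p] metric_deriv_eqD[OF L' U V X Z p]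
      cov_deriv1_def
    by (simp add: algebra_simps)
qed

lemma curvature_weyl:
  assumes L: "levi_civita A g L" and D: "affine_connection A D" and \<omega>: "one_form A \<omega>"
    and dif: "differ_by D L (weyl_form \<omega>)"
    and fr: "frame_on U E" and V: "smooth_field_on A U V" and X: "smooth_field_on A U X"
    and Y: "smooth_field_on A U Y" and Z: "smooth_field_on A U Z" and p: "p \<in> U"
  shows "g p (curvature A D V X Y p) (Z p) = g p (curvature A L V X Y p) (Z p)
    + 1/2 * (cov_deriv1 A L \<omega> V Z p * g p (X p) (Y p) - cov_deriv1 A L \<omega> V X p * g p (Y p) (Z p)
           - cov_deriv1 A L \<omega> V Y p * g p (X p) (Z p))
    - 1/2 * (cov_deriv1 A L \<omega> X Z p * g p (V p) (Y p) - cov_deriv1 A L \<omega> X V p * g p (Y p) (Z p)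
           - cov_deriv1 A L \<omega> X Y p * g p (V p) (Z p))
    + weyl_form \<omega> p (V p) (raise (weyl_form \<omega>) p (X p) (Y p)) (Z p)
    - weyl_form \<omega> p (X p) (raise (weyl_form \<omega>) p (V p) (Y p)) (Z p)"
proof -
  note U = frame_onD(1)[OF fr]
  note b = trilinear_weyl_form[OF \<omega>]
  have L': "affine_connection A L" using L by (simp add: levi_civita_def)
  have t: "V p \<in> tangent A p" "X p \<in> tangent A p" "Y p \<in> tangent A p" "Z p \<in> tangent A p"
    using smooth_field_tangent V X Y Z p by blast+
  note tL = connection_tangent[OF L' U _ _ p]
  note DL = connection_eq_add_raise[OF L D b dif fr _ _ p]
  show ?thesis
    unfolding curvature_difference[OF L D dif U V X Y Z p]
      deriv_along_weyl_form[OF L \<omega> U V X Y Z p] deriv_along_weyl_form[OF L \<omega> U X V Y Z p]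
      DL[OF X Y] DL[OF V Y]
      linear_at_add[OF trilinear_linear(2)[OF b t(1,4)] tL[OF X Y] raise_tangent]
      linear_at_add[OF trilinear_linear(2)[OF b t(2,4)] tL[OF V Y] raise_tangent]
      linear_at_diff[OF trilinear_linear(1)[OF b t(3,4)] tL[OF V X] tL[OF X V]]
    by simp
qed

lemma weyl_quadratic:
  assumes on: "orthonormal p e" and \<omega>: "one_form A \<omega>" and x: "x \<in> tangent A p" and y: "y \<in> tangent A p"
  shows "(\<Sum>i\<in>UNIV. weyl_form \<omega> p (e i) (raise (weyl_form \<omega>) p x y) (e i)
      - weyl_form \<omega> p x (raise (weyl_form \<omega>) p (e i) y) (e i))
    = 1/2 * (\<omega> p x * \<omega> p y - (\<Sum>i\<in>UNIV. \<omega> p (e i) * \<omega> p (e i)) * g p x y)"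
proof -
  note b = trilinear_weyl_form[OF \<omega>] and t = orthonormal_tangent[OF on]
  have lin: "linear_at \<omega> p" using \<omega> one_form_iff by blast
  define a where "a i = \<omega> p (e i)" for i
  define X where "X i = g p x (e i)" for i
  define Y where "Y i = g p y (e i)" for i
  have \<omega>x: "\<omega> p x = (\<Sum>i\<in>UNIV. X i * a i)" and \<omega>y: "\<omega> p y = (\<Sum>i\<in>UNIV. Y i * a i)"
    unfolding a_def X_def Y_def using linear_at_expand[OF on lin] x y by blast+
  have xy: "g p x y = (\<Sum>i\<in>UNIV. X i * Y i)"
    unfolding X_def Y_def by (rule g_expand[OF on x y])
  have ex: "g p (e i) x = X i" "g p (e i) y = Y i" for i
    unfolding X_def Y_def using g_sym t x y by blast+
  define r where "r = raise (weyl_form \<omega>) p x y"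
  define s where "s i = raise (weyl_form \<omega>) p (e i) y" for i
  have rs: "r \<in> tangent A p" "s i \<in> tangent A p" for i
    unfolding r_def s_def by (rule raise_tangent)+
  have re: "g p r (e j) = 1/2 * (a j * g p x y - \<omega> p x * Y j - \<omega> p y * X j)" for j
    unfolding r_def g_raise[OF b x y t] weyl_form_def a_def X_def Y_def ..
  have se: "g p (s i) (e j) = 1/2 * (a j * Y i - a i * Y j - \<omega> p y * (if i = j then 1 else 0))" for i j
    unfolding s_def g_raise[OF b t y t] weyl_form_def ex orthonormal_g[OF on] a_def Y_def ..
  have \<omega>r: "\<omega> p r = (\<Sum>j\<in>UNIV. g p r (e j) * a j)" and \<omega>s: "\<omega> p (s i) = (\<Sum>j\<in>UNIV. g p (s i) (e j) * a j)" for i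
    unfolding a_def using linear_at_expand[OF on lin] rs by blast+
  have xs: "g p x (s i) = (\<Sum>j\<in>UNIV. X j * g p (s i) (e j))" for i
    unfolding X_def by (rule g_expand[OF on x rs(2)])
  have er: "g p (e i) r = g p r (e i)" for i by (rule g_sym[OF t rs(1)])
  have "(\<Sum>i\<in>UNIV. weyl_form \<omega> p (e i) r (e i)) = - 2 * \<omega> p r"
    unfolding weyl_form_def er orthonormal_g[OF on] a_def[symmetric] by (simp add: sum_4)
  also have "\<dots> = 2 * \<omega> p x * \<omega> p y - (\<Sum>i\<in>UNIV. a i * a i) * g p x y"
    unfolding \<omega>r re \<omega>x \<omega>y by (simp add: sum_4) algebra
  finally have 1: "(\<Sum>i\<in>UNIV. weyl_form \<omega> p (e i) r (e i)) = 2 * \<omega> p x * \<omega> p y - (\<Sum>i\<in>UNIV. a i * a i) * g p x y" .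
  have "(\<Sum>i\<in>UNIV. weyl_form \<omega> p x (s i) (e i))
      = (\<Sum>i\<in>UNIV. 1/2 * (a i * g p x (s i) - \<omega> p x * g p (s i) (e i) - \<omega> p (s i) * X i))"
    unfolding weyl_form_def a_def X_def ..
  also have "\<dots> = 3/2 * \<omega> p x * \<omega> p y - 1/2 * (\<Sum>i\<in>UNIV. a i * a i) * g p x y"
  proof -
    have s1: "g p (s i) (e i) = - 1/2 * \<omega> p y" for i
      unfolding se by simp
    have s2: "g p x (s i) = 1/2 * (Y i * \<omega> p x - a i * g p x y - \<omega> p y * X i)" for i
      unfolding xs se \<omega>x xy using exhaust_4[of i] by (auto simp: sum_4 algebra_simps)
    have s3: "\<omega> p (s i) = 1/2 * Y i * (\<Sum>j\<in>UNIV. a j * a j) - a i * \<omega> p y" for i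
      unfolding \<omega>s se \<omega>y using exhaust_4[of i] by (auto simp: sum_4 algebra_simps)
    have "(\<Sum>i\<in>UNIV. 1/2 * (a i * g p x (s i) - \<omega> p x * g p (s i) (e i) - \<omega> p (s i) * X i))
        = (\<Sum>i\<in>UNIV. 1/4 * (\<omega> p x * (Y i * a i) - g p x y * (a i * a i) + \<omega> p y * (X i * a i)
          + \<omega> p x * \<omega> p y - (\<Sum>j\<in>UNIV. a j * a j) * (X i * Y i)))"
      unfolding s1 s2 s3 by (simp add: algebra_simps)
    also have "\<dots> = 1/4 * (\<omega> p x * \<omega> p y - g p x y * (\<Sum>i\<in>UNIV. a i * a i) + \<omega> p y * \<omega> p x
        + 4 * (\<omega> p x * \<omega> p y) - (\<Sum>j\<in>UNIV. a j * a j) * g p x y)"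
      unfolding sum_distrib_left[symmetric] sum.distrib sum_subtractf
      by (simp add: \<omega>x[symmetric] \<omega>y[symmetric] xy[symmetric])
    finally show ?thesis by (simp add: algebra_simps)
  qed
  finally have 2: "(\<Sum>i\<in>UNIV. weyl_form \<omega> p x (s i) (e i))
      = 3/2 * \<omega> p x * \<omega> p y - 1/2 * (\<Sum>i\<in>UNIV. a i * a i) * g p x y" .
  show ?thesis
    unfolding sum_subtractf r_def[symmetric] s_def[symmetric] 1 2 a_def[symmetric] by (simp add: algebra_simps)
qed

lemma ricci_weyl:
  assumes L: "levi_civita A g L" and D: "affine_connection A D" and \<omega>: "one_form A \<omega>"
    and dif: "differ_by D L (weyl_form \<omega>)"
    and fr: "frame_on U E" and X: "smooth_field_on A U X"
    and Y: "smooth_field_on A U Y" and p: "p \<in> U"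
  shows "(\<Sum>i\<in>UNIV. g p (curvature A D (E i) X Y p) (E i p)) = (\<Sum>i\<in>UNIV. g p (curvature A L (E i) X Y p) (E i p))
    + 1/2 * (\<Sum>i\<in>UNIV. cov_deriv1 A L \<omega> (E i) (E i) p) * g p (X p) (Y p)
    + 3/2 * cov_deriv1 A L \<omega> X Y p - 1/2 * cov_deriv1 A L \<omega> Y X p
    + 1/2 * (\<omega> p (X p) * \<omega> p (Y p) - (\<Sum>i\<in>UNIV. \<omega> p (E i p) * \<omega> p (E i p)) * g p (X p) (Y p))"
proof -
  note on = frame_onD(4)[OF fr p] and E = frame_onD(2)[OF fr]
  have L': "affine_connection A L" using L by (simp add: levi_civita_def)
  have t: "X p \<in> tangent A p" "Y p \<in> tangent A p"
    using smooth_field_tangent X Y p by blast+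
  have s: "g p (E i p) (Y p) = g p (Y p) (E i p)" for i
    by (rule g_sym[OF orthonormal_tangent[OF on] t(2)])
  have "(\<Sum>i\<in>UNIV. g p (curvature A D (E i) X Y p) (E i p)) = (\<Sum>i\<in>UNIV. g p (curvature A L (E i) X Y p) (E i p))
    + (\<Sum>i\<in>UNIV. 1/2 * (cov_deriv1 A L \<omega> (E i) (E i) p * g p (X p) (Y p) - cov_deriv1 A L \<omega> (E i) X p * g p (Y p) (E i p)
           - cov_deriv1 A L \<omega> (E i) Y p * g p (X p) (E i p)))
    - (\<Sum>i\<in>UNIV. 1/2 * (cov_deriv1 A L \<omega> X (E i) p * g p (E i p) (Y p) - cov_deriv1 A L \<omega> X (E i) p * g p (Y p) (E i p)
           - cov_deriv1 A L \<omega> X Y p * g p (E i p) (E i p)))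
    + (\<Sum>i\<in>UNIV. weyl_form \<omega> p (E i p) (raise (weyl_form \<omega>) p (X p) (Y p)) (E i p)
    - weyl_form \<omega> p (X p) (raise (weyl_form \<omega>) p (E i p) (Y p)) (E i p))"
    unfolding curvature_weyl[OF L D \<omega> dif fr E X Y E p] sum.distrib sum_subtractf by simp
  then show ?thesis
    unfolding weyl_quadratic[OF on \<omega> t] s orthonormal_g[OF on]
      cov_deriv1_expand[OF L' \<omega> fr X Y p] cov_deriv1_expand[OF L' \<omega> fr Y X p]
    by (simp add: sum_4 algebra_simps)
qed

lemma ricci_skew:
  assumes L: "levi_civita A g L" and D: "affine_connection A D" and H: "three_form A H"
    and dif: "differ_by D L (\<lambda>p u v w. 1/2 * H p u v w)"
    and fr: "frame_on U E" and X: "smooth_field_on A U X"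
    and Y: "smooth_field_on A U Y" and p: "p \<in> U"
  defines "\<omega> \<equiv> hodge3 A g H"
  shows "(\<Sum>i\<in>UNIV. g p (curvature A D (E i) X Y p) (E i p)) + (\<Sum>i\<in>UNIV. g p (curvature A D (E i) Y X p) (E i p))
    = (\<Sum>i\<in>UNIV. g p (curvature A L (E i) X Y p) (E i p)) + (\<Sum>i\<in>UNIV. g p (curvature A L (E i) Y X p) (E i p))
    + (\<omega> p (X p) * \<omega> p (Y p) - (\<Sum>i\<in>UNIV. \<omega> p (E i p) * \<omega> p (E i p)) * g p (X p) (Y p))"
proof -
  note U = frame_onD(1)[OF fr] and E = frame_onD(2)[OF fr] and on = frame_onD(4)[OF fr p] and onb = frame_onD(3)[OF fr p]
  have L': "affine_connection A L" using L by (simp add: levi_civita_def)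
  have alt: "alternating_at H q" for q using H three_form_iff by blast
  define b where "b = (\<lambda>p u v w. 1/2 * H p u v w)"
  have b: "trilinear_form b" unfolding b_def by (rule trilinear_three_form[OF H])
  have dif': "differ_by D L b"
    unfolding b_def by (rule dif)
  have b12: "b q v u w = - b q u v w" and b23: "b q u w v = - b q u v w"
    if "u \<in> tangent A q" "v \<in> tangent A q" "w \<in> tangent A q" for q u v w
    unfolding b_def using alternating_at_swap12[OF alt that] alternating_at_swap23[OF alt that] by simp_all
  have b13: "b q u v u = 0" if "u \<in> tangent A q" "v \<in> tangent A q" for q u v
    using b12[of u q u v] b23[of u q u v] that by simp
  have bwvu: "b q w v u = - b q u v w" if "u \<in> tangent A q" "v \<in> tangent A q" "w \<in> tangent A q" for q u v w
    using b12[of v q w u] b12[of v q u w] b23[of v q w u] that by simp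
  have tE: "E i q \<in> tangent A q" if "q \<in> U" for i q using smooth_field_tangent[OF E that] .
  have per: "g p (curvature A D (E i) X Y p) (E i p) + g p (curvature A D (E i) Y X p) (E i p)
      = g p (curvature A L (E i) X Y p) (E i p) + g p (curvature A L (E i) Y X p) (E i p)
      - 2 * (\<Sum>j\<in>UNIV. b p (X p) (E i p) (E j p) * b p (Y p) (E i p) (E j p))" for i
  proof -
    have half: "g p (curvature A D (E i) X Y p) (E i p) = g p (curvature A L (E i) X Y p) (E i p)
      + deriv_along A (E i) (\<lambda>q. b q (X q) (Y q) (E i q)) p - b p (X p) (Y p) (L (E i) (E i) p)
      - b p (X p) (L (E i) Y p) (E i p) - b p (L (E i) X p) (Y p) (E i p)
      - (\<Sum>j\<in>UNIV. b p (X p) (E i p) (E j p) * b p (Y p) (E i p) (E j p))"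
      if X: "smooth_field_on A U X" and Y: "smooth_field_on A U Y" for X Y
    proof -
      have t: "X p \<in> tangent A p" "Y p \<in> tangent A p"
        using smooth_field_tangent X Y p by blast+
      note tL = connection_tangent[OF L' U _ _ p]
      have zero: "deriv_along A X (\<lambda>q. b q (E i q) (Y q) (E i q)) p = 0"
      proof -
        have "deriv_along A X (\<lambda>q. b q (E i q) (Y q) (E i q)) p = deriv_along A X (\<lambda>q. 0) p"
          by (rule deriv_along_cong[OF U smooth_trilinear[OF b U E Y E] p])
            (use b13 tE smooth_field_tangent[OF Y] in auto)
        then show ?thesis by simp
      qed
      define r where "r = raise b p (E i p) (Y p)"
      have r: "r \<in> tangent A p" unfolding r_def by (rule raise_tangent)
      have "b p (X p) r (E i p) = (\<Sum>j\<in>UNIV. g p r (E j p) * b p (X p) (E j p) (E i p))"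
        using linear_at_expand[OF on trilinear_linear(2)[OF b t(1) tE[OF p]] r] .
      also have "\<dots> = (\<Sum>j\<in>UNIV. b p (X p) (E i p) (E j p) * b p (Y p) (E i p) (E j p))"
        unfolding r_def g_raise[OF b tE[OF p] t(2) tE[OF p]] b12[OF t(2) tE[OF p] tE[OF p]]
          b23[OF t(1) tE[OF p] tE[OF p], of _ i] by (simp add: mult.commute)
      finally have q: "b p (X p) r (E i p) = (\<Sum>j\<in>UNIV. b p (X p) (E i p) (E j p) * b p (Y p) (E i p) (E j p))" .
      have DEY: "b p (X p) (D (E i) Y p) (E i p) = b p (X p) (L (E i) Y p) (E i p) + b p (X p) r (E i p)"
        unfolding connection_eq_add_raise[OF L D b dif' fr E Y p] r_def[symmetric]
        by (rule linear_at_add[OF trilinear_linear(2)[OF b t(1) tE[OF p]] tL[OF E Y] r])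
      show ?thesis
        unfolding curvature_difference[OF L D dif' U E X Y E p] zero DEY q
          linear_at_diff[OF trilinear_linear(1)[OF b t(2) tE[OF p]] tL[OF E X] tL[OF X E]]
        using b13[OF tE[OF p] connection_tangent[OF D U X Y p]] bwvu[OF tE[OF p] t(2) tL[OF X E]] by simp
    qed
    have t: "X p \<in> tangent A p" "Y p \<in> tangent A p"
      using smooth_field_tangent X Y p by blast+
    note tL = connection_tangent[OF L' U _ _ p]
    have "deriv_along A (E i) (\<lambda>q. b q (X q) (Y q) (E i q)) p = deriv_along A (E i) (\<lambda>q. - b q (Y q) (X q) (E i q)) p"
      by (rule deriv_along_cong[OF U smooth_trilinear[OF b U X Y E] p
            b12[OF smooth_field_tangent[OF Y] smooth_field_tangent[OF X] tE] refl])
    then have d: "deriv_along A (E i) (\<lambda>q. b q (X q) (Y q) (E i q)) p = - deriv_along A (E i) (\<lambda>q. b q (Y q) (X q) (E i q)) p"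
      using deriv_along_uminus[OF U smooth_trilinear[OF b U Y X E] p] by simp
    show ?thesis
      unfolding half[OF X Y] half[OF Y X] d
      using b12[OF t tL[OF E E]] b12[OF tL[OF E X] t(2) tE[OF p]] b12[OF t(1) tL[OF E Y] tE[OF p]]
      by (simp add: mult.commute)
  qed
  have t: "X p \<in> tangent A p" "Y p \<in> tangent A p"
    using smooth_field_tangent X Y p by blast+
  have hX: "H p (Z p) (E i p) (E j p) = (\<Sum>a\<in>UNIV. g p (Z p) (E a p) * H p (E a p) (E i p) (E j p))"
    if "smooth_field_on A U Z" for Z i j
    using linear_at_expand[OF on alternating_at_linear1[OF alt tE[OF p] tE[OF p]] smooth_field_tangent[OF that p]] .
  have \<omega>: "\<omega> p (Z p) = (\<Sum>i\<in>UNIV. star_coeff H p (\<lambda>i. E i p) i * g p (Z p) (E i p))" 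
    if "smooth_field_on A U Z" for Z
    unfolding \<omega>_def by (rule hodge3_frame[OF onb alt smooth_field_tangent[OF that p]])
  have \<omega>E: "\<omega> p (E i p) = star_coeff H p (\<lambda>i. E i p) i" for i
    unfolding \<omega>_def by (rule hodge3_frame_vector[OF onb alt])
  have "4 * (\<Sum>i\<in>UNIV. \<Sum>j\<in>UNIV. b p (X p) (E i p) (E j p) * b p (Y p) (E i p) (E j p))
      = (\<Sum>i\<in>UNIV. \<Sum>j\<in>UNIV. H p (X p) (E i p) (E j p) * H p (Y p) (E i p) (E j p))"
    by (simp add: b_def sum_distrib_left)
  also have "\<dots> = 2 * ((\<Sum>i\<in>UNIV. \<omega> p (E i p) * \<omega> p (E i p)) * g p (X p) (Y p) - \<omega> p (X p) * \<omega> p (Y p))"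
    unfolding hX[OF X] hX[OF Y] \<omega>[OF X] \<omega>[OF Y] \<omega>E g_expand[OF on t]
    by (rule alternating3.contraction[OF alternating3_frame[OF on alt]])
  finally show ?thesis
    unfolding sum.distrib[symmetric] per
    by (simp add: sum_subtractf sum_distrib_left[symmetric])
qed

end

section \<open>Einstein-Weyl structures and skew torsion\<close>

context oriented_manifold
begin

lemma smooth_fun_on_exp:
  assumes "open U" "smooth_fun_on A U f"
  shows "smooth_fun_on A U (\<lambda>p. exp (f p))"
proof (rule smooth_fun_onI)
  fix c assume c: "c \<in> A"
  have "smooth_on UNIV (exp :: real \<Rightarrow> real)"
    by (simp add: smooth_on_def Ck_on_exp)
  then show "smooth_on (coords c ` (U \<inter> dom c)) (\<lambda>x. exp (f (param c x)))"
    by (rule smooth_on_compose[OF open_coords_image[OF c assms(1)] open_UNIV subset_UNIV _ smooth_fun_onD[OF assms(2) c]])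
qed

definition differential :: "('m \<Rightarrow> real) \<Rightarrow> 'm form1"
  where "differential f p v = deriv_along A (\<lambda>_. v) f p"

lemma differential_field: "differential f p (X p) = deriv_along A X f p"
  by (simp add: differential_def deriv_along_def)

lemma one_form_differential:
  assumes f: "smooth_fun_on A UNIV f"
  shows "one_form A (differential f)"
  unfolding one_form_iff
proof (intro conjI allI impI)
  show "linear_at (differential f) p" for p
  proof -
    obtain F where F: "((\<lambda>x. f (param (chart_at A p) x)) has_derivative F) (at (coords (chart_at A p) p))"
      using deriv_along_has_derivative[OF open_UNIV f UNIV_I] .
    have l: "linear F" using F by (rule has_derivative_linear)
    show ?thesis
      unfolding linear_at_def differential_def deriv_alongI[OF F]
      by (simp add: linear_add[OF l] linear_scale[OF l])
  qed
  fix U X assume "open U" "smooth_field_on A U X"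
  then show "smooth_fun_on A U (\<lambda>p. differential f p (X p))"
    unfolding differential_field
    by (intro smooth_deriv_along smooth_fun_on_subset[OF f subset_UNIV])
qed

lemma one_form_add:
  assumes "one_form A \<omega>" "one_form A \<theta>"
  shows "one_form A (\<lambda>p v. \<omega> p v + \<theta> p v)"
  using assms unfolding one_form_iff linear_at_def
  by (auto simp: algebra_simps intro: smooth_fun_on_add)

lemma one_form_uminus:
  assumes "one_form A \<omega>"
  shows "one_form A (\<lambda>p v. - \<omega> p v)"
  using assms unfolding one_form_iff linear_at_def
  by (auto simp: algebra_simps intro: smooth_fun_on_uminus)

end

context riemannian_manifold
begin

lemma hodge_ext_deriv3_eq:
  assumes L: "levi_civita A g L" and H: "three_form A H"
  shows "hodge_ext_deriv3 A g H p
    = - (\<Sum>i\<in>UNIV. cov_deriv1 A L (hodge3 A g H) (frame A g p i) (frame A g p i) p)"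
proof -
  obtain U where pU: "p \<in> U" and fr: "frame_on U (frame A g p)" by (rule frame_near)
  define E where "E = frame A g p"
  define \<omega> where "\<omega> = hodge3 A g H"
  note fr = fr[folded E_def]
  note U = frame_onD(1)[OF fr] and E = frame_onD(2)[OF fr] and on = frame_onD(4)[OF fr] and onb = frame_onD(3)[OF fr]
  have L': "affine_connection A L" "torsion_free A L" "metric_deriv_eq A L g (\<lambda>_ _. 0)"
    using L by (auto simp: levi_civita_def)
  have alt: "alternating_at H q" for q using H three_form_iff by blast
  have \<omega>: "one_form A \<omega>" unfolding \<omega>_def by (rule one_form_hodge3[OF H])
  have s\<omega>: "smooth_fun_on A U (\<lambda>q. \<omega> q (E i q))" for i
    using \<omega> U E one_form_iff by blast
  have \<omega>E: "\<omega> q (E i q) = star_coeff H q (\<lambda>i. E i q) i" if "q \<in> U" for q i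
    unfolding \<omega>_def by (rule hodge3_frame_vector[OF onb[OF that] alt])
  define h where "h i j k = H p (E i p) (E j p) (E k p)" for i j k
  interpret alternating3 h
    unfolding h_def by (rule alternating3_frame[OF on[OF pU] alt])
  define \<Gamma> where "\<Gamma> i j k = g p (L (E i) (E j) p) (E k p)" for i j k
  note tL = connection_tangent[OF L'(1) U E E pU] and tE = orthonormal_tangent[OF on[OF pU]]
  have \<Gamma>: "\<Gamma> i k j = - \<Gamma> i j k" for i j k
  proof -
    have "deriv_along A (E i) (\<lambda>q. g q (E j q) (E k q)) p = deriv_along A (E i) (\<lambda>q. if j = k then 1 else 0) p"
      by (rule deriv_along_cong[OF U smooth_g[OF U E E] pU orthonormal_g[OF on] refl])
    then show ?thesis
      using metric_deriv_eqD[OF L'(3) U E E E pU, of i j k] g_sym[OF tE tL, of j i k] by (simp add: \<Gamma>_def)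
  qed
  have \<Gamma>0: "\<Gamma> i j j = 0" for i j using \<Gamma>[of i j j] by simp
  have \<Gamma>s: "\<Gamma> i 2 1 = - \<Gamma> i 1 2" "\<Gamma> i 3 1 = - \<Gamma> i 1 3" "\<Gamma> i 4 1 = - \<Gamma> i 1 4"
    "\<Gamma> i 3 2 = - \<Gamma> i 2 3" "\<Gamma> i 4 2 = - \<Gamma> i 2 4" "\<Gamma> i 4 3 = - \<Gamma> i 3 4" for i
    by (rule \<Gamma>)+
  have br: "H p (lie_bracket A (E i) (E j) p) (E k p) (E l p) = (\<Sum>a\<in>UNIV. (\<Gamma> i j a - \<Gamma> j i a) * h a k l)" for i j k l
  proof -
    have "lie_bracket A (E i) (E j) p \<in> tangent A p"
      using smooth_field_tangent[OF smooth_lie_bracket[OF L'(1,2) U E E] pU] .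
    from linear_at_expand[OF on[OF pU] alternating_at_linear1[OF alt tE tE] this]
    show ?thesis
      unfolding torsion_freeD[OF L'(2) U E E pU] g_diff_left[OF tL tL tE] \<Gamma>_def h_def .
  qed
  have \<omega>L: "\<omega> p (L (E i) (E i) p) = (\<Sum>a\<in>UNIV. star a * \<Gamma> i i a)" for i
    unfolding \<omega>_def hodge3_frame[OF onb[OF pU] alt tL] \<Gamma>_def h_def ..
  have d1: "deriv_along A (E 1) (\<lambda>q. H q (E 2 q) (E 3 q) (E 4 q)) p = - deriv_along A (E 1) (\<lambda>q. \<omega> q (E 1 q)) p"
    and d3: "deriv_along A (E 3) (\<lambda>q. H q (E 1 q) (E 2 q) (E 4 q)) p = - deriv_along A (E 3) (\<lambda>q. \<omega> q (E 3 q)) p"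
    unfolding deriv_along_uminus[OF U s\<omega> pU, symmetric]
    by (rule deriv_along_cong[OF U smooth_fun_on_uminus[OF U s\<omega>] pU _ refl, symmetric],
        simp add: \<omega>E star_coeff_simps[OF on alt])+
  have d2: "deriv_along A (E 2) (\<lambda>q. H q (E 1 q) (E 3 q) (E 4 q)) p = deriv_along A (E 2) (\<lambda>q. \<omega> q (E 2 q)) p"
    and d4: "deriv_along A (E 4) (\<lambda>q. H q (E 1 q) (E 2 q) (E 3 q)) p = deriv_along A (E 4) (\<lambda>q. \<omega> q (E 4 q)) p"
    by (rule deriv_along_cong[OF U s\<omega> pU _ refl, symmetric], simp add: \<omega>E star_coeff_simps[OF on alt])+
  show ?thesis
    unfolding hodge_ext_deriv3_def Let_def ext_deriv3_def cov_deriv1_def E_def[symmetric] \<omega>_def[symmetric]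
      d1 d2 d3 d4 br \<omega>L sum_4 star_simps
    by (simp add: sorted \<Gamma>0 \<Gamma>s algebra_simps)
qed

lemma trace_free_ricci_eq:
  assumes L: "levi_civita A g L" and H: "three_form A H"
    and D: "affine_connection A D" and difD: "differ_by D L (weyl_form (hodge3 A g H))"
    and T: "affine_connection A T" and difT: "differ_by T L (\<lambda>p u v w. 1/2 * H p u v w)"
    and U: "open U" and X: "smooth_field_on A U X" and Y: "smooth_field_on A U Y" and p: "p \<in> U"
  shows "trace_free_part A g (symmetrization (metric_ricci A g D)) X Y p
    = trace_free_part A g (symmetrization (metric_ricci A g T)) X Y p
      + symmetrization (cov_deriv1 A T (hodge3 A g H)) X Y p + hodge_ext_deriv3 A g H p / 4 * g p (X p) (Y p)"
proof -
  define \<omega> where "\<omega> = hodge3 A g H"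
  have \<omega>: "one_form A \<omega>" unfolding \<omega>_def by (rule one_form_hodge3[OF H])
  have lin: "linear_at \<omega> p" using \<omega> one_form_iff by blast
  obtain V where V: "p \<in> V" "frame_on V (frame A g p)" by (rule frame_near)
  define E where "E = frame A g p"
  define W where "W = U \<inter> V"
  have W: "open W" "p \<in> W" "W \<subseteq> U" "W \<subseteq> V"
    using U p V frame_onD(1)[OF V(2)] by (auto simp: W_def)
  have fr: "frame_on W E"
    unfolding E_def by (rule frame_on_subset[OF V(2) W(1,4)])
  note E = frame_onD(2)[OF fr] and on = frame_onD(4)[OF fr W(2)]
  have XW: "smooth_field_on A W X" and YW: "smooth_field_on A W Y"
    using smooth_field_on_subset X Y W(3) by blast+
  have L': "affine_connection A L" using L by (simp add: levi_civita_def)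
  have alt: "alternating_at H p" using H three_form_iff by blast
  note bT = trilinear_three_form[OF H, of "1/2"]
  define \<delta> where "\<delta> = (\<Sum>i\<in>UNIV. cov_deriv1 A L \<omega> (E i) (E i) p)"
  have dH: "hodge_ext_deriv3 A g H p = - \<delta>"
    unfolding \<delta>_def \<omega>_def E_def by (rule hodge_ext_deriv3_eq[OF L H])
  have ric: "metric_ricci A g S X' Y' p = (\<Sum>i\<in>UNIV. g p (curvature A S (E i) X' Y' p) (E i p))" for S X' Y'
    by (simp add: metric_ricci_def Let_def E_def)
  have gs: "g p (Y' p) (X' p) = g p (X' p) (Y' p)"
    if "smooth_field_on A W X'" "smooth_field_on A W Y'" for X' Y'
    using g_sym smooth_field_tangent that W(2) by blast
  have N: "cov_deriv1 A T \<omega> X' Y' p + cov_deriv1 A T \<omega> Y' X' p = cov_deriv1 A L \<omega> X' Y' p + cov_deriv1 A L \<omega> Y' X' p"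
    if X': "smooth_field_on A W X'" and Y': "smooth_field_on A W Y'" for X' Y'
  proof -
    have t: "X' p \<in> tangent A p" "Y' p \<in> tangent A p"
      using smooth_field_tangent X' Y' W(2) by blast+
    let ?r = "raise (\<lambda>p u v w. 1/2 * H p u v w) p"
    have r: "?r (Y' p) (X' p) = - ?r (X' p) (Y' p)"
    proof (rule raise_eqI[OF bT t(2,1)])
      show "- ?r (X' p) (Y' p) \<in> tangent A p" by (rule tangent_uminus[OF raise_tangent])
      show "g p (- ?r (X' p) (Y' p)) w = 1/2 * H p (Y' p) (X' p) w" if "w \<in> tangent A p" for w
        unfolding g_uminus_left[OF raise_tangent that] g_raise[OF bT t that]
        using alternating_at_swap12[OF alt t that] by simp
    qed
    show ?thesis
      unfolding cov_deriv1_def connection_eq_add_raise[OF L T bT difT fr X' Y' W(2)]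
        connection_eq_add_raise[OF L T bT difT fr Y' X' W(2)] r
        linear_at_add[OF lin connection_tangent[OF L' W(1) X' Y' W(2)] raise_tangent]
        linear_at_add[OF lin connection_tangent[OF L' W(1) Y' X' W(2)] tangent_uminus[OF raise_tangent]]
        linear_at_uminus_arg[OF lin raise_tangent] by simp
  qed
  have main: "symmetrization (metric_ricci A g D) X' Y' p = symmetrization (metric_ricci A g T) X' Y' p
      + symmetrization (cov_deriv1 A T \<omega>) X' Y' p + 1/2 * \<delta> * g p (X' p) (Y' p)"
    if X': "smooth_field_on A W X'" and Y': "smooth_field_on A W Y'" for X' Y'
    using ricci_weyl[OF L D \<omega> difD[folded \<omega>_def] fr X' Y' W(2)] ricci_weyl[OF L D \<omega> difD[folded \<omega>_def] fr Y' X' W(2)]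
      ricci_skew[OF L T H difT fr X' Y' W(2), folded \<omega>_def] N[OF X' Y']
    unfolding symmetrization_def ric \<delta>_def[symmetric] gs[OF X' Y'] by (simp add: algebra_simps)
  have tr: "metric_trace A g (symmetrization (metric_ricci A g D)) p
      = metric_trace A g (symmetrization (metric_ricci A g T)) p + 3 * \<delta>"
  proof -
    have "(\<Sum>i\<in>UNIV. symmetrization (cov_deriv1 A T \<omega>) (E i) (E i) p) = \<delta>"
      unfolding \<delta>_def symmetrization_def N[OF E E] by simp
    moreover have "(\<Sum>i\<in>(UNIV::4 set). 1/2 * \<delta> * g p (E i p) (E i p)) = 2 * \<delta>"
      by (simp add: orthonormal_g[OF on])
    ultimately show ?thesis
      unfolding metric_trace_def Let_def E_def[symmetric] main[OF E E] sum.distrib by simp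
  qed
  show ?thesis
    unfolding trace_free_part_def tr main[OF XW YW] dH \<omega>_def[symmetric] by (simp add: field_simps)
qed

lemma trace_free_affine_ricci:
  assumes D: "affine_connection A D" "torsion_free A D" and U: "open U"
    and X: "smooth_field_on A U X" and Y: "smooth_field_on A U Y" and p: "p \<in> U"
  shows "trace_free_part A g (symmetrization (affine_ricci A D)) X Y p
    = trace_free_part A g (symmetrization (metric_ricci A g D)) X Y p"
proof -
  obtain V where V: "p \<in> V" "frame_on V (frame A g p)" by (rule frame_near)
  have "affine_ricci A D (frame A g p i) (frame A g p i) p = metric_ricci A g D (frame A g p i) (frame A g p i) p" for i
    by (rule affine_ricci_eq_metric_ricci[OF D frame_onD(1)[OF V(2)] frame_onD(2)[OF V(2)] frame_onD(2)[OF V(2)] V(1)])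
  then show ?thesis
    by (simp add: trace_free_part_def metric_trace_def Let_def symmetrization_def
        affine_ricci_eq_metric_ricci[OF D U X Y p] affine_ricci_eq_metric_ricci[OF D U Y X p])
qed

lemma metric_deriv_eq_cong:
  assumes "metric_deriv_eq A D g \<omega>" "\<And>p v. v \<in> tangent A p \<Longrightarrow> \<omega> p v = \<theta> p v"
  shows "metric_deriv_eq A D g \<theta>"
  unfolding metric_deriv_eq_def
proof (intro allI impI ballI)
  fix U X Y Z p assume a: "open U" "smooth_field_on A U X" "smooth_field_on A U Y" "smooth_field_on A U Z" "p \<in> U"
  have "metric_deriv A D g X Y Z p = \<omega> p (X p) * g p (Y p) (Z p)"
    using assms(1)[unfolded metric_deriv_eq_def, rule_format, OF a] .
  then show "metric_deriv A D g X Y Z p = \<theta> p (X p) * g p (Y p) (Z p)"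
    using assms(2)[OF smooth_field_tangent[OF a(2,5)]] by simp
qed

lemma conformal_metric_deriv_eq:
  assumes D: "affine_connection A D" and \<omega>: "metric_deriv_eq A D g \<omega>" and f: "smooth_fun_on A UNIV f"
    and g': "\<And>p u v. u \<in> tangent A p \<Longrightarrow> v \<in> tangent A p \<Longrightarrow> g' p u v = exp (f p) * g p u v"
  shows "metric_deriv_eq A D g' (\<lambda>p v. \<omega> p v + differential f p v)"
  unfolding metric_deriv_eq_def
proof (intro allI impI ballI)
  fix U X Y Z p assume U: "open U" and X: "smooth_field_on A U X" and Y: "smooth_field_on A U Y"
    and Z: "smooth_field_on A U Z" and p: "p \<in> U"
  note f = smooth_fun_on_subset[OF f subset_UNIV, of U]
  have t: "Y q \<in> tangent A q" "Z q \<in> tangent A q" if "q \<in> U" for q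
    using smooth_field_tangent Y Z that by blast+
  have tD: "D X Y p \<in> tangent A p" "D X Z p \<in> tangent A p"
    using connection_tangent[OF D U X _ p] Y Z by blast+
  have e: "smooth_fun_on A U (\<lambda>q. exp (f q) * g q (Y q) (Z q))"
    by (intro smooth_fun_on_mult U smooth_fun_on_exp f smooth_g Y Z)
  have "deriv_along A X (\<lambda>q. g' q (Y q) (Z q)) p = deriv_along A X (\<lambda>q. exp (f q) * g q (Y q) (Z q)) p"
    by (rule deriv_along_cong[OF U e p _ refl, symmetric]) (simp add: g' t)
  also have "\<dots> = exp (f p) * deriv_along A X f p * g p (Y p) (Z p)
      + exp (f p) * (\<omega> p (X p) * g p (Y p) (Z p) + g p (D X Y p) (Z p) + g p (Y p) (D X Z p))"
    unfolding deriv_along_mult[OF U smooth_fun_on_exp[OF U f] smooth_g[OF U Y Z] p] deriv_along_exp[OF U f p]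
      metric_deriv_eqD[OF \<omega> U X Y Z p] ..
  finally show "metric_deriv A D g' X Y Z p = (\<omega> p (X p) + differential f p (X p)) * g' p (Y p) (Z p)"
    unfolding metric_deriv_def differential_field g'[OF t[OF p]] g'[OF tD(1) t(2)[OF p]] g'[OF t(1)[OF p] tD(2)]
    by (simp add: algebra_simps)
qed

lemma trace_free_conformal:
  assumes g': "riemannian_metric A g'" and f: "\<And>p u v. u \<in> tangent A p \<Longrightarrow> v \<in> tangent A p \<Longrightarrow> g' p u v = exp (f p) * g p u v"
    and zero: "\<And>U X Y. open U \<Longrightarrow> smooth_field_on A U X \<Longrightarrow> smooth_field_on A U Y \<Longrightarrow> p \<in> U \<Longrightarrow>
      trace_free_part A g R X Y p = 0"
    and U: "open U" and X: "smooth_field_on A U X" and Y: "smooth_field_on A U Y" and p: "p \<in> U"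
  shows "trace_free_part A g' R X Y p = 0"
proof -
  interpret g': riemannian_manifold A g' by unfold_locales (rule g')
  define \<mu> where "\<mu> = metric_trace A g R p / 4"
  have R: "R X Y p = \<mu> * exp (- f p) * g' p (X p) (Y p)"
    if "open U" "smooth_field_on A U X" "smooth_field_on A U Y" "p \<in> U" for U X Y
    using zero[OF that] f[OF smooth_field_tangent[OF that(2,4)] smooth_field_tangent[OF that(3,4)]]
    by (simp add: trace_free_part_def \<mu>_def exp_minus field_simps)
  obtain V where V: "p \<in> V" "g'.frame_on V (frame A g' p)" by (rule g'.frame_near)
  have "R (frame A g' p i) (frame A g' p i) p = \<mu> * exp (- f p)" for i
    using R[OF g'.frame_onD(1)[OF V(2)] g'.frame_onD(2)[OF V(2)] g'.frame_onD(2)[OF V(2)] V(1)]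
      g'.orthonormal_g[OF g'.orthonormal_frame] by simp
  then have "metric_trace A g' R p = 4 * (\<mu> * exp (- f p))"
    by (simp add: metric_trace_def Let_def)
  then show ?thesis
    using R[OF U X Y p] by (simp add: trace_free_part_def)
qed

lemma differ_by_weyl:
  assumes "affine_connection A D" "torsion_free A D" "metric_deriv_eq A D g \<omega>" "levi_civita A g L"
  shows "differ_by D L (weyl_form \<omega>)"
  unfolding differ_by_def using connection_weyl_form[OF assms] by blast

lemma ex1_weyl_connection:
  assumes L: "levi_civita A g L" and \<omega>: "one_form A \<omega>"
  shows "\<exists>!D. affine_connection A D \<and> torsion_free A D \<and> metric_deriv_eq A D g \<omega>"
proof (rule ex1I[of _ "perturb L (weyl_form \<omega>)"])
  have L': "affine_connection A L" "torsion_free A L" "metric_deriv_eq A L g (\<lambda>_ _. 0)"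
    using L by (auto simp: levi_civita_def)
  show *: "affine_connection A (perturb L (weyl_form \<omega>)) \<and> torsion_free A (perturb L (weyl_form \<omega>)) \<and>
      metric_deriv_eq A (perturb L (weyl_form \<omega>)) g \<omega>"
    using affine_perturb[OF L'(1) trilinear_weyl_form[OF \<omega>]] torsion_free_perturb_weyl[OF L'(2) \<omega>]
      metric_deriv_eq_perturb_weyl[OF L'(1,3) \<omega>] by simp
  fix D assume D: "affine_connection A D \<and> torsion_free A D \<and> metric_deriv_eq A D g \<omega>"
  have d: "differ_by D L (weyl_form \<omega>)" "differ_by (perturb L (weyl_form \<omega>)) L (weyl_form \<omega>)"
    using differ_by_weyl[OF _ _ _ L] D * by blast+
  show "D = perturb L (weyl_form \<omega>)"
    by (rule connection_eqI) (use D * differ_byD[OF d(1)] differ_byD[OF d(2)] in \<open>blast, blast, simp\<close>)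
qed

lemma skew_torsion_connection_iff:
  "skew_torsion_connection A g H T \<longleftrightarrow>
    affine_connection A T \<and> (\<exists>L. levi_civita A g L \<and> differ_by T L (\<lambda>p u v w. 1/2 * H p u v w))"
  unfolding skew_torsion_connection_def differ_by_def ..

lemma einstein_weyl_of_einstein_skew_torsion:
  assumes ES: "einstein_skew_torsion A g H"
    and D: "affine_connection A D" "torsion_free A D" "metric_deriv_eq A D g (hodge3 A g H)"
  shows "einstein_weyl A (conformal_class A g) D"
proof -
  note ES = ES[unfolded einstein_skew_torsion_def]
  have H: "three_form A H" using ES by (rule conjunct1[OF conjunct2])
  from ES obtain T where T: "skew_torsion_connection A g H T \<and> (\<forall>U X Y. open U \<longrightarrow>
      smooth_field_on A U X \<longrightarrow> smooth_field_on A U Y \<longrightarrow> (\<forall>p\<in>U.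
      trace_free_part A g (symmetrization (metric_ricci A g T)) X Y p
       + symmetrization (cov_deriv1 A T (hodge3 A g H)) X Y p + hodge_ext_deriv3 A g H p / 4 * g p (X p) (Y p) = 0))"
    by (elim conjE exE) (rule that, rule conjI)
  note es = T[THEN conjunct2, rule_format]
  from T obtain L where L: "levi_civita A g L" and T': "affine_connection A T"
    and difT: "differ_by T L (\<lambda>p u v w. 1/2 * H p u v w)"
    unfolding skew_torsion_connection_iff by (elim conjE exE) (rule that)
  have zero: "trace_free_part A g (symmetrization (affine_ricci A D)) X Y p = 0"
    if "open U" "smooth_field_on A U X" "smooth_field_on A U Y" "p \<in> U" for U X Y p
    unfolding trace_free_affine_ricci[OF D(1,2) that]
      trace_free_ricci_eq[OF L H D(1) differ_by_weyl[OF D L] T' difT that] by (rule es[OF that])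
  show ?thesis
    unfolding einstein_weyl_def weyl_connection_def
  proof (intro conjI ballI allI impI D)
    show "conformal_structure A (conformal_class A g)"
      unfolding conformal_structure_def using metric by blast
  next
    fix g' assume "g' \<in> conformal_class A g"
    then obtain f where g': "riemannian_metric A g'" and f: "smooth_fun_on A UNIV f"
      and e: "\<And>p u v. u \<in> tangent A p \<Longrightarrow> v \<in> tangent A p \<Longrightarrow> g' p u v = exp (f p) * g p u v"
      unfolding conformal_class_def by blast
    show "\<exists>\<omega>. one_form A \<omega> \<and> metric_deriv_eq A D g' \<omega>"
      using one_form_add[OF one_form_hodge3[OF H] one_form_differential[OF f]]
        conformal_metric_deriv_eq[OF D(1,3) f e] by blast
    fix U X Y p assume U: "open U" "smooth_field_on A U X" "smooth_field_on A U Y" "p \<in> U"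
    show "trace_free_part A g' (symmetrization (affine_ricci A D)) X Y p = 0"
      by (rule trace_free_conformal[OF g' e zero U])
  qed
qed

lemma einstein_skew_torsion_of_einstein_weyl:
  assumes D: "affine_connection A D" "torsion_free A D" "metric_deriv_eq A D g \<omega>" and \<omega>: "one_form A \<omega>"
    and ew: "\<And>U X Y p. open U \<Longrightarrow> smooth_field_on A U X \<Longrightarrow> smooth_field_on A U Y \<Longrightarrow> p \<in> U \<Longrightarrow>
      trace_free_part A g (symmetrization (affine_ricci A D)) X Y p = 0"
  shows "einstein_skew_torsion A g (- hodge1 A g \<omega>)"
proof -
  define H where "H = - hodge1 A g \<omega>"
  have H: "three_form A H" unfolding H_def by (rule three_form_minus_hodge1[OF \<omega>])
  define L where "L = perturb D (weyl_form (\<lambda>p v. - \<omega> p v))"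
  note m\<omega> = one_form_uminus[OF \<omega>]
  have L: "levi_civita A g L"
    unfolding levi_civita_def L_def
    using affine_perturb[OF D(1) trilinear_weyl_form[OF m\<omega>]] torsion_free_perturb_weyl[OF D(2) m\<omega>]
      metric_deriv_eq_perturb_weyl[OF D(1,3) m\<omega>] by simp
  have L': "affine_connection A L" using L by (simp add: levi_civita_def)
  define T where "T = perturb L (\<lambda>p u v w. 1/2 * H p u v w)"
  note b = trilinear_three_form[OF H, of "1/2"]
  have T: "affine_connection A T" unfolding T_def by (rule affine_perturb[OF L' b])
  have difT: "differ_by T L (\<lambda>p u v w. 1/2 * H p u v w)"
    unfolding differ_by_def T_def using g_perturb[OF L' b] by blast
  have D3: "metric_deriv_eq A D g (hodge3 A g H)"
    by (rule metric_deriv_eq_cong[OF D(3)]) (simp add: H_def hodge3_minus_hodge1[OF \<omega>])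
  have "skew_torsion_connection A g H T"
    unfolding skew_torsion_connection_iff using T L difT by blast
  moreover have "trace_free_part A g (symmetrization (metric_ricci A g T)) X Y p
       + symmetrization (cov_deriv1 A T (hodge3 A g H)) X Y p + hodge_ext_deriv3 A g H p / 4 * g p (X p) (Y p) = 0"
    if "open U" "smooth_field_on A U X" "smooth_field_on A U Y" "p \<in> U" for U X Y p
    using ew[OF that] unfolding trace_free_affine_ricci[OF D(1,2) that]
      trace_free_ricci_eq[OF L H D(1) differ_by_weyl[OF D(1,2) D3 L] T difT that] .
  ultimately show ?thesis
    unfolding einstein_skew_torsion_def H_def[symmetric] using metric H by blast
qed

end

theorem theorem4p10:
  fixes A :: "('m::{t2_space, second_countable_topology}) atlas"
  assumes "oriented_atlas A" and "compact (UNIV :: 'm set)"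
  shows "(\<forall>g H. einstein_skew_torsion A g H \<longrightarrow>
            (\<exists>!D. affine_connection A D \<and> torsion_free A D \<and> metric_deriv_eq A D g (hodge3 A g H)) \<and>
            (\<forall>D. affine_connection A D \<and> torsion_free A D \<and> metric_deriv_eq A D g (hodge3 A g H) \<longrightarrow>
               einstein_weyl A (conformal_class A g) D)) \<and>
         (\<forall>C D. einstein_weyl A C D \<longrightarrow>
            (\<forall>g\<in>C. \<forall>\<omega>. one_form A \<omega> \<and> metric_deriv_eq A D g \<omega> \<longrightarrow>
               einstein_skew_torsion A g (- hodge1 A g \<omega>)))"
proof (intro conjI allI impI ballI)
  fix g H assume ES: "einstein_skew_torsion A g H"
  then have g: "riemannian_metric A g" and H: "three_form A H"
    by (simp_all add: einstein_skew_torsion_def)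
  interpret riemannian_manifold A g
    by unfold_locales (rule assms(1), rule g)
  from ES obtain T where "skew_torsion_connection A g H T"
    unfolding einstein_skew_torsion_def by (elim conjE exE) (rule that)
  then obtain L where L: "levi_civita A g L"
    unfolding skew_torsion_connection_iff by (elim conjE exE) (rule that)
  show "\<exists>!D. affine_connection A D \<and> torsion_free A D \<and> metric_deriv_eq A D g (hodge3 A g H)"
    by (rule ex1_weyl_connection[OF L one_form_hodge3[OF H]])
  show "einstein_weyl A (conformal_class A g) D"
    if "affine_connection A D \<and> torsion_free A D \<and> metric_deriv_eq A D g (hodge3 A g H)" for D
    using einstein_weyl_of_einstein_skew_torsion[OF ES] that by blast
next
  fix C D g \<omega> assume EW: "einstein_weyl A C D" and gC: "g \<in> C"
    and \<omega>: "one_form A \<omega> \<and> metric_deriv_eq A D g \<omega>"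
  note EW = EW[unfolded einstein_weyl_def weyl_connection_def]
  have "conformal_structure A C" using EW by (rule conjunct1)
  then obtain g\<^sub>0 where "C = conformal_class A g\<^sub>0"
    unfolding conformal_structure_def by (elim exE conjE) (rule that)
  then have g: "riemannian_metric A g"
    using gC by (simp add: conformal_class_def)
  interpret riemannian_manifold A g
    by unfold_locales (rule assms(1), rule g)
  have D: "affine_connection A D" "torsion_free A D"
    using EW by simp_all
  note ew = EW[THEN conjunct2, THEN conjunct2, rule_format, OF gC]
  show "einstein_skew_torsion A g (- hodge1 A g \<omega>)"
    by (rule einstein_skew_torsion_of_einstein_weyl[OF D \<omega>[THEN conjunct2] \<omega>[THEN conjunct1] ew])
qed

end
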